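(* ($q$-Hahn / dual $q$-Hahn.) Let $N\ge1$ and let $q,m^\star,s^\star,r,\mu,\sigma,\rho\in\mathbb{C}$, $q\neq0$. For $j=0,\dots,N$ let $\Phi_j=(t_x,t_x^\star(j),x=0,\dots,N-j;\ f_x(j),g_x(j),x=1,\dots,N-j)$ with $$t_x=q^{-x}-1,\qquad t^\star_x(j)=m^\star q^{N-j}(q^{-x}-1)(1-s^\star q^{j+x+1}),$$ $$f_x(j)=m^\star q^{N-j+1-2x}(1-q^x)(1-q^{x-N+j-1})(1-rq^x),$$ $$g_x(j)=-m^\star q^{N-j+1-x}(1-q^x)(1-q^{x-N+j-1})(r-s^\star q^{x+j}),$$ and for $x=0,\dots,N$ let $\Psi_x=(\theta_j(x),\theta_j^\star,j=0,\dots,N-x;\ \varphi_j(x),\phi_j(x),j=1,\dots,N-x)$ with $$\theta_j(x)=\mu q^{N-x}(q^{-j}-1)(1-\sigma q^{x+j+1}),\qquad\theta^\star_j=q^{-j}-1,$$ $$\varphi_j(x)=\mu q^{N-x+1-2j}(1-q^j)(1-q^{j-N+x-1})(1-\rho q^j),$$ $$\phi_j(x)=\mu q^{2N-2x+2-2j}(1-q^j)(1-q^{j-N+x-1})(\sigma q^x-\rho q^{j-N+x-1}).$$ Assume the parameters are such that all $\Phi_j$ and all $\Psi_x$ are parameter arrays, and that $r\ne0$, $\sigma\neq0$. Then the pair $(\Phi_j,\Psi_x)$ is associated to a factorized $A_2$-Leonard pair: there exist a $\mathbb{C}$-vector space $V$ of dimension $\binom{N+2}{2}$, a factorized $A_2$-Leonard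 pair on $V$ with basis $(X,Y;X^\star,Y^\star)$, and nonzero vectors $V_{x,y}\in V_{(x,y)}$, $V^\star_{i,j}\in V^\star_{(i,j)}$ such that $XV_{x,y}=t_xV_{x,y}$, $YV_{x,y}=\theta_y(x)V_{x,y}$, $X^\star V^\star_{i,j}=t^\star_i(j)V^\star_{i,j}$, $Y^\star V^\star_{i,j}=\theta^\star_jV^\star_{i,j}$ and $V^\star_{i,j}=\sum_{x=0}^{N-j}\sum_{y=0}^{N-x}T_{i,j}(x,y)V_{x,y}$, where $$T_{i,j}(x,y)=\frac{(-1)^jq^{\frac j2(j-3-2N)}(rq;q)_i(s^\star q^{j+2};q)_{N-j}(\rho q;q)_j}{(rq)^i(s^\star q^{j+1}/r;q)_i(s^\star q^{i+j+1};q)_i(s^\star q^{2+2i+j};q)_{N-i-j}\,\sigma^j(q^{-N}\rho/\sigma;q)_j}\begin{bmatrix} N-j \\ i \end{bmatrix}_q\begin{bmatrix} N-x \\ j \end{bmatrix}_q\times{}_3\phi_2\!\left({q^{-i},\ q^{-x},\ s^\star q^{i+j+1}\atop rq,\ q^{-N+j}};q,q\right){}_3\phi_2\!\left({q^{-j},\ q^{-y},\ \sigma q^{x+y+1}\atop\rho q,\ q^{-N+x}};q,q\right).$$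
   Context: **Factorized $A_2$-Leonard pairs.** $N\ge1$ is an integer, $\mathcal D=\{(x,y)\in\mathbb{Z}_{\ge0}^2 : x+y\le N\}$, $A_2=\{(0,0),(1,-1),(1,0),(0,1),(-1,1),(-1,0),(0,-1)\}$; $\lambda,\chi\in\mathcal D$ are adjacent if $\lambda-\chi\in A_2$. Let $V$ be a $\mathbb{C}$-vector space. $(H,H^\star)$ is an $A_2$-Leonard pair on $\mathcal D$ if: (i) $H$ and (ii) $H^\star$ are two-dimensional subspaces of $\mathrm{End}(V)$, each consisting of diagonalizable, mutually commuting elements; (iii) there is a bijection $\lambda\mapsto V_\lambda$ from $\mathcal D$ to the common eigenspaces of $H$ with $H^\star V_\lambda\subseteq\sum_{\chi\in\mathcal D,\ \chi\text{ adjacent to }\lambda}V_\chi$; (iv) there is a bijection $\lambda\mapsto V^\star_\lambda$ from $\mathcal D$ to the common eigenspaces of $H^\star$ with $HV^\star_\lambda\subseteq\sum_{\chi\in\mathcal D,\ \chi\text{ adjacent to }\lambda}V^\star_\chi$; (v) there is no subspace $W\neq 0,V$ of $V$ with $HW\subseteq W$ and $H^\star W\subseteq W$; (vi) $\dim V_\lambda=\dim V^\star_\lambda=1$ for all $\lambda\in\mathcal D$; (vii) there is a non-degenerate symmetric bilinear form $\langle\,,\rangle$ on $V$ with $\langle V_\lambda,V_\chi\rangle=0=\langle V^\star_\lambda,V^\star_\chi\rangle$ for $\lambda\ne\chi$. It is a *factorized* $A_2$-Leonard pair with basis $(X,Y;X^\star,Y^\star)$ if moreover $X,Y$ is a basis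 of $H$, $X^\star,Y^\star$ is a basis of $H^\star$, and: (viii) $X$ acts on $V_{(x,y)}$ as a scalar $t_x$ and $Y^\star$ acts on $V^\star_{(i,j)}$ as a scalar $\theta^\star_j$, the $t_x$ ($0\le x\le N$) being pairwise distinct and the $\theta^\star_j$ ($0\le j\le N$) pairwise distinct; (ix) $[X,Y^\star]=0$; (x) each common eigenspace of $X$ and $Y^\star$ has dimension one; (xi) $\langle V^\star_{(i+1,j)},XV^\star_{(i,j)}\rangle\ne0$ and $\langle V^\star_{(i,j)},XV^\star_{(i+1,j)}\rangle\neq0$ for $(i,j),(i+1,j)\in\mathcal D$, and $\langle V_{(x,y+1)},Y^\star V_{(x,y)}\rangle\ne0$ and $\langle V_{(x,y)},Y^\star V_{(x,y+1)}\rangle\ne0$ for $(x,y),(x,y+1)\in\mathcal D$ (for subspaces, $\langle U,W\rangle\neq0$ means the form is not identically zero on $U\times W$). **Parameter arrays.** A parameter array of diameter $d\ge0$ is a tuple $(\theta_i,\theta^\star_i,i=0,\dots,d;\varphi_j,\phi_j,j=1,\dots,d)$ of complex numbers such that: all $\varphi_i,\phi_i$ are nonzero; the $\theta_i$ are pairwise distinct and the $\theta_i^\star$ are pairwise distinct; for $1\le i\le d$, with $\vartheta_i=\sum_{h=0}^{i-1}\frac{\theta_h-\theta_{d-h}}{\theta_0-\theta_d}$, one has $\varphi_i=\phi_1\vartheta_i+(\theta^\star_i-\theta^\star_0)(\theta_{i-1}-\theta_d)$ and $\phi_i=\varphi_1\vartheta_i+(\theta^\star_i-\theta^\star_0)(\theta_{d-i+1}-\theta_0)$;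 and $\frac{\theta_{i-2}-\theta_{i+1}}{\theta_{i-1}-\theta_i}$ and $\frac{\theta^\star_{i-2}-\theta^\star_{i+1}}{\theta^\star_{i-1}-\theta^\star_i}$ are equal and independent of $i$ for $2\le i\le d-1$. For the arrays in the claim this amounts to the non-vanishing and distinctness conditions (in particular $q^k\ne1$ for $1\le k\le N$). **Notation.** $(a;q)_i=\prod_{k=0}^{i-1}(1-aq^k)$; $\begin{bmatrix} n \\ i \end{bmatrix}_q=\frac{(q;q)_n}{(q;q)_i(q;q)_{n-i}}$; ${}_3\phi_2\left({a_1,a_2,a_3\atop b_1,b_2};q,q\right)=\sum_k\frac{(a_1;q)_k(a_2;q)_k(a_3;q)_k}{(b_1;q)_k(b_2;q)_k(q;q)_k}q^k$, here a finite sum over $k=0,\dots,\min(i,x)$ (resp. $\min(j,y)$). *)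

theory Defs
  imports Complex_Main "HOL-Library.Function_Algebras"
begin

section \<open>Endomorphisms of a subspace\<close>

text \<open>
  A vector space is rendered as a subspace \<open>V\<close> of an ambient type, because its dimension has to
  depend on a natural number. \<open>pointwise\<close> is the scaling both of the concrete function space used
  as ambient space and of the space of endomorphisms.
\<close>

definition pointwise :: "('k \<Rightarrow> 'v \<Rightarrow> 'v) \<Rightarrow> 'k \<Rightarrow> ('i \<Rightarrow> 'v) \<Rightarrow> 'i \<Rightarrow> 'v" where
  "pointwise s c f = (\<lambda>i. s c (f i))"

lemma vector_space_pointwise:
  assumes "vector_space s"
  shows "vector_space (pointwise s)"
proof -
  interpret vector_space s by fact
  show ?thesis
    by unfold_locales
      (auto simp: pointwise_def fun_eq_iff plus_fun_def scale_right_distrib scale_left_distrib)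
qed

locale complex_space = vector_space scale
  for scale :: "complex \<Rightarrow> 'v::ab_group_add \<Rightarrow> 'v" (infixr \<open>*s\<close> 75)
begin

text \<open>
  Endomorphisms of \<open>V\<close> are extended by \<open>0\<close> outside \<open>V\<close>, so that each has exactly one
  representative and \<open>endos V\<close> is a vector space under \<open>pointwise scale\<close>.
\<close>

definition endos :: "'v set \<Rightarrow> ('v \<Rightarrow> 'v) set" where
  "endos V = {f. f ` V \<subseteq> V \<and> (\<forall>u\<in>V. \<forall>v\<in>V. f (u + v) = f u + f v) \<and>
     (\<forall>c. \<forall>v\<in>V. f (c *s v) = c *s f v) \<and> (\<forall>v. v \<notin> V \<longrightarrow> f v = 0)}"

definition diagonalizable :: "'v set \<Rightarrow> ('v \<Rightarrow> 'v) \<Rightarrow> bool" where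
  "diagonalizable V f \<longleftrightarrow>
     (\<exists>B. independent B \<and> span B = V \<and> (\<forall>b\<in>B. \<exists>c. f b = c *s b))"

definition common_eigenspaces :: "'v set \<Rightarrow> ('v \<Rightarrow> 'v) set \<Rightarrow> 'v set set" where
  "common_eigenspaces V F =
     {W. W \<noteq> {0} \<and> (\<exists>w. W = {v \<in> V. \<forall>f\<in>F. f v = w f *s v})}"

definition commuting_diagonalizable_plane :: "'v set \<Rightarrow> ('v \<Rightarrow> 'v) set \<Rightarrow> bool" where
  "commuting_diagonalizable_plane V H \<longleftrightarrow>
     H \<subseteq> endos V \<and> module.subspace (pointwise scale) H \<and>
     vector_space.dim (pointwise scale) H = 2 \<and>
     (\<forall>f\<in>H. diagonalizable V f) \<and> (\<forall>f\<in>H. \<forall>g\<in>H. f \<circ> g = g \<circ> f)"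

definition basis_pair :: "('v \<Rightarrow> 'v) \<Rightarrow> ('v \<Rightarrow> 'v) \<Rightarrow> ('v \<Rightarrow> 'v) set \<Rightarrow> bool" where
  "basis_pair X Y H \<longleftrightarrow> X \<noteq> Y \<and> \<not> module.dependent (pointwise scale) {X, Y} \<and>
     module.span (pointwise scale) {X, Y} = H"

definition nondeg_symmetric_form :: "'v set \<Rightarrow> ('v \<Rightarrow> 'v \<Rightarrow> complex) \<Rightarrow> bool" where
  "nondeg_symmetric_form V B \<longleftrightarrow>
     (\<forall>u\<in>V. \<forall>v\<in>V. B u v = B v u) \<and>
     (\<forall>u\<in>V. \<forall>v\<in>V. \<forall>w\<in>V. B (u + v) w = B u w + B v w) \<and>
     (\<forall>c. \<forall>u\<in>V. \<forall>v\<in>V. B (c *s u) v = c * B u v) \<and>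
     (\<forall>u\<in>V. (\<forall>v\<in>V. B u v = 0) \<longrightarrow> u = 0)"

end

definition form_vanishes :: "('v \<Rightarrow> 'v \<Rightarrow> complex) \<Rightarrow> 'v set \<Rightarrow> 'v set \<Rightarrow> bool" where
  "form_vanishes B U W \<longleftrightarrow> (\<forall>u\<in>U. \<forall>w\<in>W. B u w = 0)"


section \<open>Factorized \<open>A\<^sub>2\<close>-Leonard pairs\<close>

definition triangle :: "nat \<Rightarrow> (nat \<times> nat) set" where
  "triangle N = {(x, y). x + y \<le> N}"

definition A2 :: "(int \<times> int) set" where
  "A2 = {(0, 0), (1, -1), (1, 0), (0, 1), (-1, 1), (-1, 0), (0, -1)}"

definition adjacent :: "nat \<times> nat \<Rightarrow> nat \<times> nat \<Rightarrow> bool" where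
  "adjacent l c \<longleftrightarrow> (int (fst l) - int (fst c), int (snd l) - int (snd c)) \<in> A2"

text \<open>
  The bijections \<open>\<lambda> \<mapsto> V\<^sub>\<lambda>\<close> (\<open>E\<close>), \<open>\<lambda> \<mapsto> V\<^sup>\<star>\<^sub>\<lambda>\<close> (\<open>Es\<close>) and the form \<open>B\<close> are parameters
  because the further axioms of a factorized pair refer to them; \<open>(H, Hs)\<close> is an
  \<open>A\<^sub>2\<close>-Leonard pair when such \<open>E\<close>, \<open>Es\<close>, \<open>B\<close> exist.
\<close>

locale A2_Leonard_pair = complex_space scale
  for scale :: "complex \<Rightarrow> 'v::ab_group_add \<Rightarrow> 'v" (infixr \<open>*s\<close> 75) +
  fixes N :: nat
    and V :: "'v set"
    and H Hs :: "('v \<Rightarrow> 'v) set"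
    and E Es :: "nat \<times> nat \<Rightarrow> 'v set"
    and B :: "'v \<Rightarrow> 'v \<Rightarrow> complex"
  assumes N_pos: "N \<ge> 1"
    and V_subspace: "subspace V"
    and H_plane: "commuting_diagonalizable_plane V H"
    and Hs_plane: "commuting_diagonalizable_plane V Hs"
    and E_bij: "bij_betw E (triangle N) (common_eigenspaces V H)"
    and Hs_E: "\<And>l h. l \<in> triangle N \<Longrightarrow> h \<in> Hs \<Longrightarrow>
      h ` E l \<subseteq> span (\<Union>c \<in> {c \<in> triangle N. adjacent c l}. E c)"
    and Es_bij: "bij_betw Es (triangle N) (common_eigenspaces V Hs)"
    and H_Es: "\<And>l h. l \<in> triangle N \<Longrightarrow> h \<in> H \<Longrightarrow>
      h ` Es l \<subseteq> span (\<Union>c \<in> {c \<in> triangle N. adjacent c l}. Es c)"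
    and irreducible: "\<not> (\<exists>W. subspace W \<and> W \<subseteq> V \<and> W \<noteq> {0} \<and> W \<noteq> V \<and>
      (\<forall>h\<in>H. h ` W \<subseteq> W) \<and> (\<forall>h\<in>Hs. h ` W \<subseteq> W))"
    and dim_E: "\<And>l. l \<in> triangle N \<Longrightarrow> dim (E l) = 1"
    and dim_Es: "\<And>l. l \<in> triangle N \<Longrightarrow> dim (Es l) = 1"
    and form: "nondeg_symmetric_form V B"
    and E_orthogonal: "\<And>l c. l \<in> triangle N \<Longrightarrow> c \<in> triangle N \<Longrightarrow> l \<noteq> c \<Longrightarrow>
      form_vanishes B (E l) (E c)"
    and Es_orthogonal: "\<And>l c. l \<in> triangle N \<Longrightarrow> c \<in> triangle N \<Longrightarrow> l \<noteq> c \<Longrightarrow>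
      form_vanishes B (Es l) (Es c)"

locale factorized_A2_Leonard_pair = A2_Leonard_pair scale N V H Hs E Es B
  for scale :: "complex \<Rightarrow> 'v::ab_group_add \<Rightarrow> 'v" (infixr \<open>*s\<close> 75)
    and N V H Hs E Es B +
  fixes X Y Xs Ys :: "'v \<Rightarrow> 'v"
  assumes X_Y_basis: "basis_pair X Y H"
    and Xs_Ys_basis: "basis_pair Xs Ys Hs"
    and X_scalar: "\<exists>t. inj_on t {0..N} \<and>
      (\<forall>x y. (x, y) \<in> triangle N \<longrightarrow> (\<forall>v \<in> E (x, y). X v = t x *s v))"
    and Ys_scalar: "\<exists>t. inj_on t {0..N} \<and>
      (\<forall>i j. (i, j) \<in> triangle N \<longrightarrow> (\<forall>v \<in> Es (i, j). Ys v = t j *s v))"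
    and X_Ys_commute: "X \<circ> Ys = Ys \<circ> X"
    and X_Ys_simple: "\<And>W. W \<in> common_eigenspaces V {X, Ys} \<Longrightarrow> dim W = 1"
    and X_raise: "\<And>i j. (i + 1, j) \<in> triangle N \<Longrightarrow>
      \<not> form_vanishes B (Es (i + 1, j)) (X ` Es (i, j))"
    and X_lower: "\<And>i j. (i + 1, j) \<in> triangle N \<Longrightarrow>
      \<not> form_vanishes B (Es (i, j)) (X ` Es (i + 1, j))"
    and Ys_raise: "\<And>x y. (x, y + 1) \<in> triangle N \<Longrightarrow>
      \<not> form_vanishes B (E (x, y + 1)) (Ys ` E (x, y))"
    and Ys_lower: "\<And>x y. (x, y + 1) \<in> triangle N \<Longrightarrow>
      \<not> form_vanishes B (E (x, y)) (Ys ` E (x, y + 1))"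

global_interpretation grid: complex_space
  "pointwise (*) :: complex \<Rightarrow> (nat \<times> nat \<Rightarrow> complex) \<Rightarrow> nat \<times> nat \<Rightarrow> complex"
  unfolding complex_space_def
  by (rule vector_space_pointwise) (unfold_locales; simp add: algebra_simps)


section \<open>Parameter arrays\<close>

definition parameter_array ::
  "nat \<Rightarrow> (nat \<Rightarrow> complex) \<Rightarrow> (nat \<Rightarrow> complex) \<Rightarrow> (nat \<Rightarrow> complex) \<Rightarrow> (nat \<Rightarrow> complex) \<Rightarrow> bool"
where
  "parameter_array d \<theta> \<theta>s vp ph \<longleftrightarrow>
     (\<forall>i\<in>{1..d}. vp i \<noteq> 0 \<and> ph i \<noteq> 0) \<and>
     inj_on \<theta> {0..d} \<and> inj_on \<theta>s {0..d} \<and>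
     (\<forall>i\<in>{1..d}.
        let vth = (\<Sum>h = 0..<i. (\<theta> h - \<theta> (d - h)) / (\<theta> 0 - \<theta> d))
        in vp i = ph 1 * vth + (\<theta>s i - \<theta>s 0) * (\<theta> (i - 1) - \<theta> d) \<and>
           ph i = vp 1 * vth + (\<theta>s i - \<theta>s 0) * (\<theta> (d - i + 1) - \<theta> 0)) \<and>
     (\<exists>\<beta>. \<forall>i\<in>{2..d - 1}.
        (\<theta> (i - 2) - \<theta> (i + 1)) / (\<theta> (i - 1) - \<theta> i) = \<beta> \<and>
        (\<theta>s (i - 2) - \<theta>s (i + 1)) / (\<theta>s (i - 1) - \<theta>s i) = \<beta>)"


section \<open>Basic hypergeometric notation\<close>

definition qpoch :: "complex \<Rightarrow> complex \<Rightarrow> nat \<Rightarrow> complex" where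
  "qpoch a q n = (\<Prod>k = 0..<n. 1 - a * q ^ k)"

definition qbinomial :: "complex \<Rightarrow> nat \<Rightarrow> nat \<Rightarrow> complex" where
  "qbinomial q n i = qpoch q q n / (qpoch q q i * qpoch q q (n - i))"

text \<open>
  The series \<open>\<^sub>3\<phi>\<^sub>2\<close> cut off after the index \<open>M\<close>: beyond the cut-off the lower parameters
  \<open>q\<^sup>-\<^sup>N\<^sup>+\<^sup>j\<close> could produce \<open>0 / 0\<close>.
\<close>

definition phi32 :: "nat \<Rightarrow> complex \<Rightarrow> complex \<Rightarrow> complex \<Rightarrow> complex \<Rightarrow> complex \<Rightarrow> complex \<Rightarrow>
    complex \<Rightarrow> complex" where
  "phi32 M a1 a2 a3 b1 b2 q z =
     (\<Sum>k = 0..M. (qpoch a1 q k * qpoch a2 q k * qpoch a3 q k) /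
        (qpoch b1 q k * qpoch b2 q k * qpoch q q k) * z ^ k)"


section \<open>The \<open>q\<close>-Hahn and dual \<open>q\<close>-Hahn data\<close>

definition t_eig :: "complex \<Rightarrow> nat \<Rightarrow> complex" where
  "t_eig q x = q powi (- int x) - 1"

definition tstar_eig :: "nat \<Rightarrow> complex \<Rightarrow> complex \<Rightarrow> complex \<Rightarrow> nat \<Rightarrow> nat \<Rightarrow> complex" where
  "tstar_eig N q ms ss j x =
     ms * q powi (int N - int j) * (q powi (- int x) - 1) * (1 - ss * q powi (int j + int x + 1))"

definition f_par :: "nat \<Rightarrow> complex \<Rightarrow> complex \<Rightarrow> complex \<Rightarrow> nat \<Rightarrow> nat \<Rightarrow> complex" where
  "f_par N q ms r j x =
     ms * q powi (int N - int j + 1 - 2 * int x) * (1 - q powi int x) *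
     (1 - q powi (int x - int N + int j - 1)) * (1 - r * q powi int x)"

definition g_par :: "nat \<Rightarrow> complex \<Rightarrow> complex \<Rightarrow> complex \<Rightarrow> complex \<Rightarrow> nat \<Rightarrow> nat \<Rightarrow> complex" where
  "g_par N q ms ss r j x =
     - ms * q powi (int N - int j + 1 - int x) * (1 - q powi int x) *
     (1 - q powi (int x - int N + int j - 1)) * (r - ss * q powi (int x + int j))"

definition theta_eig :: "nat \<Rightarrow> complex \<Rightarrow> complex \<Rightarrow> complex \<Rightarrow> nat \<Rightarrow> nat \<Rightarrow> complex" where
  "theta_eig N q \<mu> \<sigma> x j =
     \<mu> * q powi (int N - int x) * (q powi (- int j) - 1) * (1 - \<sigma> * q powi (int x + int j + 1))"

definition thetastar_eig :: "complex \<Rightarrow> nat \<Rightarrow> complex" where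
  "thetastar_eig q j = q powi (- int j) - 1"

definition varphi_par :: "nat \<Rightarrow> complex \<Rightarrow> complex \<Rightarrow> complex \<Rightarrow> nat \<Rightarrow> nat \<Rightarrow> complex" where
  "varphi_par N q \<mu> \<rho> x j =
     \<mu> * q powi (int N - int x + 1 - 2 * int j) * (1 - q powi int j) *
     (1 - q powi (int j - int N + int x - 1)) * (1 - \<rho> * q powi int j)"

definition phi_par :: "nat \<Rightarrow> complex \<Rightarrow> complex \<Rightarrow> complex \<Rightarrow> complex \<Rightarrow> nat \<Rightarrow> nat \<Rightarrow> complex" where
  "phi_par N q \<mu> \<sigma> \<rho> x j =
     \<mu> * q powi (2 * int N - 2 * int x + 2 - 2 * int j) * (1 - q powi int j) *
     (1 - q powi (int j - int N + int x - 1)) *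
     (\<sigma> * q powi int x - \<rho> * q powi (int j - int N + int x - 1))"

text \<open>
  The exponent \<open>(j/2) (j - 3 - 2N)\<close> is an integer since \<open>j (j - 3)\<close> is even, so \<open>div\<close> is exact.
\<close>

definition T_coeff :: "nat \<Rightarrow> complex \<Rightarrow> complex \<Rightarrow> complex \<Rightarrow> complex \<Rightarrow> complex \<Rightarrow>
    nat \<Rightarrow> nat \<Rightarrow> nat \<Rightarrow> nat \<Rightarrow> complex" where
  "T_coeff N q ss r \<sigma> \<rho> i j x y =
     ((-1) ^ j * q powi ((int j * (int j - 3 - 2 * int N)) div 2) *
      qpoch (r * q) q i * qpoch (ss * q ^ (j + 2)) q (N - j) * qpoch (\<rho> * q) q j) /
     ((r * q) ^ i * qpoch (ss * q ^ (j + 1) / r) q i * qpoch (ss * q ^ (i + j + 1)) q i *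
      qpoch (ss * q ^ (2 + 2 * i + j)) q (N - i - j) *
      \<sigma> ^ j * qpoch (q powi (- int N) * \<rho> / \<sigma>) q j) *
     qbinomial q (N - j) i * qbinomial q (N - x) j *
     phi32 (min i x) (q powi (- int i)) (q powi (- int x)) (ss * q ^ (i + j + 1))
       (r * q) (q powi (- int N + int j)) q q *
     phi32 (min j y) (q powi (- int j)) (q powi (- int y)) (\<sigma> * q ^ (x + y + 1))
       (\<rho> * q) (q powi (- int N + int x)) q q"

end

theory Submission
  imports Defs
begin

text \<open>
  Take \<open>V\<close> to be the functions on the triangle, with \<open>X\<close> and \<open>Y\<close> acting by multiplication, and let
  \<open>S\<close> be the product of two dual \<open>q\<close>-Hahn polynomials, normalised so that \<open>V\<^sup>\<star>\<^sub>i\<^sub>j\<close> is a nonzero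
  multiple of \<open>S\<^sub>i\<^sub>j\<close> and so that \<open>S\<close> is invariant under exchanging \<open>(i, j, s\<^sup>\<star>, r)\<close> with
  \<open>(y, x, \<sigma>, \<rho>)\<close>. Contiguity relations that shift the column \<open>x\<close> by one define operators \<open>B\<close>
  (raising) and \<open>D\<close> (lowering) which are mutually adjoint for an explicit weight.
  Then \<open>Y\<^sup>\<star> + 1 = q\<^sup>x\<^sup>-\<^sup>N (1 - B D)\<close>, and \<open>X\<^sup>\<star>\<close> is a combination of \<open>B\<close>, \<open>D\<close>, \<open>B D\<close> and \<open>1\<close> with
  coefficients depending on \<open>x\<close> only; that \<open>S\<^sub>i\<^sub>j\<close> is an eigenvector of \<open>X\<^sup>\<star>\<close> reduces to the
  \<open>q\<close>-Hahn difference equation in \<open>x\<close>. Adjointness makes \<open>X\<^sup>\<star>\<close> and \<open>Y\<^sup>\<star>\<close> self-adjoint, hence the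
  \<open>S\<^sub>i\<^sub>j\<close> are orthogonal, and the invariance of \<open>S\<close> transfers every statement to \<open>X\<close> and \<open>Y\<close>
  acting on the \<open>S\<^sub>i\<^sub>j\<close>. Irreducibility holds because no \<open>S\<^sub>i\<^sub>j\<close> vanishes at the origin.
\<close>

section \<open>Operators with a common eigenbasis on the triangle\<close>

text \<open>Let R_j(y; x) be the dual q-Hahn polynomial in y attached to column x, of length N - x.
  The contiguity relations keep the degree j: B carries R_j(.; x+1) to R_j(.; x), and D carries
  R_j(.; x) to (1 - q^(N-x-j)) R_j(.; x+1). So on column x the product B D acts on R_j as 1 -
  q^(N-x-j), and this explains the formula for \<open>Ys\<close>. Both steps preserve functions of
  the shape g(x) R_j(y; x), so \<open>Xs\<close> becomes an operator on g alone. The factor 1/(q;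
  q)_(N-x-j) in \<open>S\<close> is the gauge that absorbs the numbers 1 - q^(N-x-j) arising from
  the shifts and leaves the plain q-Hahn difference equation; being symmetric in x and j, it
  respects the exchange. The obstacle is the boundary. The raising relation is available for x + j <
  N only, and a step may leave the triangle. So \<open>S\<close> is cut off at x + j = N, and each
  operator identity has to be seen to yield 0 beyond. The weight is complex, so the form is not
  positive and nonvanishing norms must come from nondegeneracy.\<close>

interpretation grid_op: vector_space
  "pointwise (pointwise (*)) :: complex \<Rightarrow> ((nat \<times> nat \<Rightarrow> complex) \<Rightarrow> nat \<times> nat \<Rightarrow> complex) \<Rightarrow> _"
  by (rule vector_space_pointwise) (rule grid.vector_space_axioms)

lemma pointwise_times_apply: "pointwise (*) c f l = c * f l"
  by (simp add: pointwise_def)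

lemma pointwise_op_apply: "pointwise (pointwise (*)) c F f = pointwise (*) c (F f)"
  by (simp add: pointwise_def)

lemma sum_fun_apply: "(\<Sum>a\<in>A. f a) l = (\<Sum>a\<in>A. f a l)"
  by (induction A rule: infinite_finite_induct) (auto simp: zero_fun_def plus_fun_def)

definition grid_space :: "nat \<Rightarrow> (nat \<times> nat \<Rightarrow> complex) set" where
  "grid_space N = {f. \<forall>l. l \<notin> triangle N \<longrightarrow> f l = 0}"

definition grid_delta :: "nat \<times> nat \<Rightarrow> nat \<times> nat \<Rightarrow> complex" where
  "grid_delta l = (\<lambda>m. if m = l then 1 else 0)"

lemma triangle_Sigma: "triangle N = Sigma {0..N} (\<lambda>x. {0..N - x})"
  by (auto simp: triangle_def)

lemma finite_triangle [simp]: "finite (triangle N)"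
  by (simp add: triangle_Sigma)

lemma card_triangle: "card (triangle N) = (N + 2) choose 2"
proof -
  have "card (triangle N) = (\<Sum>x=0..N. Suc (N - x))" by (simp add: triangle_Sigma)
  also have "\<dots> = (\<Sum>x=0..N. Suc x)"
    by (rule sum.reindex_bij_witness[of _ "\<lambda>x. N - x" "\<lambda>x. N - x"]) auto
  also have "\<dots> = (N + 2) choose 2"
    by (induction N) (simp_all add: numeral_2_eq_2)
  finally show ?thesis .
qed

lemma subspace_grid_space [simp]: "grid.subspace (grid_space N)"
  by (auto simp: grid.subspace_def grid_space_def pointwise_times_apply)

lemma grid_spaceD: "f \<in> grid_space N \<Longrightarrow> l \<notin> triangle N \<Longrightarrow> f l = 0"
  unfolding grid_space_def by blast

lemma grid_delta_in [simp]: "l \<in> triangle N \<Longrightarrow> grid_delta l \<in> grid_space N"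
  by (auto simp: grid_delta_def grid_space_def)

lemma grid_space_expand:
  assumes "f \<in> grid_space N"
  shows "f = (\<Sum>l\<in>triangle N. pointwise (*) (f l) (grid_delta l))"
proof
  fix m
  show "f m = (\<Sum>l\<in>triangle N. pointwise (*) (f l) (grid_delta l)) m"
    using grid_spaceD[OF assms, of m] by (simp add: sum_fun_apply pointwise_times_apply grid_delta_def if_distrib cong: if_cong)
qed

lemma grid_space_span: "grid.span (grid_delta ` triangle N) = grid_space N"
proof (rule grid.span_subspace)
  show "grid_space N \<subseteq> grid.span (grid_delta ` triangle N)"
  proof
    fix f assume "f \<in> grid_space N"
    have "(\<Sum>l\<in>triangle N. pointwise (*) (f l) (grid_delta l)) \<in> grid.span (grid_delta ` triangle N)"
      by (intro grid.span_sum grid.span_scale grid.span_base) auto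
    then show "f \<in> grid.span (grid_delta ` triangle N)"
      using grid_space_expand[OF \<open>f \<in> grid_space N\<close>] by simp
  qed
qed auto

section \<open>Endomorphisms of the function space and operators given by kernels\<close>

lemma grid_endosD:
  assumes "F \<in> grid.endos V"
  shows "v \<in> V \<Longrightarrow> F v \<in> V"
    and "u \<in> V \<Longrightarrow> v \<in> V \<Longrightarrow> F (u + v) = F u + F v"
    and "v \<in> V \<Longrightarrow> F (pointwise (*) c v) = pointwise (*) c (F v)"
    and "v \<notin> V \<Longrightarrow> F v = 0"
  using assms by (auto simp: grid.endos_def)

lemma grid_endos_0:
  assumes "F \<in> grid.endos V" "grid.subspace V"
  shows "F 0 = 0"
  using grid_endosD(3)[OF assms(1) grid.subspace_0[OF assms(2)], of 0] by (simp only: grid.scale_zero_left)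

lemma grid_endos_sum:
  assumes "F \<in> grid.endos V" "grid.subspace V" "\<And>l. l \<in> A \<Longrightarrow> v l \<in> V"
  shows "F (\<Sum>l\<in>A. pointwise (*) (c l) (v l)) = (\<Sum>l\<in>A. pointwise (*) (c l) (F (v l)))"
proof -
  note 0 = grid_endos_0[OF assms(1,2)]
  have "(\<Sum>l\<in>A. pointwise (*) (c l) (v l)) \<in> V \<and> F (\<Sum>l\<in>A. pointwise (*) (c l) (v l)) = (\<Sum>l\<in>A. pointwise (*) (c l) (F (v l)))"
    using assms(3)
  proof (induction A rule: infinite_finite_induct)
    case (insert a A)
    have 1: "v a \<in> V" "pointwise (*) (c a) (v a) \<in> V"
      using insert assms(2) by (auto intro: grid.subspace_scale)
    have 2: "(\<Sum>l\<in>A. pointwise (*) (c l) (v l)) \<in> V"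
      and 3: "F (\<Sum>l\<in>A. pointwise (*) (c l) (v l)) = (\<Sum>l\<in>A. pointwise (*) (c l) (F (v l)))"
      using insert by blast+
    show ?case
      by (simp only: sum.insert[OF insert.hyps] grid_endosD(2)[OF assms(1) 1(2) 2]
          grid_endosD(3)[OF assms(1) 1(1)] 3 grid.subspace_add[OF assms(2) 1(2) 2])
  qed (use 0 grid.subspace_0[OF assms(2)] in auto)
  then show ?thesis ..
qed

text \<open>Off \<open>grid_space N\<close> the value is 0, as \<open>endos\<close> demands of its
  representatives. The first argument of the kernel is the output point, so column \<open>m\<close>
  of the kernel is the image of \<open>grid_delta m\<close>.\<close>

definition kernel_op :: "nat \<Rightarrow> (nat \<times> nat \<Rightarrow> nat \<times> nat \<Rightarrow> complex) \<Rightarrow> (nat \<times> nat \<Rightarrow> complex) \<Rightarrow> nat \<times> nat \<Rightarrow> complex" where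
  "kernel_op N M f = (if f \<in> grid_space N
     then (\<lambda>l. if l \<in> triangle N then \<Sum>c\<in>triangle N. M l c * f c else 0) else 0)"

lemma kernel_op_endos: "kernel_op N M \<in> grid.endos (grid_space N)"
  by (auto simp: grid.endos_def kernel_op_def grid_space_def fun_eq_iff distrib_left sum.distrib pointwise_times_apply
      sum_distrib_left mult.left_commute)

lemma kernel_op_apply: "f \<in> grid_space N \<Longrightarrow> l \<in> triangle N \<Longrightarrow> kernel_op N M f l = (\<Sum>c\<in>triangle N. M l c * f c)"
  by (simp add: kernel_op_def)

lemma kernel_op_eqI:
  assumes "f \<in> grid_space N" "g \<in> grid_space N"
    and "\<And>l. l \<in> triangle N \<Longrightarrow> (\<Sum>c\<in>triangle N. M l c * f c) = g l"
  shows "kernel_op N M f = g"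
  using assms by (auto simp: kernel_op_def grid_space_def)

lemma kernel_op_delta:
  assumes "m \<in> triangle N"
  shows "kernel_op N M (grid_delta m) = (\<Sum>l\<in>triangle N. pointwise (*) (M l m) (grid_delta l))"
proof (rule kernel_op_eqI)
  show "(\<Sum>l\<in>triangle N. pointwise (*) (M l m) (grid_delta l)) \<in> grid_space N"
    by (intro grid.subspace_sum grid.subspace_scale) auto
qed (use assms grid_delta_in[of m N] in \<open>simp_all add: sum_fun_apply pointwise_times_apply if_distrib cong: if_cong\<close>,
    simp_all add: grid_delta_def if_distrib cong: if_cong)

section \<open>Weighted bilinear forms on the triangle\<close>

definition grid_form :: "nat \<Rightarrow> (nat \<times> nat \<Rightarrow> complex) \<Rightarrow> (nat \<times> nat \<Rightarrow> complex) \<Rightarrow> (nat \<times> nat \<Rightarrow> complex) \<Rightarrow> complex" where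
  "grid_form N w f g = (\<Sum>l\<in>triangle N. w l * f l * g l)"

lemma grid_form_simps:
  "grid_form N w f g = grid_form N w g f"
  "grid_form N w (f + g) h = grid_form N w f h + grid_form N w g h"
  "grid_form N w (pointwise (*) c f) h = c * grid_form N w f h"
  "grid_form N w h (pointwise (*) c f) = c * grid_form N w h f"
  by (auto simp: grid_form_def pointwise_times_apply sum.distrib distrib_left distrib_right sum_distrib_left mult_ac)

lemma grid_form_sum:
  "grid_form N w h (\<Sum>l\<in>A. v l) = (\<Sum>l\<in>A. grid_form N w h (v l))"
  unfolding grid_form_def by (subst sum.swap) (simp add: sum_fun_apply sum_distrib_left)

lemma grid_form_delta: "l \<in> triangle N \<Longrightarrow> grid_form N w f (grid_delta l) = w l * f l"
  by (simp add: grid_form_def grid_delta_def if_distrib cong: if_cong)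

lemma grid_form_nondeg:
  assumes "\<And>l. l \<in> triangle N \<Longrightarrow> w l \<noteq> 0"
  shows "grid.nondeg_symmetric_form (grid_space N) (grid_form N w)"
  unfolding grid.nondeg_symmetric_form_def
proof (intro conjI ballI allI impI)
  fix u assume u: "u \<in> grid_space N" "\<forall>v\<in>grid_space N. grid_form N w u v = 0"
  show "u = 0"
  proof
    fix l
    show "u l = 0 l"
    proof (cases "l \<in> triangle N")
      case True
      then have "grid_form N w u (grid_delta l) = 0" using u by simp
      then show ?thesis using True assms by (simp add: grid_form_delta)
    qed (use u grid_spaceD in simp)
  qed
qed (rule grid_form_simps)+

text \<open>The first hypothesis is detailed balance; after exchanging the two summations it moves
  the kernel to the other argument. The form is bilinear, without complex conjugation.\<close>

lemma grid_form_selfadjoint: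
  assumes "\<And>l m. l \<in> triangle N \<Longrightarrow> m \<in> triangle N \<Longrightarrow> w l * M l m = w m * M m l"
    and "f \<in> grid_space N" "g \<in> grid_space N"
  shows "grid_form N w (kernel_op N M f) g = grid_form N w f (kernel_op N M g)"
proof -
  have "grid_form N w (kernel_op N M f) g = (\<Sum>l\<in>triangle N. \<Sum>c\<in>triangle N. w l * M l c * f c * g l)"
    using assms by (simp add: grid_form_def kernel_op_apply sum_distrib_left sum_distrib_right mult.assoc)
  also have "\<dots> = (\<Sum>l\<in>triangle N. \<Sum>c\<in>triangle N. w c * M c l * f c * g l)"
    using assms(1) by (intro sum.cong) auto
  also have "\<dots> = grid_form N w f (kernel_op N M g)"
    using assms by (subst sum.swap) (simp add: grid_form_def kernel_op_apply sum_distrib_left mult_ac)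
  finally show ?thesis .
qed

lemma grid_op_span_pair: "h \<in> grid_op.span {F, G} \<longleftrightarrow>
    (\<exists>\<alpha> \<beta>. h = pointwise (pointwise (*)) \<alpha> F + pointwise (pointwise (*)) \<beta> G)"
proof -
  have "h \<in> grid_op.span {F, G} \<longleftrightarrow> (\<exists>\<alpha> \<beta>. h - pointwise (pointwise (*)) \<alpha> F = pointwise (pointwise (*)) \<beta> G)"
    by (simp only: grid_op.span_insert grid_op.span_singleton mem_Collect_eq image_iff) auto
  then show ?thesis by (metis add.commute diff_add_cancel add_diff_cancel_right')
qed

text \<open>Instantiated twice: for \<open>grid_delta\<close> with \<open>X\<close>,
  \<open>Y\<close> and for \<open>S\<close> with \<open>Xs\<close>, \<open>Ys\<close>. By
  \<open>inj\<close> the pair of eigenvalues separates the points, so that common eigenspaces are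
  lines; \<open>ex1\<close> and \<open>ex2\<close> make \<open>F\<close> and \<open>G\<close>
  linearly independent.\<close>

locale joint_eigenbasis =
  fixes N :: nat and e :: "nat \<times> nat \<Rightarrow> nat \<times> nat \<Rightarrow> complex"
    and F G :: "(nat \<times> nat \<Rightarrow> complex) \<Rightarrow> nat \<times> nat \<Rightarrow> complex"
    and a b :: "nat \<times> nat \<Rightarrow> complex"
  assumes e_in: "\<And>l. l \<in> triangle N \<Longrightarrow> e l \<in> grid_space N"
    and e_nz: "\<And>l. l \<in> triangle N \<Longrightarrow> e l \<noteq> 0"
    and F_endo: "F \<in> grid.endos (grid_space N)"
    and G_endo: "G \<in> grid.endos (grid_space N)"
    and F_e: "\<And>l. l \<in> triangle N \<Longrightarrow> F (e l) = pointwise (*) (a l) (e l)"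
    and G_e: "\<And>l. l \<in> triangle N \<Longrightarrow> G (e l) = pointwise (*) (b l) (e l)"
    and inj: "inj_on (\<lambda>l. (a l, b l)) (triangle N)"
    and ex1: "\<exists>l\<in>triangle N. a l \<noteq> 0 \<and> b l = 0"
    and ex2: "\<exists>l\<in>triangle N. b l \<noteq> 0"
begin

text \<open>Induction on the support: subtracting \<open>d m\<close> from \<open>P\<close>, which is
  \<open>F\<close> or \<open>G\<close>, kills the term at \<open>m\<close> and multiplies every
  other coefficient by \<open>d l - d m\<close>. By \<open>inj\<close> one of the two choices gives
  a nonzero factor at \<open>l\<close>, which can be divided out.\<close>

lemma components:
  assumes W: "grid.subspace W" and FW: "\<And>v. v \<in> W \<Longrightarrow> F v \<in> W" and GW: "\<And>v. v \<in> W \<Longrightarrow> G v \<in> W"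
    and "A \<subseteq> triangle N" "(\<Sum>l\<in>A. pointwise (*) (c l) (e l)) \<in> W" "l \<in> A"
  shows "pointwise (*) (c l) (e l) \<in> W"
proof -
  have "finite A" using assms(4) finite_triangle by (rule finite_subset)
  then show ?thesis using assms(4-6)
  proof (induction A arbitrary: c l rule: finite_induct)
    case empty
    from empty.prems(3) show ?case by (rule emptyE)
  next
    case (insert m A)
    have sub: "A \<subseteq> triangle N" using insert.prems(1) by simp
    define v where "v = (\<Sum>l\<in>insert m A. pointwise (*) (c l) (e l))"
    have key: "pointwise (*) (c l) (e l) \<in> W" if l: "l \<in> A" for l
    proof -
      have step: "pointwise (*) (c l * (d l - d m)) (e l) \<in> W"
        if P: "P \<in> grid.endos (grid_space N)" "\<And>v. v \<in> W \<Longrightarrow> P v \<in> W"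
          "\<And>l. l \<in> triangle N \<Longrightarrow> P (e l) = pointwise (*) (d l) (e l)" for P d
      proof -
        have "P v = (\<Sum>l\<in>insert m A. pointwise (*) (c l) (P (e l)))"
          unfolding v_def using insert.prems e_in P(1) by (intro grid_endos_sum) auto
        also have "\<dots> = (\<Sum>l\<in>insert m A. pointwise (*) (c l * d l) (e l))"
          using insert.prems P(3) by (intro sum.cong) auto
        finally have Pv: "P v = (\<Sum>l\<in>insert m A. pointwise (*) (c l * d l) (e l))" .
        have "P v - pointwise (*) (d m) v
          = (\<Sum>l\<in>insert m A. pointwise (*) (c l * d l) (e l)) - (\<Sum>l\<in>insert m A. pointwise (*) (d m * c l) (e l))"
          unfolding Pv by (simp only: v_def grid.scale_sum_right grid.scale_scale)
        also have "\<dots> = (\<Sum>l\<in>insert m A. pointwise (*) (c l * (d l - d m)) (e l))"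
          by (simp only: sum_subtractf[symmetric] grid.scale_left_diff_distrib[symmetric])
            (simp only: right_diff_distrib mult.commute)
        also have "\<dots> = (\<Sum>l\<in>A. pointwise (*) (c l * (d l - d m)) (e l))"
          by (simp only: sum.insert[OF insert.hyps] diff_self mult_zero_right grid.scale_zero_left add_0_left)
        finally have "(\<Sum>l\<in>A. pointwise (*) (c l * (d l - d m)) (e l)) = P v - pointwise (*) (d m) v" ..
        moreover have "v \<in> W" using insert.prems(2) by (simp only: v_def)
        ultimately have "(\<Sum>l\<in>A. pointwise (*) (c l * (d l - d m)) (e l)) \<in> W"
          using grid.subspace_diff[OF W P(2) grid.subspace_scale[OF W]] by (simp only:)
        with sub show ?thesis using l by (rule insert.IH[where c = "\<lambda>l. c l * (d l - d m)"])
      qed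
      have sc: "pointwise (*) (c l) (e l) \<in> W" if "pointwise (*) (c l * k) (e l) \<in> W" "k \<noteq> 0" for k
      proof -
        have "pointwise (*) (1 / k) (pointwise (*) (c l * k) (e l)) \<in> W"
          using W that(1) by (rule grid.subspace_scale)
        moreover have "1 / k * (c l * k) = c l" using that(2) by simp
        ultimately show ?thesis by (simp only: grid.scale_scale)
      qed
      have "m \<noteq> l" "m \<in> triangle N" "l \<in> triangle N" using insert l by auto
      then have "a l - a m \<noteq> 0 \<or> b l - b m \<noteq> 0" using inj by (auto simp: inj_on_def)
      then show ?thesis
      proof
        assume "a l - a m \<noteq> 0"
        from step[OF F_endo FW F_e] this show ?thesis by (rule sc)
      next
        assume "b l - b m \<noteq> 0"
        from step[OF G_endo GW G_e] this show ?thesis by (rule sc)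
      qed
    qed
    show ?case
    proof (cases "l = m")
      case True
      have "pointwise (*) (c m) (e m) = v - (\<Sum>l\<in>A. pointwise (*) (c l) (e l))"
        by (simp only: v_def sum.insert[OF insert.hyps] add_diff_cancel_right')
      moreover have "v \<in> W" using insert.prems(2) by (simp only: v_def)
      moreover have "(\<Sum>l\<in>A. pointwise (*) (c l) (e l)) \<in> W"
        using W key by (rule grid.subspace_sum)
      ultimately show ?thesis using True grid.subspace_diff[OF W] by metis
    next
      case False
      then show ?thesis using key insert.prems(3) by blast
    qed
  qed
qed

lemma F_0: "F 0 = 0"
  by (rule grid_endos_0[OF F_endo subspace_grid_space])

lemma G_0: "G 0 = 0"
  by (rule grid_endos_0[OF G_endo subspace_grid_space])

text \<open>Linear independence is the case \<open>W = {0}\<close> of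
  \<open>components\<close>.\<close>

lemma coeff_0:
  assumes "(\<Sum>l\<in>triangle N. pointwise (*) (c l) (e l)) = 0" "l \<in> triangle N"
  shows "c l = 0"
proof -
  have "pointwise (*) (c l) (e l) \<in> {0}"
    by (rule components[OF grid.subspace_single_0 _ _ order_refl _ assms(2)]) (use assms F_0 G_0 in auto)
  then show ?thesis using e_nz[OF assms(2)] by (simp add: grid.scale_eq_0_iff)
qed

lemma coeff_eq:
  assumes "(\<Sum>l\<in>triangle N. pointwise (*) (c l) (e l)) = (\<Sum>l\<in>triangle N. pointwise (*) (d l) (e l))" "l \<in> triangle N"
  shows "c l = d l"
proof -
  have "(\<Sum>l\<in>triangle N. pointwise (*) (c l - d l) (e l)) = 0"
    using assms(1) by (simp add: grid.scale_left_diff_distrib sum_subtractf)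
  from coeff_0[OF this assms(2)] show ?thesis by simp
qed

lemma e_inj: "inj_on e (triangle N)"
proof (rule inj_onI)
  fix l m assume lm: "l \<in> triangle N" "m \<in> triangle N" "e l = e m"
  then have "a l = a m" "b l = b m"
    using F_e[of l] F_e[of m] G_e[of l] G_e[of m] e_nz[of m] by (auto simp: grid.scale_cancel_right)
  then show "l = m" using inj lm by (auto simp: inj_on_def)
qed

lemma e_independent: "grid.independent (e ` triangle N)"
  unfolding grid.dependent_finite[OF finite_imageI[OF finite_triangle]]
proof (safe)
  fix u l assume "(\<Sum>v\<in>e ` triangle N. pointwise (*) (u v) v) = 0" and l: "l \<in> triangle N" "u (e l) \<noteq> 0"
  then have "(\<Sum>l\<in>triangle N. pointwise (*) (u (e l)) (e l)) = 0"
    by (simp add: sum.reindex[OF e_inj])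
  from coeff_0[OF this l(1)] l(2) show False by simp
qed

text \<open>By counting: a function outside the span would enlarge an independent family of
  \<open>card (triangle N)\<close> vectors, inside a space spanned by as many delta
  functions.\<close>

lemma e_span: "grid.span (e ` triangle N) = grid_space N"
proof (rule grid.span_subspace)
  show "grid_space N \<subseteq> grid.span (e ` triangle N)"
  proof
    fix f assume f: "f \<in> grid_space N"
    show "f \<in> grid.span (e ` triangle N)"
    proof (rule ccontr)
      assume nf: "f \<notin> grid.span (e ` triangle N)"
      then have "grid.independent (insert f (e ` triangle N))"
        using e_independent by (simp add: grid.independent_insert)
      moreover have "insert f (e ` triangle N) \<subseteq> grid.span (grid_delta ` triangle N)"
        using f e_in by (auto simp: grid_space_span)
      ultimately have "card (insert f (e ` triangle N)) \<le> card (grid_delta ` triangle N)"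
        using grid.independent_span_bound[OF finite_imageI[OF finite_triangle]] by blast
      also have "\<dots> \<le> card (triangle N)" by (simp add: card_image_le)
      also have "card (triangle N) = card (e ` triangle N)" by (simp add: card_image e_inj)
      finally have "f \<in> e ` triangle N" by (auto simp: card_insert_if split: if_splits)
      then show False using nf grid.span_base by blast
    qed
  qed
qed (use e_in in auto)

lemma grid_space_dim: "grid.dim (grid_space N) = (N + 2) choose 2"
  using grid.dim_eq_card[OF _ e_independent] e_span grid.span_span[of "e ` triangle N"]
  by (metis card_image card_triangle e_inj)

lemma expand:
  assumes "v \<in> grid_space N"
  obtains c where "v = (\<Sum>l\<in>triangle N. pointwise (*) (c l) (e l))"
proof -
  have "v \<in> grid.span (e ` triangle N)" using assms e_span by simp
  then obtain u where "v = (\<Sum>w\<in>e ` triangle N. pointwise (*) (u w) w)"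
    using grid.span_finite[OF finite_imageI[OF finite_triangle]] by auto
  then have "v = (\<Sum>l\<in>triangle N. pointwise (*) (u (e l)) (e l))" by (simp add: sum.reindex[OF e_inj])
  then show ?thesis by (rule that)
qed

lemma eigen_expand:
  assumes "P \<in> grid.endos (grid_space N)" "\<And>l. l \<in> triangle N \<Longrightarrow> P (e l) = pointwise (*) (d l) (e l)"
  shows "P (\<Sum>l\<in>triangle N. pointwise (*) (c l) (e l)) = (\<Sum>l\<in>triangle N. pointwise (*) (d l * c l) (e l))"
proof -
  have "P (\<Sum>l\<in>triangle N. pointwise (*) (c l) (e l)) = (\<Sum>l\<in>triangle N. pointwise (*) (c l) (P (e l)))"
    using assms(1) e_in by (intro grid_endos_sum) auto
  also have "\<dots> = (\<Sum>l\<in>triangle N. pointwise (*) (d l * c l) (e l))"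
    using assms(2) by (intro sum.cong) (auto simp: mult_ac)
  finally show ?thesis .
qed

abbreviation plane where "plane \<equiv> grid_op.span {F, G}"

lemma plane_endo: "h \<in> plane \<Longrightarrow> h \<in> grid.endos (grid_space N)"
proof -
  assume "h \<in> plane"
  then obtain \<alpha> \<beta> where h: "h = pointwise (pointwise (*)) \<alpha> F + pointwise (pointwise (*)) \<beta> G"
    by (auto simp: grid_op_span_pair)
  show ?thesis
    unfolding grid.endos_def h using grid_endosD[OF F_endo] grid_endosD[OF G_endo]
    by (auto simp: pointwise_op_apply grid.scale_right_distrib grid.subspace_add grid.subspace_scale mult.commute
        intro!: grid.subspace_add grid.subspace_scale)
qed

lemma plane_eigen:
  assumes "h \<in> plane"
  obtains d where "\<And>l. l \<in> triangle N \<Longrightarrow> h (e l) = pointwise (*) (d l) (e l)"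
proof -
  obtain \<alpha> \<beta> where h: "h = pointwise (pointwise (*)) \<alpha> F + pointwise (pointwise (*)) \<beta> G"
    using assms by (auto simp: grid_op_span_pair)
  show ?thesis
    by (rule that[of "\<lambda>l. \<alpha> * a l + \<beta> * b l"]) (auto simp: h pointwise_op_apply F_e G_e grid.scale_left_distrib)
qed

lemma F_in_plane: "F \<in> plane" and G_in_plane: "G \<in> plane"
  by (auto intro: grid_op.span_base)

lemma eigen_e_eq:
  assumes "l \<in> triangle N" "F (e l) = pointwise (*) \<alpha> (e l)" "G (e l) = pointwise (*) \<beta> (e l)"
  shows "\<alpha> = a l" "\<beta> = b l"
  using assms F_e[of l] G_e[of l] e_nz[of l] by (auto simp: grid.scale_cancel_right)

text \<open>Comparing coefficients in the eigenvalue equations of \<open>F\<close> and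
  \<open>G\<close> kills the coefficient at each \<open>m \<noteq> l\<close>, because one of the two
  eigenvalues differs there by \<open>inj\<close>.\<close>

lemma eigenspace_eq:
  assumes l: "l \<in> triangle N" and w: "\<And>h. h \<in> plane \<Longrightarrow> h (e l) = pointwise (*) (w h) (e l)"
  shows "{v \<in> grid_space N. \<forall>h\<in>plane. h v = pointwise (*) (w h) v} = grid.span {e l}"
proof (intro equalityI subsetI)
  fix v assume "v \<in> {v \<in> grid_space N. \<forall>h\<in>plane. h v = pointwise (*) (w h) v}"
  then have v: "v \<in> grid_space N" "F v = pointwise (*) (w F) v" "G v = pointwise (*) (w G) v"
    using F_in_plane G_in_plane by auto
  from v(1) obtain c where c: "v = (\<Sum>m\<in>triangle N. pointwise (*) (c m) (e m))" by (rule expand)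
  have ab: "w F = a l" "w G = b l" using eigen_e_eq[OF l w[OF F_in_plane] w[OF G_in_plane]] by auto
  have "c m = 0" if m: "m \<in> triangle N" "m \<noteq> l" for m
  proof -
    have "(\<Sum>m\<in>triangle N. pointwise (*) (a m * c m) (e m)) = (\<Sum>m\<in>triangle N. pointwise (*) (a l * c m) (e m))"
      using v(2) eigen_expand[OF F_endo F_e, of c] c by (simp add: ab grid.scale_sum_right)
    from coeff_eq[OF this m(1)] have 1: "a m = a l \<or> c m = 0" by auto
    have "(\<Sum>m\<in>triangle N. pointwise (*) (b m * c m) (e m)) = (\<Sum>m\<in>triangle N. pointwise (*) (b l * c m) (e m))"
      using v(3) eigen_expand[OF G_endo G_e, of c] c by (simp add: ab grid.scale_sum_right)
    from coeff_eq[OF this m(1)] have 2: "b m = b l \<or> c m = 0" by auto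
    show ?thesis using 1 2 inj l m by (auto simp: inj_on_def)
  qed
  then have "v = (\<Sum>m\<in>triangle N. if m = l then pointwise (*) (c l) (e l) else 0)"
    unfolding c by (intro sum.cong) auto
  also have "\<dots> = pointwise (*) (c l) (e l)" using l by simp
  finally show "v \<in> grid.span {e l}" by (auto simp: grid.span_singleton)
next
  fix v assume "v \<in> grid.span {e l}"
  then obtain k where v: "v = pointwise (*) k (e l)" by (auto simp: grid.span_singleton)
  have "h v = pointwise (*) (w h) v" if "h \<in> plane" for h
    using grid_endosD(3)[OF plane_endo[OF that] e_in[OF l]] w[OF that] by (simp add: v mult.commute)
  then show "v \<in> {v \<in> grid_space N. \<forall>h\<in>plane. h v = pointwise (*) (w h) v}"
    using e_in[OF l] by (auto simp: v intro!: grid.subspace_scale)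
qed

lemma eigenspaces_bij: "bij_betw (\<lambda>l. grid.span {e l}) (triangle N) (grid.common_eigenspaces (grid_space N) plane)"
  unfolding bij_betw_def
proof (intro conjI equalityI subsetI inj_onI)
  fix l m assume lm: "l \<in> triangle N" "m \<in> triangle N" "grid.span {e l} = grid.span {e m}"
  then have "e l \<in> grid.span {e m}" using grid.span_base by blast
  then obtain k where k: "e l = pointwise (*) k (e m)" by (auto simp: grid.span_singleton)
  have "F (e l) = pointwise (*) (a m) (e l)" "G (e l) = pointwise (*) (b m) (e l)"
    by (simp_all only: k grid_endosD(3)[OF F_endo e_in[OF lm(2)]] grid_endosD(3)[OF G_endo e_in[OF lm(2)]]
        F_e[OF lm(2)] G_e[OF lm(2)] grid.scale_scale mult.commute)
  from eigen_e_eq[OF lm(1) this] show "l = m" using inj lm by (auto simp: inj_on_def)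
next
  fix W assume "W \<in> (\<lambda>l. grid.span {e l}) ` triangle N"
  then obtain l where l: "l \<in> triangle N" "W = grid.span {e l}" by auto
  \<comment> \<open>The eigenvalue at \<open>e l\<close>; for operators in the plane it exists by
    \<open>plane_eigen\<close>.\<close>
  define w where "w h = (SOME k. h (e l) = pointwise (*) k (e l))" for h :: "(nat \<times> nat \<Rightarrow> complex) \<Rightarrow> nat \<times> nat \<Rightarrow> complex"
  have "h (e l) = pointwise (*) (w h) (e l)" if "h \<in> plane" for h
    unfolding w_def by (rule someI_ex) (use plane_eigen[OF that] l in metis)
  from eigenspace_eq[OF l(1), of w, OF this] have "W = {v \<in> grid_space N. \<forall>h\<in>plane. h v = pointwise (*) (w h) v}"
    using l by simp
  moreover have "e l \<in> W" unfolding l(2) by (rule grid.span_base) simp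
  then have "W \<noteq> {0}" using e_nz[OF l(1)] by blast
  ultimately show "W \<in> grid.common_eigenspaces (grid_space N) plane"
    unfolding grid.common_eigenspaces_def by blast
next
  fix W assume "W \<in> grid.common_eigenspaces (grid_space N) plane"
  then obtain w where W: "W \<noteq> {0}" "W = {v \<in> grid_space N. \<forall>h\<in>plane. h v = pointwise (*) (w h) v}"
    unfolding grid.common_eigenspaces_def by blast
  \<comment> \<open>\<open>W \<noteq> {0}\<close> alone would allow the empty set; since 0 lies in
    \<open>W\<close>, there is a nonzero vector.\<close>
  have "h 0 = pointwise (*) (w h) 0" if "h \<in> plane" for h
    unfolding grid.scale_zero_right by (rule grid_endos_0[OF plane_endo[OF that] subspace_grid_space])
  then have "0 \<in> W" unfolding W(2) using grid.subspace_0[OF subspace_grid_space] by blast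
  then obtain v where v: "v \<in> W" "v \<noteq> 0" using W by blast
  have "v \<in> grid_space N" using v W by simp
  then obtain c where c: "v = (\<Sum>m\<in>triangle N. pointwise (*) (c m) (e m))" by (rule expand)
  have "\<exists>l\<in>triangle N. c l \<noteq> 0"
  proof (rule ccontr)
    assume "\<not> ?thesis"
    then have "v = 0" unfolding c by (simp add: sum.neutral)
    with v show False by simp
  qed
  then obtain l where l: "l \<in> triangle N" "c l \<noteq> 0" by blast
  \<comment> \<open>An index in the support of \<open>v\<close> forces \<open>w\<close> to be the
    eigenvalue functional of \<open>e l\<close>; \<open>eigenspace_eq\<close> then identifies
    \<open>W\<close>.\<close>
  have "h (e l) = pointwise (*) (w h) (e l)" if h: "h \<in> plane" for h
  proof -
    obtain d where d: "\<And>l. l \<in> triangle N \<Longrightarrow> h (e l) = pointwise (*) (d l) (e l)"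
      using h by (rule plane_eigen) blast
    have "(\<Sum>m\<in>triangle N. pointwise (*) (d m * c m) (e m)) = (\<Sum>m\<in>triangle N. pointwise (*) (w h * c m) (e m))"
      using v(1) h eigen_expand[OF plane_endo[OF h] d, of c] c W(2) by (simp add: grid.scale_sum_right)
    from coeff_eq[OF this l(1)] l(2) d[OF l(1)] show ?thesis by simp
  qed
  from eigenspace_eq[OF l(1), of w, OF this] show "W \<in> (\<lambda>l. grid.span {e l}) ` triangle N"
    using W l by blast
qed

lemma dim_eigenspace: "l \<in> triangle N \<Longrightarrow> grid.dim (grid.span {e l}) = 1"
  using grid.dim_eq_card[of "{e l}" "grid.span {e l}"] e_nz[of l] by (simp add: grid.span_span)

lemma plane_basis: "F \<noteq> G" "grid_op.independent {F, G}"
proof -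
  obtain l where l: "l \<in> triangle N" "a l \<noteq> 0" "b l = 0" using ex1 by blast
  obtain m where m: "m \<in> triangle N" "b m \<noteq> 0" using ex2 by blast
  show "F \<noteq> G" using F_e[OF l(1)] G_e[OF l(1)] e_nz[OF l(1)] l by (auto simp: grid.scale_cancel_right)
  have nf: "F \<notin> grid_op.span {G}"
  proof
    assume "F \<in> grid_op.span {G}"
    then obtain k where "F = pointwise (pointwise (*)) k G" by (auto simp: grid_op.span_singleton)
    then have "F (e l) = 0" using G_e[OF l(1)] l by (simp add: pointwise_op_apply grid.scale_zero_left)
    then show False using F_e[OF l(1)] l e_nz[OF l(1)] by (simp add: grid.scale_eq_0_iff)
  qed
  have "G \<noteq> 0" using G_e[OF m(1)] m e_nz[OF m(1)] by (auto simp: grid.scale_eq_0_iff)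
  then have "grid_op.independent {G}" by simp
  then show "grid_op.independent {F, G}" using nf \<open>F \<noteq> G\<close> by (simp add: grid_op.independent_insert)
qed

lemma basis_pair: "grid.basis_pair F G plane"
  using plane_basis by (simp add: grid.basis_pair_def)

lemma plane: "grid.commuting_diagonalizable_plane (grid_space N) plane"
  unfolding grid.commuting_diagonalizable_plane_def
proof (intro conjI ballI)
  show "grid_op.dim plane = 2"
    using grid_op.dim_eq_card[OF _ plane_basis(2), of plane] plane_basis(1) by (simp add: grid_op.span_span)
next
  fix h assume h: "h \<in> plane"
  obtain d where d: "\<And>l. l \<in> triangle N \<Longrightarrow> h (e l) = pointwise (*) (d l) (e l)"
    using h by (rule plane_eigen) blast
  then show "grid.diagonalizable (grid_space N) h"
    unfolding grid.diagonalizable_def using e_independent e_span by (intro exI[of _ "e ` triangle N"]) blast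
  fix g assume g: "g \<in> plane"
  obtain d' where d': "\<And>l. l \<in> triangle N \<Longrightarrow> g (e l) = pointwise (*) (d' l) (e l)"
    using g by (rule plane_eigen) blast
  have hc: "h (\<Sum>l\<in>triangle N. pointwise (*) (c l) (e l)) = (\<Sum>l\<in>triangle N. pointwise (*) (d l * c l) (e l))" for c
    by (rule eigen_expand[OF plane_endo[OF h] d])
  have gc: "g (\<Sum>l\<in>triangle N. pointwise (*) (c l) (e l)) = (\<Sum>l\<in>triangle N. pointwise (*) (d' l * c l) (e l))" for c
    by (rule eigen_expand[OF plane_endo[OF g] d'])
  show "h \<circ> g = g \<circ> h"
  proof
    fix v
    show "(h \<circ> g) v = (g \<circ> h) v"
    proof (cases "v \<in> grid_space N")
      case True
      then obtain c where c: "v = (\<Sum>m\<in>triangle N. pointwise (*) (c m) (e m))" by (rule expand)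
      show ?thesis
        unfolding c o_apply hc gc by (simp only: mult_ac)
    next
      case False
      have "h 0 = 0" "g 0 = 0"
        by (rule grid_endos_0[OF plane_endo[OF h] subspace_grid_space])
          (rule grid_endos_0[OF plane_endo[OF g] subspace_grid_space])
      moreover have "h v = 0" "g v = 0"
        using False g h plane_endo[THEN grid_endosD(4)] by blast+
      ultimately show ?thesis by (simp only: o_apply)
    qed
  qed
next
  show "plane \<subseteq> grid.endos (grid_space N)" using plane_endo by blast
  show "grid_op.subspace plane" by (rule grid_op.subspace_span)
qed

lemma invariant_contains:
  assumes W: "grid.subspace W" "\<forall>h\<in>plane. \<forall>v\<in>W. h v \<in> W"
    and c: "(\<Sum>l\<in>triangle N. pointwise (*) (c l) (e l)) \<in> W" "l \<in> triangle N" "c l \<noteq> 0"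
  shows "e l \<in> W"
proof -
  have "pointwise (*) (c l) (e l) \<in> W"
    using components[OF W(1) bspec[OF bspec[OF W(2) F_in_plane]] bspec[OF bspec[OF W(2) G_in_plane]] order_refl c(1,2)] .
  then have "pointwise (*) (1 / c l) (pointwise (*) (c l) (e l)) \<in> W"
    by (rule grid.subspace_scale[OF W(1)])
  then show ?thesis using c(3) by simp
qed

lemma orthogonal:
  assumes "\<And>f g. f \<in> grid_space N \<Longrightarrow> g \<in> grid_space N \<Longrightarrow> grid_form N w (F f) g = grid_form N w f (F g)"
    and "\<And>f g. f \<in> grid_space N \<Longrightarrow> g \<in> grid_space N \<Longrightarrow> grid_form N w (G f) g = grid_form N w f (G g)"
    and "l \<in> triangle N" "m \<in> triangle N" "l \<noteq> m"
  shows "grid_form N w (e l) (e m) = 0"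
proof -
  have "a l \<noteq> a m \<or> b l \<noteq> b m" using inj assms(3-5) by (auto simp: inj_on_def)
  moreover have "a l * grid_form N w (e l) (e m) = a m * grid_form N w (e l) (e m)"
    using assms(1)[OF e_in e_in, OF assms(3,4)] F_e assms(3,4) by (simp add: grid_form_simps)
  moreover have "b l * grid_form N w (e l) (e m) = b m * grid_form N w (e l) (e m)"
    using assms(2)[OF e_in e_in, OF assms(3,4)] G_e assms(3,4) by (simp add: grid_form_simps)
  ultimately show ?thesis by auto
qed

text \<open>If the norm vanished, \<open>e l\<close> would be orthogonal to the whole eigenbasis,
  against nondegeneracy.\<close>

lemma norm_nz:
  assumes "grid.nondeg_symmetric_form (grid_space N) (grid_form N w)"
    and "\<And>m. m \<in> triangle N \<Longrightarrow> m \<noteq> l \<Longrightarrow> grid_form N w (e l) (e m) = 0" "l \<in> triangle N"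
  shows "grid_form N w (e l) (e l) \<noteq> 0"
proof
  assume 0: "grid_form N w (e l) (e l) = 0"
  have "grid_form N w (e l) v = 0" if v: "v \<in> grid_space N" for v
  proof -
    obtain c where c: "v = (\<Sum>m\<in>triangle N. pointwise (*) (c m) (e m))" using v by (rule expand)
    show ?thesis unfolding c grid_form_sum grid_form_simps(4)
    proof (rule sum.neutral, rule ballI)
      fix m assume "m \<in> triangle N"
      then have "grid_form N w (e l) (e m) = 0" using 0 assms(2) by (cases "m = l") simp_all
      then show "c m * grid_form N w (e l) (e m) = 0" by simp
    qed
  qed
  then have "e l = 0" using assms(1) e_in[OF assms(3)] unfolding grid.nondeg_symmetric_form_def by blast
  then show False using e_nz assms(3) by blast
qed

lemma adjacent_span:
  assumes "P \<in> grid.endos (grid_space N)" "Q \<in> grid.endos (grid_space N)"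
    and "P (e l) = (\<Sum>m\<in>triangle N. pointwise (*) (K m) (e m))" "\<And>m. m \<in> triangle N \<Longrightarrow> K m \<noteq> 0 \<Longrightarrow> adjacent m l"
    and "Q (e l) = (\<Sum>m\<in>triangle N. pointwise (*) (L m) (e m))" "\<And>m. m \<in> triangle N \<Longrightarrow> L m \<noteq> 0 \<Longrightarrow> adjacent m l"
    and l: "l \<in> triangle N" and h: "h \<in> grid_op.span {P, Q}"
  shows "h ` grid.span {e l} \<subseteq> grid.span (\<Union>c \<in> {c \<in> triangle N. adjacent c l}. grid.span {e c})"
    (is "_ \<subseteq> ?S")
proof
  fix u assume "u \<in> h ` grid.span {e l}"
  then obtain k where u: "u = h (pointwise (*) k (e l))" by (auto simp: grid.span_singleton)
  obtain \<alpha> \<beta> where h: "h = pointwise (pointwise (*)) \<alpha> P + pointwise (pointwise (*)) \<beta> Q"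
    using h by (auto simp: grid_op_span_pair)
  have in_S: "(\<Sum>m\<in>triangle N. pointwise (*) (M m) (e m)) \<in> ?S"
    if M: "\<And>m. m \<in> triangle N \<Longrightarrow> M m \<noteq> 0 \<Longrightarrow> adjacent m l" for M
  proof (rule grid.span_sum)
    fix m assume m: "m \<in> triangle N"
    show "pointwise (*) (M m) (e m) \<in> ?S"
    proof (cases "M m = 0")
      case True
      then show ?thesis by (simp add: grid.scale_zero_left grid.span_zero)
    next
      case False
      then have "e m \<in> (\<Union>c \<in> {c \<in> triangle N. adjacent c l}. grid.span {e c})"
        using M m grid.span_base by blast
      then show ?thesis by (intro grid.span_scale grid.span_base)
    qed
  qed
  have "u = pointwise (*) (\<alpha> * k) (P (e l)) + pointwise (*) (\<beta> * k) (Q (e l))"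
    using grid_endosD(3)[OF assms(1) e_in[OF l]] grid_endosD(3)[OF assms(2) e_in[OF l]]
    by (simp add: u h pointwise_op_apply)
  moreover have "P (e l) \<in> ?S" unfolding assms(3) by (rule in_S[OF assms(4)])
  moreover have "Q (e l) \<in> ?S" unfolding assms(5) by (rule in_S[OF assms(6)])
  ultimately show "u \<in> ?S" by (simp only: grid.span_add grid.span_scale)
qed


lemma eigenspace_scalar:
  assumes "l \<in> triangle N" "v \<in> grid.span {e l}"
  shows "F v = pointwise (*) (a l) v" "G v = pointwise (*) (b l) v"
proof -
  obtain k where k: "v = pointwise (*) k (e l)" using assms by (auto simp: grid.span_singleton)
  show "F v = pointwise (*) (a l) v" "G v = pointwise (*) (b l) v"
    unfolding k grid_endosD(3)[OF F_endo e_in[OF assms(1)]] grid_endosD(3)[OF G_endo e_in[OF assms(1)]]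
      F_e[OF assms(1)] G_e[OF assms(1)] grid.scale_scale
    by (simp_all only: mult.commute)
qed

text \<open>By orthogonality, pairing with \<open>e k\<close> reads off the coefficient
  \<open>K k\<close>, up to the nonzero norm.\<close>

lemma not_form_vanishes:
  assumes "P (e l) = (\<Sum>m\<in>triangle N. pointwise (*) (K m) (e m))" "k \<in> triangle N" "K k \<noteq> 0"
    and orth: "\<And>m. m \<in> triangle N \<Longrightarrow> m \<noteq> k \<Longrightarrow> grid_form N w (e k) (e m) = 0"
    and nz: "grid_form N w (e k) (e k) \<noteq> 0"
  shows "\<not> form_vanishes (grid_form N w) (grid.span {e k}) (P ` grid.span {e l})"
proof -
  have "grid_form N w (e k) (P (e l)) = (\<Sum>m\<in>triangle N. K m * grid_form N w (e k) (e m))"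
    unfolding assms(1) grid_form_sum grid_form_simps(4) ..
  also have "\<dots> = (\<Sum>m\<in>triangle N. if m = k then K k * grid_form N w (e k) (e k) else 0)"
    using orth by (intro sum.cong) auto
  also have "\<dots> \<noteq> 0" using assms(2,3) nz by simp
  finally have "grid_form N w (e k) (P (e l)) \<noteq> 0" .
  moreover have "e k \<in> grid.span {e k}" "P (e l) \<in> P ` grid.span {e l}"
    by (rule grid.span_base; simp) (rule imageI, rule grid.span_base, simp)
  ultimately show ?thesis unfolding form_vanishes_def by blast
qed

end

section \<open>Contiguity relations for dual \<open>q\<close>-Hahn polynomials\<close>

lemma qpoch_0 [simp]: "qpoch a q 0 = 1"
  by (simp add: qpoch_def)

lemma qpoch_Suc: "qpoch a q (Suc k) = qpoch a q k * (1 - a * q ^ k)"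
  by (simp add: qpoch_def)

lemma qpoch_Suc_shift: "qpoch a q (Suc k) = (1 - a) * qpoch (a * q) q k"
  unfolding qpoch_def by (subst prod.atLeast0_lessThan_Suc_shift) (simp add: mult.assoc)

lemma qpoch_eq_0_iff: "qpoch a q k = 0 \<longleftrightarrow> (\<exists>m<k. a * q ^ m = 1)"
  by (auto simp: qpoch_def)

text \<open>\<open>q_pow\<close> and \<open>rho_pow\<close> keep the denominators of the series
  nonzero, and \<open>sigma_pow\<close> the factor s - u in those of \<open>b0\<close>,
  \<open>b1\<close>, \<open>d0\<close>, \<open>d1\<close>. Together with \<open>rho_sigma\<close>
  they also make these coefficients nonzero on steps that stay in the triangle.\<close>

locale q_hahn =
  fixes N :: nat and q \<sigma> \<rho> :: complex
  assumes q_nz: "q \<noteq> 0"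
    and q_pow: "\<And>k. \<lbrakk>1 \<le> k; k \<le> N\<rbrakk> \<Longrightarrow> q ^ k \<noteq> 1"
    and rho_pow: "\<And>k. \<lbrakk>1 \<le> k; k \<le> N\<rbrakk> \<Longrightarrow> \<rho> * q ^ k \<noteq> 1"
    and sigma_pow: "\<And>k. \<lbrakk>2 \<le> k; k \<le> 2 * N\<rbrakk> \<Longrightarrow> \<sigma> * q ^ k \<noteq> 1"
    and rho_sigma: "\<And>k. \<lbrakk>1 \<le> k; k \<le> N\<rbrakk> \<Longrightarrow> \<rho> \<noteq> \<sigma> * q ^ k"
begin

text \<open>The factor depending on j is left out: these are the coefficients of a polynomial in
  q^-j in the basis (q^-j; q)_k, so that shifts of \<open>x\<close> and \<open>y\<close> act on the
  coefficients alone.\<close>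

definition cf :: "nat \<Rightarrow> nat \<Rightarrow> nat \<Rightarrow> complex" where
  "cf y x k = qpoch (1 / q ^ y) q k * qpoch (\<sigma> * q ^ (x + y + 1)) q k /
     (qpoch (\<rho> * q) q k * qpoch (q ^ x / q ^ N) q k * qpoch q q k) * q ^ k"

text \<open>A dual q-Hahn polynomial of degree j at the point y of a grid of length N - x; read in
  j, a q-Hahn polynomial of degree y. For j, y at most N, the terms between min(j, y) and N are 0
  because a numerator vanishes.\<close>

definition dual_hahn :: "nat \<Rightarrow> nat \<Rightarrow> nat \<Rightarrow> complex" where
  "dual_hahn j y x = (\<Sum>k\<le>N. cf y x k * qpoch (1 / q ^ j) q k)"

text \<open>
  The boundary cases \<open>y = 0\<close> and \<open>x + y = N\<close> are separated in \<open>b0\<close> and \<open>b1\<close> because the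
  hypotheses do not exclude \<open>s = u\<close> there, where the generic formula would be \<open>0 / 0\<close>.
  The index \<open>x\<close> of \<open>d0\<close> and \<open>d1\<close> is the target column \<open>x\<close> of the step \<open>x + 1 \<mapsto> x\<close>.
\<close>

definition b0 :: "nat \<Rightarrow> nat \<Rightarrow> complex" where
  "b0 x y = (let n = q ^ x / q ^ N; s = \<sigma> * q ^ (x + y + 1); u = 1 / q ^ y in
     if y = 0 then 1 else (1 - s) * (n - u) / ((1 - n) * (s - u)))"

definition b1 :: "nat \<Rightarrow> nat \<Rightarrow> complex" where
  "b1 x y = (let n = q ^ x / q ^ N; s = \<sigma> * q ^ (x + y + 1); u = 1 / q ^ y in
     if x + y = N then 1 else (1 - u) * (s - n) / ((1 - n) * (s - u)))"

definition d0 :: "nat \<Rightarrow> nat \<Rightarrow> complex" where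
  "d0 x y = (let n = q ^ x / q ^ N; s = \<sigma> * q ^ (x + y + 1); u = 1 / q ^ (y + 1) in
     (1 - n) * (s - \<rho>) / (n * (u - s)))"

definition d1 :: "nat \<Rightarrow> nat \<Rightarrow> complex" where
  "d1 x y = (let n = q ^ x / q ^ N; s = \<sigma> * q ^ (x + y + 1); u = 1 / q ^ (y + 1) in
     (1 - n) * (u - \<rho>) / (n * (s - u)))"

section \<open>Nonvanishing of denominators\<close>

lemma inv_pow_mult_neq_1:
  assumes "m < y" "y \<le> N"
  shows "1 / q ^ y * q ^ m \<noteq> 1"
proof
  assume "1 / q ^ y * q ^ m = 1"
  then have "q ^ m = q ^ y" using q_nz by (simp add: field_simps)
  also have "\<dots> = q ^ m * q ^ (y - m)" using assms by (simp flip: power_add)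
  finally have "q ^ m = q ^ m * q ^ (y - m)" .
  then have "q ^ (y - m) = 1" using q_nz by simp
  then show False using q_pow[of "y - m"] assms by auto
qed

lemma n_neq_1: "x < N \<Longrightarrow> q ^ x / q ^ N \<noteq> 1"
  using inv_pow_mult_neq_1[of x N] by simp

lemma inv_pow_neq_1: "\<lbrakk>1 \<le> y; y \<le> N\<rbrakk> \<Longrightarrow> 1 / q ^ y \<noteq> 1"
  using inv_pow_mult_neq_1[of 0 y] by simp

lemma s_neq_u:
  assumes "2 \<le> k + y" "k + y \<le> 2 * N"
  shows "\<sigma> * q ^ k \<noteq> 1 / q ^ y"
proof
  assume "\<sigma> * q ^ k = 1 / q ^ y"
  then have "\<sigma> * q ^ (k + y) = 1" using q_nz by (simp add: field_simps power_add)
  then show False using sigma_pow[of "k + y"] assms by auto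
qed

lemma s_neq_n:
  assumes "x + 2 \<le> k + N" "k \<le> N + x" "x \<le> N"
  shows "\<sigma> * q ^ k \<noteq> q ^ x / q ^ N"
proof
  assume "\<sigma> * q ^ k = q ^ x / q ^ N"
  then have "\<sigma> * q ^ (k + N) = q ^ x" using q_nz by (simp add: field_simps power_add)
  then have "\<sigma> * q ^ (k + N - x) * q ^ x = q ^ x"
    using assms by (simp add: mult.assoc flip: power_add)
  then have "\<sigma> * q ^ (k + N - x) = 1" using q_nz by simp
  then show False using sigma_pow[of "k + N - x"] assms by auto
qed

lemma rho_qpoch_nz: "k \<le> N \<Longrightarrow> qpoch (\<rho> * q) q k \<noteq> 0"
  using rho_pow[of "Suc _"] by (auto simp: qpoch_eq_0_iff mult.assoc)

lemma q_qpoch_nz: "k \<le> N \<Longrightarrow> qpoch q q k \<noteq> 0"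
  using q_pow[of "Suc _"] by (auto simp: qpoch_eq_0_iff)

lemma n_qpoch_nz:
  assumes "x + k \<le> N"
  shows "qpoch (q ^ x / q ^ N) q k \<noteq> 0"
proof -
  have "q ^ x / q ^ N * q ^ m \<noteq> 1" if "m < k" for m
    using n_neq_1[of "x + m"] that assms by (simp add: power_add)
  then show ?thesis by (auto simp: qpoch_eq_0_iff)
qed

lemma inv_pow_qpoch_0: "y < k \<Longrightarrow> qpoch (1 / q ^ y) q k = 0"
  using q_nz by (auto simp: qpoch_eq_0_iff intro!: exI[of _ y])

lemma dual_hahn_0 [simp]: "dual_hahn 0 y x = 1" "dual_hahn j 0 x = 1"
proof -
  have *: "(\<Sum>k\<le>N. if k = 0 then 1 else 0) = (1::complex)" by simp
  have "cf y x k * qpoch (1 / q ^ 0) q k = (if k = 0 then 1 else 0)" for k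
    using inv_pow_qpoch_0[of 0 k] by (auto simp: cf_def)
  then show "dual_hahn 0 y x = 1" unfolding dual_hahn_def by (simp only: *)
  have "cf 0 x k * qpoch (1 / q ^ j) q k = (if k = 0 then 1 else 0)" for k
    using inv_pow_qpoch_0[of 0 k] by (auto simp: cf_def)
  then show "dual_hahn j 0 x = 1" unfolding dual_hahn_def by (simp only: *)
qed

text \<open>The zeros switch off the terms of the raising relation whose target leaves the triangle:
  (x+1, y-1) at y = 0 and (x+1, y) at x + y = N.\<close>

lemma b_boundary:
  shows "b0 x 0 = 1" "x < N \<Longrightarrow> b1 x 0 = 0" "x + y = N \<Longrightarrow> y \<noteq> 0 \<Longrightarrow> b0 x y = 0" "x + y = N \<Longrightarrow> b1 x y = 1"
  using q_nz by (auto simp: b0_def b1_def Let_def power_add)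

text \<open>The k = 0 coefficient of the raising relation. It does not follow from
  \<open>b_identity\<close> at \<open>Q = 1\<close>, where the common factor (1 - u)(1 - s) vanishes
  for y = 0.\<close>

lemma b_sum:
  assumes "x < N" "x + y \<le> N"
  shows "b0 x y + b1 x y = 1"
proof -
  consider "y = 0" | "y \<noteq> 0" "x + y = N" | "y \<noteq> 0" "x + y < N" using assms by linarith
  then show ?thesis
  proof cases
    case 3
    define n s u where "n = q ^ x / q ^ N" and "s = \<sigma> * q ^ (x + y + 1)" and "u = 1 / q ^ y"
    have nz: "1 - n \<noteq> 0" "s - u \<noteq> 0"
      using n_neq_1[of x] s_neq_u[of "x+y+1" y] 3 by (auto simp: n_def s_def u_def)
    have "(1 - s) * (n - u) / ((1 - n) * (s - u)) + (1 - u) * (s - n) / ((1 - n) * (s - u))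
      = ((1 - s) * (n - u) + (1 - u) * (s - n)) / ((1 - n) * (s - u))"
      by (simp add: add_divide_distrib)
    also have "(1 - s) * (n - u) + (1 - u) * (s - n) = (1 - n) * (s - u)" by algebra
    finally show ?thesis using 3 nz
      unfolding b0_def b1_def by (simp add: Let_def n_def s_def u_def)
  qed (use assms in \<open>auto simp: b_boundary\<close>)
qed

text \<open>For k > 0 the k-th coefficient of the raising relation reduces to this with
  \<open>Q = q ^ k\<close>: shifting the base a of a Pochhammer symbol to aq trades its first factor
  1 - a for 1 - aQ.\<close>

lemma b_identity:
  fixes Q :: complex
  assumes "x < N" "x + y \<le> N"
  defines "n \<equiv> q ^ x / q ^ N" and "s \<equiv> \<sigma> * q ^ (x + y + 1)" and "u \<equiv> 1 / q ^ y"
  shows "(1 - n) * (b0 x y * ((1 - u) * (1 - s * Q)) + b1 x y * ((1 - u * Q) * (1 - s)))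
    = (1 - u) * (1 - s) * (1 - n * Q)"
proof -
  consider "y = 0" | "y \<noteq> 0" "x + y = N" | "y \<noteq> 0" "x + y < N" using assms by linarith
  then show ?thesis
  proof cases
    case 1
    then show ?thesis using assms by (simp add: b_boundary)
  next
    case 2
    then have "u = n" using q_nz unfolding u_def n_def by (auto simp: power_add)
    then show ?thesis using 2 by (simp add: b_boundary)
  next
    case 3
    have nz: "1 - n \<noteq> 0" "s - u \<noteq> 0"
      using n_neq_1[of x] s_neq_u[of "x+y+1" y] 3 by (auto simp: n_def s_def u_def)
    have b: "b0 x y = (1 - s) * (n - u) / ((1 - n) * (s - u))" "b1 x y = (1 - u) * (s - n) / ((1 - n) * (s - u))"
      using 3 by (auto simp: b0_def b1_def Let_def n_def s_def u_def)
    have "(1 - n) * (b0 x y * ((1 - u) * (1 - s * Q)) + b1 x y * ((1 - u * Q) * (1 - s)))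
      = ((1 - s) * (n - u) * ((1 - u) * (1 - s * Q)) + (1 - u) * (s - n) * ((1 - u * Q) * (1 - s))) / (s - u)"
      unfolding b using nz by (simp add: divide_simps) (simp add: algebra_simps)?
    also have "(1 - s) * (n - u) * ((1 - u) * (1 - s * Q)) + (1 - u) * (s - n) * ((1 - u * Q) * (1 - s))
      = (s - u) * ((1 - u) * (1 - s) * (1 - n * Q))" by algebra
    finally show ?thesis using nz by simp
  qed
qed

text \<open>Raising \<open>x\<close>: the identity holds term by term in the expansion in \<open>(q\<^sup>-\<^sup>j; q)\<^sub>k\<close>.\<close>

lemma dual_hahn_raise:
  assumes "x + j < N" "x + y \<le> N"
  shows "dual_hahn j y x = b0 x y * dual_hahn j y (x + 1) + b1 x y * dual_hahn j (y - 1) (x + 1)"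
proof -
  have "cf y x k * qpoch (1 / q ^ j) q k = (b0 x y * cf y (x + 1) k + b1 x y * cf (y - 1) (x + 1) k) * qpoch (1 / q ^ j) q k"
    if "k \<le> N" for k
  proof (cases "k > j")
    case True
    then show ?thesis by (simp add: inv_pow_qpoch_0)
  next
    case False
    show ?thesis
    proof (cases k)
      case 0
      then show ?thesis using b_sum[of x y] assms by (simp add: cf_def)
    next
      case (Suc m)
      define n s u where "n = q ^ x / q ^ N" and "s = \<sigma> * q ^ (x + y + 1)" and "u = 1 / q ^ y"
      have n': "q ^ (x + 1) / q ^ N = n * q" by (simp add: n_def)
      \<comment> \<open>Here k <= j < N - x, so the symbols for column x and for column x + 1 are
        both nonzero.\<close>
      have nn: "qpoch n q (Suc m) \<noteq> 0" "qpoch (n * q) q (Suc m) \<noteq> 0"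
        using n_qpoch_nz[of x k] n_qpoch_nz[of "x + 1" k] assms Suc False unfolding n' n_def[symmetric] by auto
      define R where "R = qpoch (\<rho> * q) q k * qpoch q q k"
      have R: "R \<noteq> 0" using rho_qpoch_nz q_qpoch_nz that by (simp add: R_def)
      define Q where "Q = q ^ k"
      have Qm: "q * q ^ m = Q" by (simp add: Q_def Suc)
      define U S M where "U = qpoch (u * q) q m" and "S = qpoch (s * q) q m" and "M = qpoch (n * q) q m"
      have un: "qpoch u q k = (1 - u) * U" "qpoch s q k = (1 - s) * S" "qpoch n q k = (1 - n) * M"
        by (auto simp: Suc qpoch_Suc_shift U_def S_def M_def)
      have sh: "qpoch (u * q) q k = U * (1 - u * Q)" "qpoch (s * q) q k = S * (1 - s * Q)" "qpoch (n * q) q k = M * (1 - n * Q)"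
        unfolding Suc qpoch_Suc U_def S_def M_def Q_def by (simp_all add: mult.assoc)
      have nz: "1 - n \<noteq> 0" "M \<noteq> 0" "1 - n * Q \<noteq> 0" using nn un sh Suc by auto
      have c: "cf y x k = (1 - u) * U * ((1 - s) * S) / (R * ((1 - n) * M)) * Q"
        unfolding un[symmetric] cf_def R_def unfolding n_def s_def u_def Q_def by (simp add: mult_ac)
      have s1: "\<sigma> * q ^ (x + 1 + y + 1) = s * q" by (simp add: s_def mult_ac power_add)
      have c0: "cf y (x + 1) k = (1 - u) * U * (S * (1 - s * Q)) / (R * (M * (1 - n * Q))) * Q"
        unfolding cf_def n' s1 sh u_def[symmetric] un R_def Q_def by (simp add: mult_ac)
      \<comment> \<open>The factor \<open>b1 x y\<close> is kept to cover y = 0, where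
        \<open>y - 1\<close> truncates but \<open>b1\<close> vanishes.\<close>
      have c1: "b1 x y * cf (y - 1) (x + 1) k = b1 x y * (U * (1 - u * Q) * ((1 - s) * S) / (R * (M * (1 - n * Q))) * Q)"
      proof (cases y)
        case 0
        then show ?thesis using b_boundary[of x] assms by simp
      next
        case (Suc y')
        have u1: "1 / q ^ (y - 1) = u * q" using Suc q_nz by (simp add: u_def)
        have s2: "\<sigma> * q ^ (x + 1 + (y - 1) + 1) = s" using Suc by (simp add: s_def)
        show ?thesis unfolding cf_def n' u1 s2 sh un R_def Q_def by (simp add: mult_ac)
      qed
      have id: "(1 - n) * (b0 x y * ((1 - u) * (1 - s * Q)) + b1 x y * ((1 - u * Q) * (1 - s)))
        = (1 - u) * (1 - s) * (1 - n * Q)"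
        using b_identity[of x y Q] assms unfolding n_def s_def u_def by simp
      have "b0 x y * cf y (x + 1) k + b1 x y * cf (y - 1) (x + 1) k
         = U * S * Q / (R * M * (1 - n * Q)) * (b0 x y * ((1 - u) * (1 - s * Q)) + b1 x y * ((1 - u * Q) * (1 - s)))"
        unfolding c0 c1 distrib_left by (simp add: mult_ac)
      also have "\<dots> = U * S * Q / (R * M * (1 - n * Q)) * ((1 - u) * (1 - s) * (1 - n * Q) / (1 - n))"
        using id nz(1) by (metis nonzero_mult_div_cancel_left)
      also have "\<dots> = cf y x k" unfolding c using nz R by (simp add: mult_ac)
      finally show ?thesis by simp
    qed
  qed
  then have "dual_hahn j y x = (\<Sum>k\<le>N. (b0 x y * cf y (x + 1) k + b1 x y * cf (y - 1) (x + 1) k) * qpoch (1 / q ^ j) q k)"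
    unfolding dual_hahn_def by (intro sum.cong) auto
  also have "\<dots> = b0 x y * dual_hahn j y (x + 1) + b1 x y * dual_hahn j (y - 1) (x + 1)"
    unfolding dual_hahn_def sum_distrib_left by (simp add: algebra_simps flip: sum.distrib)
  finally show ?thesis .
qed


text \<open>The term ratio of the series, cleared of denominators. For y <= k both sides are 0,
  which takes care of the indices at which (q^(x-N); q)_k may vanish.\<close>

lemma cf_Suc:
  assumes "k < N" "x + y \<le> N"
  shows "cf y x (Suc k) * ((1 - \<rho> * q * q ^ k) * (1 - q ^ x / q ^ N * q ^ k) * (1 - q * q ^ k))
    = cf y x k * ((1 - 1 / q ^ y * q ^ k) * (1 - \<sigma> * q ^ (x + y + 1) * q ^ k) * q)"
proof (cases "k \<ge> y")
  case True
  then have "cf y x (Suc k) = 0" by (simp add: cf_def inv_pow_qpoch_0)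
  moreover have "cf y x k * (1 - 1 / q ^ y * q ^ k) = 0"
    using True q_nz by (cases "k = y") (simp_all add: cf_def inv_pow_qpoch_0)
  ultimately show ?thesis by auto
next
  case False
  define n where "n = q ^ x / q ^ N"
  have nz: "qpoch n q (Suc k) \<noteq> 0" "qpoch (\<rho> * q) q (Suc k) \<noteq> 0" "qpoch q q (Suc k) \<noteq> 0"
    using n_qpoch_nz[of x "Suc k"] rho_qpoch_nz[of "Suc k"] q_qpoch_nz[of "Suc k"] False assms
    by (auto simp: n_def)
  then show ?thesis unfolding cf_def n_def[symmetric] qpoch_Suc
    by (simp add: divide_simps)
qed

text \<open>Lowering \<open>x\<close>: multiplication by \<open>q\<^sup>-\<^sup>j\<close> shifts the expansion index \<open>k\<close> by one, so the
  coefficients at \<open>k\<close> and \<open>k - 1\<close> combine.\<close>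

lemma dual_hahn_lower:
  assumes "x + y < N" "j \<le> N"
  shows "(1 - q ^ N / q ^ x / q ^ j) * dual_hahn j y (x + 1) = d0 x y * dual_hahn j y x + d1 x y * dual_hahn j (y + 1) x"
proof -
  define n s u J where "n = q ^ x / q ^ N" and "s = \<sigma> * q ^ (x + y + 1)" and "u = 1 / q ^ (y + 1)" and "J = 1 / q ^ j"
  have n0: "n \<noteq> 0" "1 - n \<noteq> 0" "u - s \<noteq> 0" "s - u \<noteq> 0"
    using q_nz n_neq_1[of x] s_neq_u[of "x + y + 1" "y + 1"] assms by (auto simp: n_def s_def u_def)
  have d: "d0 x y = (1 - n) * (s - \<rho>) / (n * (u - s))" "d1 x y = (1 - n) * (u - \<rho>) / (n * (s - u))"
    by (auto simp: d0_def d1_def Let_def n_def s_def u_def)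
  \<comment> \<open>With J = q^-j, 1 - J/n = (1 - 1/(n q^k)) + (1 - J q^k)/(n q^k), and the factor 1
    - J q^k extends (J; q)_k to index k + 1. \<open>A\<close> collects the part that keeps the
    index, \<open>B\<close> the part that moves.\<close>
  define A where "A k = cf y (x + 1) k * ((1 - 1 / (n * q ^ k)) * qpoch J q k)" for k
  define B where "B k = cf y (x + 1) k * (1 / (n * q ^ k) * qpoch J q (Suc k))" for k
  define R where "R k = (d0 x y * cf y x k + d1 x y * cf (y + 1) x k) * qpoch J q k" for k
  have AB: "(1 - J / n) * (cf y (x + 1) k * qpoch J q k) = A k + B k" for k
    using q_nz n0 by (simp add: A_def B_def qpoch_Suc field_simps)
  have R0: "A 0 = R 0"
  proof -
    have "d0 x y + d1 x y = (1 - n) / n * ((s - \<rho>) / (u - s) + (u - \<rho>) / (s - u))"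
      unfolding d by (simp add: distrib_left)
    also have "(s - \<rho>) / (u - s) + (u - \<rho>) / (s - u) = -1"
      using n0 by (simp add: divide_simps) (simp add: algebra_simps)?
    finally show ?thesis using n0 by (simp add: A_def R_def cf_def divide_simps)
  qed
  have Rk: "A (Suc m) + B m = R (Suc m)" if m: "m < N" for m
  proof -
    have n': "q ^ (x + 1) / q ^ N = n * q" by (simp add: n_def)
    define U S M where "U = qpoch (u * q) q m" and "S = qpoch (s * q) q m" and "M = qpoch (n * q) q m"
    define Q where "Q = q ^ Suc m"
    have qm: "q ^ m = Q / q" using q_nz by (simp add: Q_def)
    have Q0: "Q \<noteq> 0" using q_nz by (simp add: Q_def)
    have uq: "1 / q ^ y = u * q" using q_nz by (simp add: u_def)
    have s1: "\<sigma> * q ^ (x + 1 + y + 1) = s * q" "\<sigma> * q ^ (x + (y + 1) + 1) = s * q"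
      by (simp_all add: s_def mult_ac power_add)
    define W where "W = qpoch (\<rho> * q) q (Suc m) * qpoch q q (Suc m)"
    have W: "qpoch (\<rho> * q) q (Suc m) \<noteq> 0" "qpoch q q (Suc m) \<noteq> 0" "W \<noteq> 0" 
      using rho_qpoch_nz q_qpoch_nz m by (simp_all add: W_def)
    have W': "qpoch (\<rho> * q) q m * qpoch q q m = W / ((1 - \<rho> * Q) * (1 - Q))" "(1 - \<rho> * Q) * (1 - Q) \<noteq> 0"
      using W by (auto simp: W_def qpoch_Suc Q_def mult.assoc)
    show ?thesis
    proof (cases "m \<le> y")
      case False
      then show ?thesis using inv_pow_qpoch_0[of "y + 1" "Suc m"]
        by (simp add: A_def B_def R_def cf_def inv_pow_qpoch_0)
    next
      case True
      have M0: "M \<noteq> 0" using n_qpoch_nz[of "x + 1" m] True assms unfolding n' M_def by simp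
      have a1: "qpoch (u * q) q (Suc m) = U * (1 - u * Q)" "qpoch (s * q) q (Suc m) = S * (1 - s * Q)"
           "qpoch (n * q) q (Suc m) = M * (1 - n * Q)"
        by (simp_all add: qpoch_Suc U_def S_def M_def Q_def mult.assoc)
      have a2: "qpoch u q (Suc m) = (1 - u) * U" "qpoch s q (Suc m) = (1 - s) * S" "qpoch n q (Suc m) = (1 - n) * M"
        by (simp_all add: qpoch_Suc_shift U_def S_def M_def)
      have cm: "cf y (x + 1) m = U * S / (W / ((1 - \<rho> * Q) * (1 - Q)) * M) * (Q / q)"
        unfolding W'(1)[symmetric] cf_def n' uq s1 U_def S_def M_def qm[symmetric] by (simp add: mult_ac)
      have c1: "cf y (x + 1) (Suc m) * (1 - 1 / (n * Q)) = - (U * (1 - u * Q) * (S * (1 - s * Q)) / (W * M * (n * Q))) * Q"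
      proof (cases "1 - n * Q = 0")
        \<comment> \<open>Here the coefficient of column x + 1 divides by 0. This happens only for m
          = y and x + y + 1 = N, where 1 - u Q vanishes as well and both sides are 0.\<close>
        case True
        have "m = y"
        proof (rule ccontr)
          assume "m \<noteq> y"
          with \<open>m \<le> y\<close> assms have "x + Suc m < N" by simp
          from n_neq_1[OF this] True show False by (simp add: n_def Q_def power_add mult_ac)
        qed
        then have "u * Q = 1" using q_nz by (simp add: u_def Q_def)
        then show ?thesis using True by simp
      next
        case False
        have e1: "cf y (x + 1) (Suc m) = U * (1 - u * Q) * (S * (1 - s * Q)) / (W * (M * (1 - n * Q))) * Q"
          unfolding cf_def n' uq s1 a1 W_def Q_def by (simp add: mult_ac)
        have e2: "1 - 1 / (n * Q) = - (1 - n * Q) / (n * Q)"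
          using n0 Q0 by (simp add: field_simps)
        have gen: "a / (W * (M * c)) * Q * (- c / (n * Q)) = - (a / (W * M * (n * Q))) * Q" if "c \<noteq> 0" for a c
          using that by simp
        show ?thesis unfolding e1 e2 by (rule gen[OF False])
      qed
      have c2: "cf y x (Suc m) = U * (1 - u * Q) * ((1 - s) * S) / (W * ((1 - n) * M)) * Q"
        unfolding cf_def n_def[symmetric] s_def[symmetric] uq a1 a2 W_def Q_def by (simp add: mult_ac)
      have c3: "cf (y + 1) x (Suc m) = (1 - u) * U * (S * (1 - s * Q)) / (W * ((1 - n) * M)) * Q"
        unfolding cf_def n_def[symmetric] s1 u_def[symmetric] a1 a2 W_def Q_def by (simp add: mult_ac)
      define F where "F = U * S * Q / (W * M)"
      have l: "A (Suc m) + B m = F * ((- ((1 - u * Q) * (1 - s * Q)) + (1 - \<rho> * Q) * (1 - Q)) / (n * Q)) * qpoch J q (Suc m)"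
      proof -
        have "A (Suc m) = (cf y (x + 1) (Suc m) * (1 - 1 / (n * Q))) * qpoch J q (Suc m)"
          by (simp add: A_def Q_def)
        also have "\<dots> = F * (- ((1 - u * Q) * (1 - s * Q)) / (n * Q)) * qpoch J q (Suc m)"
          unfolding c1 F_def by (simp add: divide_simps)
        finally have 1: "A (Suc m) = F * (- ((1 - u * Q) * (1 - s * Q)) / (n * Q)) * qpoch J q (Suc m)" .
        have "B m = F * ((1 - \<rho> * Q) * (1 - Q) / (n * Q)) * qpoch J q (Suc m)"
          unfolding B_def cm F_def qm using W' W M0 q_nz Q0 n0 by (simp add: field_simps)
        with 1 show ?thesis by (simp only: add_divide_distrib distrib_left distrib_right)
      qed
      have r: "R (Suc m) = F * ((d0 x y * ((1 - u * Q) * (1 - s)) + d1 x y * ((1 - u) * (1 - s * Q))) / (1 - n)) * qpoch J q (Suc m)"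
      proof -
        have "d0 x y * (U * a * (b * S) / (W * (c * M)) * Q) + d1 x y * (a' * U * (S * b') / (W * (c * M)) * Q)
          = U * S * Q / (W * M) * ((d0 x y * (a * b) + d1 x y * (a' * b')) / c)" for a b a' b' c
          by (simp add: distrib_left add_divide_distrib mult_ac)
        then show ?thesis unfolding R_def c2 c3 F_def by simp
      qed
      have "(d0 x y * ((1 - u * Q) * (1 - s)) + d1 x y * ((1 - u) * (1 - s * Q))) / (1 - n)
         = ((s - \<rho>) * ((1 - u * Q) * (1 - s)) - (u - \<rho>) * ((1 - u) * (1 - s * Q))) / (n * (u - s))"
        unfolding d using n0 by (simp add: divide_simps) (simp add: algebra_simps)?
      also have "\<dots> = (- ((1 - u * Q) * (1 - s * Q)) + (1 - \<rho> * Q) * (1 - Q)) / (n * Q)"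
      proof -
        have "((s - \<rho>) * ((1 - u * Q) * (1 - s)) - (u - \<rho>) * ((1 - u) * (1 - s * Q))) * Q
          = (- ((1 - u * Q) * (1 - s * Q)) + (1 - \<rho> * Q) * (1 - Q)) * (u - s)" by algebra
        then show ?thesis using n0 Q0 by (simp add: frac_eq_eq mult_ac)
      qed
      finally show ?thesis unfolding l r by simp
    qed
  qed
  \<comment> \<open>The shifted sum would spill over to index N + 1, but (q^-j; q)_(N+1) = 0 for j
    <= N.\<close>
  have BN: "B N = 0" using inv_pow_qpoch_0[of j "Suc N"] assms by (simp add: B_def J_def)
  have "q ^ N / q ^ x / q ^ j = J / n" using q_nz by (simp add: n_def J_def)
  then have "(1 - q ^ N / q ^ x / q ^ j) * dual_hahn j y (x + 1) = (\<Sum>k\<le>N. A k + B k)"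
    unfolding dual_hahn_def sum_distrib_left AB[symmetric] J_def by simp
  also have "\<dots> = (\<Sum>k\<le>N. A k) + (\<Sum>k\<le>N. B k)" by (rule sum.distrib)
  also have "\<dots> = A 0 + (\<Sum>k<N. A (Suc k) + B k)"
  proof -
    have "(\<Sum>k\<le>N. A k) = A 0 + (\<Sum>k<N. A (Suc k))" by (rule sum.atMost_shift)
    moreover have "(\<Sum>k\<le>N. B k) = (\<Sum>k<N. B k)" using BN by (simp flip: lessThan_Suc_atMost)
    ultimately show ?thesis by (simp add: sum.distrib)
  qed
  also have "\<dots> = (\<Sum>k\<le>N. R k)"
    unfolding sum.atMost_shift R0 using Rk by simp
  also have "\<dots> = d0 x y * dual_hahn j y x + d1 x y * dual_hahn j (y + 1) x"
    unfolding dual_hahn_def R_def J_def sum_distrib_left by (simp add: algebra_simps flip: sum.distrib)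
  finally show ?thesis .
qed

text \<open>The difference equation of the q-Hahn polynomial of degree y in q^-j. On the basis (z;
  q)_k with z = q^-j, the difference operator reaches only the indices k and k - 1 (fact
  \<open>L\<close>); comparing coefficients leaves the term recurrence \<open>cf_Suc\<close> (facts
  \<open>K\<close> and \<open>KN\<close>).\<close>

lemma dual_hahn_difference:
  assumes "x + y \<le> N" "x + j \<le> N"
  shows "(1 / q ^ y - 1) * (1 - \<sigma> * q ^ (x + y + 1)) * dual_hahn j y x
    = (1 - q ^ (x + j) / q ^ N) * (1 - \<rho> * q ^ (j + 1)) * (dual_hahn (j + 1) y x - dual_hahn j y x)
      + q * (1 - q ^ j) * (\<sigma> * q ^ x - \<rho> * q ^ (x + j) / q ^ (N + 1)) * (dual_hahn (j - 1) y x - dual_hahn j y x)"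
proof -
  define n s u z where "n = q ^ x / q ^ N" and "s = \<sigma> * q ^ (x + y + 1)" and "u = 1 / q ^ y" and "z = 1 / q ^ j"
  have z0: "z \<noteq> 0" "q ^ j = 1 / z" using q_nz by (auto simp: z_def)
  define C D where "C = (1 - n / z) * (1 - \<rho> * q / z)" and "D = q * (1 - 1 / z) * (\<sigma> * q ^ x - \<rho> * n / (q * z))"
  have CD: "C = (1 - q ^ (x + j) / q ^ N) * (1 - \<rho> * q ^ (j + 1))"
     "D = q * (1 - q ^ j) * (\<sigma> * q ^ x - \<rho> * q ^ (x + j) / q ^ (N + 1))"
    using q_nz by (simp_all add: C_def D_def z_def n_def power_add mult_ac)
  define lam where "lam k = 1 / q ^ k * (1 - q ^ k) * (1 - \<sigma> * q ^ (x + 1) * q ^ k)" for k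
  define kap where "kap k = 1 / q ^ k * (1 - q ^ k) * (1 - n * q ^ k / q) * (1 - \<rho> * q ^ k)" for k
  have L: "C * (qpoch (z / q) q k - qpoch z q k) + D * (qpoch (z * q) q k - qpoch z q k)
      = lam k * qpoch z q k - kap k * (if k = 0 then 0 else qpoch z q (k - 1))" for k
  proof (cases k)
    case 0
    then show ?thesis by (simp add: lam_def kap_def)
  next
    case (Suc m)
    define Q where "Q = q ^ k"
    have Q0: "Q \<noteq> 0" using q_nz by (simp add: Q_def)
    define G where "G = qpoch z q m"
    have zk: "qpoch z q k = G * (1 - z * Q / q)" using q_nz by (simp add: Suc qpoch_Suc G_def Q_def)
    have "qpoch (z / q) q k = (1 - z / q) * G" using q_nz by (simp add: Suc qpoch_Suc_shift G_def)
    then have 1: "qpoch (z / q) q k - qpoch z q k = - (z / q) * (1 - Q) * G"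
      unfolding zk by (simp add: algebra_simps add_divide_distrib diff_divide_distrib)
    have "qpoch (z * q) q k - qpoch z q k = qpoch (z * q) q m * z * (1 - Q)"
      unfolding Q_def Suc qpoch_Suc_shift[of z] qpoch_Suc[of "z * q"] by (simp add: algebra_simps)
    then have "(1 - 1 / z) * (qpoch (z * q) q k - qpoch z q k) = (1 - 1 / z) * z * qpoch (z * q) q m * (1 - Q)"
      by simp
    also have "(1 - 1 / z) * z = - (1 - z)" using z0 by (simp add: field_simps)
    also have "- (1 - z) * qpoch (z * q) q m = - qpoch z q k" by (simp add: Suc qpoch_Suc_shift[of z] algebra_simps)
    finally have 2: "(1 - 1 / z) * (qpoch (z * q) q k - qpoch z q k) = - (1 - Q) * qpoch z q k"
      by (simp add: algebra_simps)
    have "C * (qpoch (z / q) q k - qpoch z q k) + D * (qpoch (z * q) q k - qpoch z q k)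
      = C * (- (z / q) * (1 - Q) * G) + q * (\<sigma> * q ^ x - \<rho> * n / (q * z)) * (- (1 - Q) * qpoch z q k)"
      unfolding 1 D_def 2[symmetric] by (simp add: mult_ac)
    also have "\<dots> = (1 - Q) * G * (- C * (z / q) - (1 - z * Q / q) * (q * (\<sigma> * q ^ x - \<rho> * n / (q * z))))"
    proof -
      have "C * (- w * (1 - Q) * G) + q * E * (- (1 - Q) * (G * v)) = (1 - Q) * G * (- C * w - v * (q * E))" for E v w
        by algebra
      then show ?thesis unfolding zk .
    qed
    also have "- C * (z / q) - (1 - z * Q / q) * (q * (\<sigma> * q ^ x - \<rho> * n / (q * z)))
       = 1 / Q * (1 - \<sigma> * q ^ (x + 1) * Q) * (1 - z * Q / q) - 1 / Q * (1 - n * Q / q) * (1 - \<rho> * Q)"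
      unfolding C_def using z0(1) q_nz Q0 by (simp add: field_simps)
    also have "(1 - Q) * G * \<dots> = lam k * qpoch z q k - kap k * (if k = 0 then 0 else qpoch z q (k - 1))"
    proof -
      have 1: "lam k = 1 / Q * (1 - Q) * (1 - \<sigma> * q ^ (x + 1) * Q)" by (simp add: lam_def Q_def)
      have 2: "kap k = 1 / Q * (1 - Q) * (1 - n * Q / q) * (1 - \<rho> * Q)" by (simp add: kap_def Q_def)
      have 3: "(if k = 0 then 0 else qpoch z q (k - 1)) = G" by (simp add: Suc G_def)
      have "(1 - Q) * G * (a * b * v - a * c * d) = a * (1 - Q) * b * (G * v) - a * (1 - Q) * c * d * G" for a b c d v
        by algebra
      then show ?thesis unfolding 1 2 3 zk .
    qed
    finally show ?thesis .
  qed
  have K: "lam k * cf y x k - kap (Suc k) * cf y x (Suc k) = (u - 1) * (1 - s) * cf y x k" if "k < N" for k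
  proof -
    define Q where "Q = q ^ k"
    have Q0: "Q \<noteq> 0" using q_nz by (simp add: Q_def)
    have us: "u * s = \<sigma> * q ^ (x + 1)" using q_nz by (simp add: u_def s_def power_add)
    have "kap (Suc k) * cf y x (Suc k) = 1 / (Q * q) * (cf y x (Suc k) * ((1 - \<rho> * q * Q) * (1 - n * Q) * (1 - q * Q)))"
      using q_nz Q0 by (simp add: kap_def Q_def mult_ac)
    also have "\<dots> = 1 / Q * (1 - u * Q) * (1 - s * Q) * cf y x k"
      using cf_Suc[OF that assms(1)] q_nz Q0 unfolding n_def s_def u_def Q_def by simp
    finally have 1: "kap (Suc k) * cf y x (Suc k) = 1 / Q * (1 - u * Q) * (1 - s * Q) * cf y x k" .
    have 2: "lam k = 1 / Q * (1 - Q) * (1 - u * s * Q)" by (simp add: lam_def Q_def us)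
    have "a * (1 - Q) * (1 - u * s * Q) * c - a * (1 - u * Q) * (1 - s * Q) * c
      = a * ((1 - Q) * (1 - u * s * Q) - ((1 - u * Q) * (1 - s * Q))) * c" for a c
      by algebra
    then have "lam k * cf y x k - kap (Suc k) * cf y x (Suc k)
      = 1 / Q * ((1 - Q) * (1 - u * s * Q) - ((1 - u * Q) * (1 - s * Q))) * cf y x k"
      unfolding 1 2 .
    also have "(1 - Q) * (1 - u * s * Q) - ((1 - u * Q) * (1 - s * Q)) = Q * ((u - 1) * (1 - s))" by algebra
    finally show ?thesis using Q0 by simp
  qed
  \<comment> \<open>At k = N there is no successor term. The coefficient can be nonzero only for y =
    N, hence x = 0, and there \<open>lam N\<close> already is the eigenvalue.\<close>
  have KN: "lam N * cf y x N = (u - 1) * (1 - s) * cf y x N"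
  proof (cases "y = N")
    case True
    then have "x = 0" using assms by simp
    then show ?thesis using True q_nz by (simp add: lam_def u_def s_def field_simps power_add)
  next
    case False
    then show ?thesis using assms by (simp add: cf_def inv_pow_qpoch_0)
  qed
  have j1: "1 / q ^ (j + 1) = z / q" by (simp add: z_def)
  \<comment> \<open>At j = 0 the index \<open>j - 1\<close> truncates, but \<open>D\<close> contains
    the factor 1 - q^j, which is 0 there.\<close>
  have j2: "D * f (1 / q ^ (j - 1)) = D * f (z * q)" for f :: "complex \<Rightarrow> complex"
    using q_nz by (cases j) (simp_all add: z_def D_def)
  have "(u - 1) * (1 - s) * dual_hahn j y x = (\<Sum>k<N. (u - 1) * (1 - s) * cf y x k * qpoch z q k) + (u - 1) * (1 - s) * cf y x N * qpoch z q N"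
    unfolding dual_hahn_def lessThan_Suc_atMost[symmetric] z_def by (simp add: sum_distrib_left algebra_simps)
  also have "\<dots> = (\<Sum>k<N. (lam k * cf y x k - kap (Suc k) * cf y x (Suc k)) * qpoch z q k) + lam N * cf y x N * qpoch z q N"
    unfolding KN[symmetric] using K by simp
  also have "\<dots> = (\<Sum>k\<le>N. lam k * cf y x k * qpoch z q k) - (\<Sum>k<N. kap (Suc k) * cf y x (Suc k) * qpoch z q k)"
    unfolding lessThan_Suc_atMost[symmetric] by (simp add: left_diff_distrib sum_subtractf)
  also have "(\<Sum>k<N. kap (Suc k) * cf y x (Suc k) * qpoch z q k) = (\<Sum>k\<le>N. kap k * cf y x k * (if k = 0 then 0 else qpoch z q (k - 1)))"
    unfolding sum.atMost_shift by simp
  also have "(\<Sum>k\<le>N. lam k * cf y x k * qpoch z q k) - (\<Sum>k\<le>N. kap k * cf y x k * (if k = 0 then 0 else qpoch z q (k - 1)))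
     = (\<Sum>k\<le>N. cf y x k * (lam k * qpoch z q k - kap k * (if k = 0 then 0 else qpoch z q (k - 1))))"
    unfolding sum_subtractf[symmetric] by (intro sum.cong) (simp_all add: algebra_simps)
  also have "\<dots> = C * ((\<Sum>k\<le>N. cf y x k * qpoch (z / q) q k) - (\<Sum>k\<le>N. cf y x k * qpoch z q k))
     + D * ((\<Sum>k\<le>N. cf y x k * qpoch (z * q) q k) - (\<Sum>k\<le>N. cf y x k * qpoch z q k))"
    unfolding L[symmetric] sum_subtractf[symmetric] sum_distrib_left sum.distrib[symmetric]
    by (intro sum.cong) (simp_all add: algebra_simps)
  also have "\<dots> = C * (dual_hahn (j + 1) y x - dual_hahn j y x) + D * (dual_hahn (j - 1) y x - dual_hahn j y x)"
    using j2[of "\<lambda>a. (\<Sum>k\<le>N. cf y x k * qpoch a q k) - (\<Sum>k\<le>N. cf y x k * qpoch z q k)"]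
    unfolding dual_hahn_def j1 z_def[symmetric] by auto
  finally show ?thesis unfolding CD u_def s_def .
qed


section \<open>Nonvanishing of the connecting coefficients, and the weight\<close>

lemma b0_nz:
  assumes "x + y < N"
  shows "b0 x y \<noteq> 0"
proof (cases "y = 0")
  case False
  have "q ^ x / q ^ N \<noteq> 1 / q ^ y"
  proof
    assume "q ^ x / q ^ N = 1 / q ^ y"
    then have "q ^ (x + y) / q ^ N = 1" using q_nz by (simp add: field_simps power_add)
    then show False using n_neq_1[of "x + y"] assms by simp
  qed
  moreover have "\<sigma> * q ^ (x + y + 1) \<noteq> 1" using sigma_pow[of "x + y + 1"] assms False by auto
  ultimately show ?thesis
    using False n_neq_1[of x] s_neq_u[of "x + y + 1" y] assms by (auto simp: b0_def Let_def)
qed (simp add: b_boundary)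

lemma b1_nz:
  assumes "1 \<le> y" "x + y \<le> N"
  shows "b1 x y \<noteq> 0"
proof (cases "x + y = N")
  case False
  then show ?thesis
    using inv_pow_neq_1[of y] n_neq_1[of x] s_neq_u[of "x + y + 1" y] s_neq_n[of x "x + y + 1"] assms
    by (auto simp: b1_def Let_def)
qed (simp add: b_boundary)

lemma d0_nz:
  assumes "x + y < N"
  shows "d0 x y \<noteq> 0"
  using n_neq_1[of x] s_neq_u[of "x + y + 1" "y + 1"] rho_sigma[of "x + y + 1"] q_nz assms
  by (auto simp: d0_def Let_def)

lemma d1_nz:
  assumes "x + y < N"
  shows "d1 x y \<noteq> 0"
proof -
  have "1 / q ^ (y + 1) \<noteq> \<rho>"
  proof
    assume "1 / q ^ (y + 1) = \<rho>"
    then have "\<rho> * q ^ (y + 1) = 1" using q_nz by auto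
    then show False using rho_pow[of "y + 1"] assms by auto
  qed
  then show ?thesis
    using n_neq_1[of x] s_neq_u[of "x + y + 1" "y + 1"] q_nz assms
    by (auto simp: d1_def Let_def)
qed

text \<open>Away from the column \<open>x = 0\<close> the generic formulas for \<open>b0\<close> and \<open>b1\<close> also hold on the boundary.\<close>

lemma b_generic:
  assumes "1 \<le> x" "x + y \<le> N" "x < N"
  shows "b0 x y = (1 - \<sigma> * q ^ (x + y + 1)) * (q ^ x / q ^ N - 1 / q ^ y) /
        ((1 - q ^ x / q ^ N) * (\<sigma> * q ^ (x + y + 1) - 1 / q ^ y))"
    and "b1 x y = (1 - 1 / q ^ y) * (\<sigma> * q ^ (x + y + 1) - q ^ x / q ^ N) /
        ((1 - q ^ x / q ^ N) * (\<sigma> * q ^ (x + y + 1) - 1 / q ^ y))"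
proof -
  have nz: "1 - q ^ x / q ^ N \<noteq> 0" "\<sigma> * q ^ (x + y + 1) - 1 / q ^ y \<noteq> 0"
    using n_neq_1[of x] s_neq_u[of "x + y + 1" y] assms by auto
  have gen: "(1 - t) * (n - 1) / ((1 - n) * (t - 1)) = 1" if "1 - n \<noteq> 0" "t - 1 \<noteq> 0" for n t :: complex
  proof -
    have "(1 - t) * (n - 1) = (1 - n) * (t - 1)" by algebra
    then show ?thesis using that by simp
  qed
  show "b0 x y = (1 - \<sigma> * q ^ (x + y + 1)) * (q ^ x / q ^ N - 1 / q ^ y) /
        ((1 - q ^ x / q ^ N) * (\<sigma> * q ^ (x + y + 1) - 1 / q ^ y))"
  proof (cases "y = 0")
    case True
    then show ?thesis using nz gen[of "q ^ x / q ^ N" "\<sigma> * q ^ (x + y + 1)"] by (simp add: b0_def Let_def)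
  next
    case False
    then show ?thesis by (simp add: b0_def Let_def)
  qed
  show "b1 x y = (1 - 1 / q ^ y) * (\<sigma> * q ^ (x + y + 1) - q ^ x / q ^ N) /
        ((1 - q ^ x / q ^ N) * (\<sigma> * q ^ (x + y + 1) - 1 / q ^ y))"
  proof (cases "x + y = N")
    case True
    then have "q ^ x / q ^ N = 1 / q ^ y" using q_nz by (auto simp: power_add)
    then show ?thesis using nz True unfolding b1_def Let_def by simp
  next
    case False
    then show ?thesis by (simp add: b1_def Let_def)
  qed
qed

text \<open>Path independence of the weight around a unit square: \<open>wt\<close> is built from
  the balance of \<open>b1\<close> against \<open>d1\<close>, and this is the cycle condition under
  which \<open>b0\<close> and \<open>d0\<close> balance as well.\<close>

lemma square_relation:
  assumes "x + y + 2 \<le> N"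
  shows "d1 x y * b0 x (Suc y) * d0 (Suc x) y * b1 (Suc x) (Suc y)
    = b1 x (Suc y) * b0 (Suc x) y * d1 (Suc x) y * d0 x (Suc y)"
proof -
  define n s u where "n = q ^ x / q ^ N" and "s = \<sigma> * q ^ (x + y + 1)" and "u = 1 / q ^ (y + 1)"
  have n1: "q ^ Suc x / q ^ N = n * q" by (simp add: n_def)
  have s1: "\<sigma> * q ^ (x + Suc y + 1) = s * q" "\<sigma> * q ^ (Suc x + y + 1) = s * q"
    "\<sigma> * q ^ (Suc x + Suc y + 1) = s * q * q" by (simp_all add: s_def mult_ac)
  have u1: "1 / q ^ Suc y = u" "1 / q ^ y = u * q" "1 / q ^ (Suc y + 1) = u / q"
    using q_nz by (simp_all add: u_def)
  have nz: "1 - n \<noteq> 0" "1 - n * q \<noteq> 0" "s - u \<noteq> 0" "s * q - u \<noteq> 0" "s * q * q - u \<noteq> 0" "n \<noteq> 0"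
    using n_neq_1[of x] n_neq_1[of "Suc x"] s_neq_u[of "x + y + 1" "y + 1"]
      s_neq_u[of "x + y + 2" "y + 1"] s_neq_u[of "x + y + 3" "y + 1"] assms q_nz
    by (auto simp: n_def s_def u_def power_add power3_eq_cube power2_eq_square mult_ac)
  have "d1 x y = (1 - n) * (u - \<rho>) / (n * (s - u))"
    by (simp add: d1_def Let_def n_def s_def u_def)
  moreover have "b0 x (Suc y) = (1 - s * q) * (n - u) / ((1 - n) * (s * q - u))"
    unfolding b0_def Let_def s1 u1 n_def by simp
  moreover have "d0 (Suc x) y = (1 - n * q) * (s * q - \<rho>) / (n * q * - (s * q - u))"
    unfolding d0_def Let_def s1 n1 u_def by simp
  moreover have "b1 (Suc x) (Suc y) = (1 - u) * (q * (s * q - n)) / ((1 - n * q) * (s * q * q - u))"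
    using b_generic(2)[of "Suc x" "Suc y"] assms unfolding n1 s1 u1 by (simp add: algebra_simps)
  moreover have "b1 x (Suc y) = (1 - u) * (s * q - n) / ((1 - n) * (s * q - u))"
    using assms unfolding b1_def Let_def s1 u1 n_def by simp
  moreover have "b0 (Suc x) y = (1 - s * q) * (q * (n - u)) / ((1 - n * q) * (q * (s - u)))"
    using b_generic(1)[of "Suc x" y] assms unfolding n1 s1 u1 by (simp add: algebra_simps)
  moreover have "d1 (Suc x) y = (1 - n * q) * (u - \<rho>) / (n * q * (s * q - u))"
    unfolding d1_def Let_def s1 n1 u_def by simp
  moreover have "d0 x (Suc y) = (1 - n) * (s * q - \<rho>) / (n * (- (s * q * q - u) / q))"
    unfolding d0_def Let_def s1 u1 n_def using q_nz by (simp add: field_simps)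
  \<comment> \<open>Each difference becomes an independent letter: a = 1 - n, b = 1 - n q, e = s -
    u, f = s q - u, g = s q q - u, and so on. What remains is cancellation.\<close>
  moreover have "a*A/(n*e)*(B*C/(a*f))*(b*D/(n*q*(-f)))*(E*(q*F)/(b*g)) = E*F/(a*f)*(B*(q*C)/(b*(q*e)))*(b*A/(n*q*f))*(a*D/(n*(-g/q)))"
    if "a \<noteq> 0" "b \<noteq> 0" "e \<noteq> 0" "f \<noteq> 0" "g \<noteq> 0" for a b e f g A B C D E F :: complex
    using that q_nz nz by (simp add: field_simps)
  ultimately show ?thesis using nz by presburger
qed

text \<open>The solution of detailed balance with value 1 at the origin: along y = 0 by
  \<open>d0\<close>, where \<open>b0\<close> is 1, then upwards in column x from column x + 1 by
  \<open>d1\<close> and \<open>b1\<close>.\<close>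

fun wt :: "nat \<Rightarrow> nat \<Rightarrow> complex" where
  "wt x 0 = (\<Prod>m<x. 1 / d0 m 0)"
| "wt x (Suc y) = wt (Suc x) y * d1 x y / b1 x (Suc y)"

lemma wt_nz: "x + y \<le> N \<Longrightarrow> wt x y \<noteq> 0"
  by (induction y arbitrary: x) (auto simp: d0_nz d1_nz b1_nz)

lemma wt_b1: "x + y < N \<Longrightarrow> wt x (Suc y) * b1 x (Suc y) = wt (Suc x) y * d1 x y"
  using b1_nz[of "Suc y" x] by simp

lemma wt_b0: "x + y < N \<Longrightarrow> wt x y * b0 x y = wt (Suc x) y * d0 x y"
proof (induction y arbitrary: x)
  case 0
  then show ?case using d0_nz[of x 0] by (simp add: b_boundary)
next
  case (Suc y)
  have IH: "wt (Suc x) y * b0 (Suc x) y = wt (Suc (Suc x)) y * d0 (Suc x) y"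
    using Suc by auto
  have nz: "b1 x (Suc y) \<noteq> 0" "b1 (Suc x) (Suc y) \<noteq> 0" "b0 (Suc x) y \<noteq> 0" "d0 (Suc x) y \<noteq> 0"
    using Suc.prems b1_nz b0_nz d0_nz by auto
  have sq: "d1 x y * b0 x (Suc y) * d0 (Suc x) y * b1 (Suc x) (Suc y)
    = b1 x (Suc y) * b0 (Suc x) y * d1 (Suc x) y * d0 x (Suc y)"
    using square_relation[of x y] Suc.prems by simp
  have w: "wt (Suc (Suc x)) y = wt (Suc x) y * b0 (Suc x) y / d0 (Suc x) y"
    using IH nz by (simp add: field_simps)
  have "wt x (Suc y) * b0 x (Suc y) = wt (Suc x) y * (d1 x y * b0 x (Suc y)) / b1 x (Suc y)" by simp
  also have "\<dots> = wt (Suc x) y * (b0 (Suc x) y * d1 (Suc x) y * d0 x (Suc y)) / (d0 (Suc x) y * b1 (Suc x) (Suc y))"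
  proof -
    have "d1 x y * b0 x (Suc y) / b1 x (Suc y)
      = b0 (Suc x) y * d1 (Suc x) y * d0 x (Suc y) / (d0 (Suc x) y * b1 (Suc x) (Suc y))"
      using sq nz by (simp add: frac_eq_eq mult_ac)
    then show ?thesis by (simp only: times_divide_eq_right[symmetric])
  qed
  also have "\<dots> = wt (Suc x) (Suc y) * d0 x (Suc y)" by (simp add: w)
  finally show ?case .
qed

end

section \<open>Raising and lowering operators\<close>

context q_hahn begin

text \<open>
  \<open>raise_k\<close>, \<open>lower_k\<close> and \<open>turn_k\<close> are the kernels of \<open>B\<close>, \<open>D\<close> and \<open>B D\<close>; \<open>column_k\<close> and, below,
  \<open>hex_k\<close> are those of \<open>Y\<^sup>\<star>\<close> and \<open>X\<^sup>\<star>\<close>.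
\<close>

definition raise_k :: "nat \<times> nat \<Rightarrow> nat \<times> nat \<Rightarrow> complex" where
  "raise_k m c = (if fst c = Suc (fst m)
     then if snd c = snd m then b0 (fst m) (snd m)
       else if snd m = Suc (snd c) then b1 (fst m) (snd m) else 0
     else 0)"

definition lower_k :: "nat \<times> nat \<Rightarrow> nat \<times> nat \<Rightarrow> complex" where
  "lower_k c m = (if fst c = Suc (fst m)
     then if snd c = snd m then d0 (fst m) (snd c)
       else if snd m = Suc (snd c) then d1 (fst m) (snd c) else 0
     else 0)"

definition turn_k :: "nat \<times> nat \<Rightarrow> nat \<times> nat \<Rightarrow> complex" where
  "turn_k l m = (\<Sum>c\<in>triangle N. raise_k l c * lower_k c m)"

definition column_k :: "nat \<times> nat \<Rightarrow> nat \<times> nat \<Rightarrow> complex" where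
  "column_k l m = q ^ fst l / q ^ N * (of_bool (l = m) - turn_k l m) - of_bool (l = m)"

lemma wt_raise_lower:
  assumes "l \<in> triangle N" "m \<in> triangle N"
  shows "wt (fst l) (snd l) * raise_k l m = wt (fst m) (snd m) * lower_k m l"
proof -
  obtain x y x' y' where lm: "l = (x, y)" "m = (x', y')" by (cases l, cases m)
  have "wt x y * raise_k (x, y) (Suc x, y') = wt (Suc x) y' * lower_k (Suc x, y') (x, y)"
    if "x + y \<le> N" "Suc x + y' \<le> N" for y'
  proof -
    consider "y' = y" | "y = Suc y'" | "y' \<noteq> y" "y \<noteq> Suc y'" by blast
    then show ?thesis
    proof cases
      case 1
      then show ?thesis using wt_b0[of x y] that by (simp add: raise_k_def lower_k_def)
    next
      case 2
      then show ?thesis using wt_b1[of x y'] that by (simp add: raise_k_def lower_k_def del: wt.simps)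
    qed (simp add: raise_k_def lower_k_def)
  qed
  then show ?thesis using assms by (cases "x' = Suc x") (auto simp: lm triangle_def, auto simp: raise_k_def lower_k_def)
qed

lemma wt_turn:
  assumes "l \<in> triangle N" "m \<in> triangle N"
  shows "wt (fst l) (snd l) * turn_k l m = wt (fst m) (snd m) * turn_k m l"
proof -
  have "wt (fst l) (snd l) * turn_k l m = (\<Sum>c\<in>triangle N. wt (fst l) (snd l) * raise_k l c * lower_k c m)"
    by (simp add: turn_k_def sum_distrib_left mult.assoc)
  also have "\<dots> = (\<Sum>c\<in>triangle N. wt (fst m) (snd m) * raise_k m c * lower_k c l)"
    using wt_raise_lower assms by (intro sum.cong) (auto simp: mult_ac)
  also have "\<dots> = wt (fst m) (snd m) * turn_k m l"
    by (simp add: turn_k_def sum_distrib_left mult.assoc)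
  finally show ?thesis .
qed

lemma turn_k_nzD:
  assumes "turn_k l m \<noteq> 0"
  shows "fst l = fst m" "snd l = snd m \<or> snd l = Suc (snd m) \<or> snd m = Suc (snd l)"
proof -
  obtain c where "raise_k l c * lower_k c m \<noteq> 0"
    using assms unfolding turn_k_def by (meson sum.neutral)
  then show "fst l = fst m" "snd l = snd m \<or> snd l = Suc (snd m) \<or> snd m = Suc (snd l)"
    by (auto simp: raise_k_def lower_k_def split: if_splits)
qed

lemma column_k_nzD:
  assumes "column_k l m \<noteq> 0"
  shows "fst l = fst m" "snd l = snd m \<or> snd l = Suc (snd m) \<or> snd m = Suc (snd l)"
proof -
  have "l = m \<or> turn_k l m \<noteq> 0"
    using assms by (rule contrapos_np) (simp add: column_k_def)
  then show "fst l = fst m" "snd l = snd m \<or> snd l = Suc (snd m) \<or> snd m = Suc (snd l)"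
    using turn_k_nzD[of l m] by auto
qed

text \<open>\<open>(Suc x, y)\<close> is the only intermediate point between \<open>(x, y)\<close>
  and \<open>(x, Suc y)\<close>, so the entry is a single product of nonvanishing
  coefficients.\<close>

lemma column_k_offdiag:
  assumes "x + y < N"
  shows "column_k (x, y) (x, Suc y) \<noteq> 0" "column_k (x, Suc y) (x, y) \<noteq> 0"
proof -
  have 1: "turn_k (x, y) (x, Suc y) = (\<Sum>c\<in>triangle N. if c = (Suc x, y) then b0 x y * d1 x y else 0)"
    unfolding turn_k_def by (intro sum.cong) (auto simp: raise_k_def lower_k_def)
  have 2: "turn_k (x, Suc y) (x, y) = (\<Sum>c\<in>triangle N. if c = (Suc x, y) then b1 x (Suc y) * d0 x y else 0)"
    unfolding turn_k_def by (intro sum.cong) (auto simp: raise_k_def lower_k_def)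
  have "(Suc x, y) \<in> triangle N" using assms by (simp add: triangle_def)
  then have "turn_k (x, y) (x, Suc y) \<noteq> 0" "turn_k (x, Suc y) (x, y) \<noteq> 0"
    using assms b0_nz[of x y] b1_nz[of "Suc y" x] d0_nz[of x y] d1_nz[of x y] unfolding 1 2 by auto
  then show "column_k (x, y) (x, Suc y) \<noteq> 0" "column_k (x, Suc y) (x, y) \<noteq> 0"
    using q_nz by (auto simp: column_k_def)
qed

text \<open>The shape g(x) R_j(y; x) with j fixed, which B and D preserve; it reduces operators in
  two variables to operators on \<open>g\<close>.\<close>

definition profile :: "(nat \<Rightarrow> complex) \<Rightarrow> nat \<Rightarrow> nat \<times> nat \<Rightarrow> complex" where
  "profile g j m = (if m \<in> triangle N then g (fst m) * dual_hahn j (snd m) (fst m) else 0)"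

text \<open>The hypothesis on \<open>g\<close> covers what \<open>dual_hahn_raise\<close> does not:
  for x + j >= N the factor \<open>g (Suc x)\<close> is 0.\<close>

lemma raise_profile:
  assumes g: "\<And>x. N < x + j \<Longrightarrow> g x = 0" and xy: "(x, y) \<in> triangle N"
  shows "(\<Sum>c\<in>triangle N. raise_k (x, y) c * profile g j c) = g (Suc x) * dual_hahn j y x"
proof (cases "x < N")
  case False
  then have "raise_k (x, y) c * profile g j c = 0" for c
    by (auto simp: raise_k_def profile_def triangle_def)
  then have "(\<Sum>c\<in>triangle N. raise_k (x, y) c * profile g j c) = 0"
    by (intro sum.neutral) blast
  then show ?thesis using False g[of "Suc x"] by simp
next
  case True
  have "(\<Sum>c\<in>triangle N. raise_k (x, y) c * profile g j c)
    = (\<Sum>c\<in>triangle N. (if c = (Suc x, y) then b0 x y * profile g j (Suc x, y) else 0)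
        + (if c = (Suc x, y - 1) then b1 x y * profile g j (Suc x, y - 1) else 0))"
    using True b_boundary(2)[of x] by (cases y) (intro sum.cong; auto simp: raise_k_def)+
  also have "\<dots> = (if (Suc x, y) \<in> triangle N then b0 x y * profile g j (Suc x, y) else 0)
      + (if (Suc x, y - 1) \<in> triangle N then b1 x y * profile g j (Suc x, y - 1) else 0)"
    by (simp only: sum.distrib sum.delta finite_triangle)
  also have "\<dots> = g (Suc x) * (b0 x y * dual_hahn j y (x + 1) + b1 x y * dual_hahn j (y - 1) (x + 1))"
  proof -
    have "(Suc x, y) \<in> triangle N \<or> x + y = N \<and> y \<noteq> 0" using xy True by (auto simp: triangle_def)
    then have "(Suc x, y) \<in> triangle N \<or> b0 x y = 0" using b_boundary(3)[of x y] by blast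
    moreover have "(Suc x, y - 1) \<in> triangle N" using xy True by (auto simp: triangle_def)
    ultimately show ?thesis by (auto simp: profile_def algebra_simps)
  qed
  also have "\<dots> = g (Suc x) * dual_hahn j y x"
    using g[of "Suc x"] dual_hahn_raise[of x j y] xy by (cases "x + j < N") (auto simp: triangle_def)
  finally show ?thesis .
qed

text \<open>The quotient of powers stands for q^(N-(x-1)-j) and, unlike subtraction on
  \<open>nat\<close>, stays correct for a negative exponent.\<close>

definition lowered :: "(nat \<Rightarrow> complex) \<Rightarrow> nat \<Rightarrow> nat \<Rightarrow> complex" where
  "lowered g j x = (if x = 0 then 0 else g (x - 1) * (1 - q ^ N / q ^ (x - 1) / q ^ j))"

lemma lower_profile:
  assumes "j \<le> N" and xy: "(x, y) \<in> triangle N"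
  shows "(\<Sum>c\<in>triangle N. lower_k (x, y) c * profile g j c) = lowered g j x * dual_hahn j y x"
proof (cases x)
  case 0
  then show ?thesis by (auto simp: lowered_def lower_k_def)
next
  case (Suc x')
  have "(\<Sum>c\<in>triangle N. lower_k (x, y) c * profile g j c)
    = (\<Sum>c\<in>triangle N. (if c = (x', y) then d0 x' y * profile g j (x', y) else 0)
        + (if c = (x', y + 1) then d1 x' y * profile g j (x', y + 1) else 0))"
    using Suc by (intro sum.cong) (auto simp: lower_k_def)
  also have "\<dots> = (if (x', y) \<in> triangle N then d0 x' y * profile g j (x', y) else 0)
      + (if (x', y + 1) \<in> triangle N then d1 x' y * profile g j (x', y + 1) else 0)"
    by (simp only: sum.distrib sum.delta finite_triangle)
  also have "\<dots> = g x' * (d0 x' y * dual_hahn j y x' + d1 x' y * dual_hahn j (y + 1) x')"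
    using xy Suc by (auto simp: profile_def triangle_def algebra_simps)
  also have "\<dots> = lowered g j x * dual_hahn j y x"
    using dual_hahn_lower[of x' y j] assms Suc by (simp add: lowered_def triangle_def)
  finally show ?thesis .
qed

lemma turn_profile:
  assumes g: "\<And>x. N < x + j \<Longrightarrow> g x = 0" and j: "j \<le> N" and xy: "(x, y) \<in> triangle N"
  shows "(\<Sum>m\<in>triangle N. turn_k (x, y) m * profile g j m)
    = g x * (1 - q ^ N / q ^ x / q ^ j) * dual_hahn j y x"
proof -
  \<comment> \<open>\<open>lowered g j\<close> again meets the hypothesis of
    \<open>raise_profile\<close>: at x + j = N + 1, where \<open>g (x - 1)\<close> may be nonzero,
    the factor is 1 - q^0.\<close>
  have g': "lowered g j x = 0" if "N < x + j" for x
  proof (cases "x + j = Suc N")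
    case True
    then have "q ^ N = q ^ (x - 1) * q ^ j \<or> x = 0" by (cases x) (auto simp flip: power_add)
    then show ?thesis using q_nz by (auto simp: lowered_def)
  next
    case False
    then show ?thesis using that g[of "x - 1"] by (auto simp: lowered_def)
  qed
  have "(\<Sum>m\<in>triangle N. turn_k (x, y) m * profile g j m)
    = (\<Sum>c\<in>triangle N. raise_k (x, y) c * (\<Sum>m\<in>triangle N. lower_k c m * profile g j m))"
    unfolding turn_k_def sum_distrib_left sum_distrib_right by (subst sum.swap) (simp add: mult.assoc)
  also have "\<dots> = (\<Sum>c\<in>triangle N. raise_k (x, y) c * profile (lowered g j) j c)"
    using lower_profile[OF j, of _ _ g] by (intro sum.cong) (auto simp: profile_def)
  also have "\<dots> = lowered g j (Suc x) * dual_hahn j y x"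
    using g' xy by (rule raise_profile)
  finally show ?thesis by (simp add: lowered_def)
qed

text \<open>The prefactor cancels the dependence on x: q^(x-N) (1 - (1 - q^(N-x-j))) = q^-j.\<close>

lemma column_profile:
  assumes g: "\<And>x. N < x + j \<Longrightarrow> g x = 0" and j: "j \<le> N" and m: "m \<in> triangle N"
  shows "(\<Sum>c\<in>triangle N. column_k m c * profile g j c) = (1 / q ^ j - 1) * profile g j m"
proof -
  obtain x y where xy: "m = (x, y)" by (cases m)
  have "(\<Sum>c\<in>triangle N. column_k m c * profile g j c)
    = (\<Sum>c\<in>triangle N. if c = m then (q ^ x / q ^ N - 1) * profile g j m else 0)
      - q ^ x / q ^ N * (\<Sum>c\<in>triangle N. turn_k (x, y) c * profile g j c)"
    unfolding column_k_def sum_distrib_left sum_subtractf[symmetric]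
    by (intro sum.cong) (auto simp: xy algebra_simps)
  also have "\<dots> = (q ^ x / q ^ N - 1) * profile g j m
      - q ^ x / q ^ N * (g x * (1 - q ^ N / q ^ x / q ^ j) * dual_hahn j y x)"
  proof -
    have "(\<Sum>c\<in>triangle N. turn_k (x, y) c * profile g j c) = g x * (1 - q ^ N / q ^ x / q ^ j) * dual_hahn j y x"
      by (rule turn_profile[OF g j m[unfolded xy]])
    then show ?thesis using m by (simp add: xy)
  qed
  also have "\<dots> = (1 / q ^ j - 1) * profile g j m"
    using m q_nz by (simp add: profile_def xy field_simps)
  finally show ?thesis .
qed

end

lemma (in q_hahn) q_pow_inj: "inj_on ((^) q) {0..N}"
proof (rule linorder_inj_onI)
  fix a b assume ab: "a < b" "a \<in> {0..N}" "b \<in> {0..N}"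
  then have "q ^ b = q ^ a * q ^ (b - a)" by (simp flip: power_add)
  moreover have "q ^ (b - a) \<noteq> 1" using q_pow[of "b - a"] ab by auto
  ultimately show "q ^ a \<noteq> q ^ b" using q_nz by auto
qed auto

section \<open>Two coupled q-Hahn systems and their joint eigenfunctions\<close>

locale q_hahn_pair = L: q_hahn N q ss r + R: q_hahn N q \<sigma> \<rho>
  for N :: nat and q ss r \<sigma> \<rho> :: complex +
  fixes ms \<mu> :: complex
  assumes N1: "1 \<le> N" and ms_nz: "ms \<noteq> 0" and mu_nz: "\<mu> \<noteq> 0"
begin

lemma swap_pair: "q_hahn_pair N q \<sigma> \<rho> ss r \<mu> ms"
  by (intro q_hahn_pair.intro q_hahn_pair_axioms.intro R.q_hahn_axioms L.q_hahn_axioms N1 ms_nz mu_nz)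

text \<open>\<open>up\<close> and \<open>dn\<close> are the coefficients of the q-Hahn difference
  equation of length N - j, multiplied by q^(N-j) and, for \<open>up\<close>, divided by 1 -
  q^(N-x-j). With the factor q^(N-j), which is also the one in \<open>tstar\<close>, both become
  free of j, so that \<open>hex_k\<close> is one operator for all j.\<close>

definition up :: "nat \<Rightarrow> complex" where
  "up x = - (q ^ x) * (1 - r * q ^ (x + 1))"

definition dn :: "nat \<Rightarrow> complex" where
  "dn x = q * (1 - q ^ x) * (ss * q ^ N - r * q ^ x / q)"

definition hex_k :: "nat \<times> nat \<Rightarrow> nat \<times> nat \<Rightarrow> complex" where
  "hex_k l m = ms * (up (fst l) * (R.raise_k l m - R.turn_k l m)
     + dn (fst l) * (R.lower_k l m - of_bool (l = m)))"

text \<open>\<open>R.wt\<close> makes B and D adjoint; the extra factor, constant on columns, does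
  the same for \<open>up\<close> times B and \<open>dn\<close> times D, and leaves the symmetry of B
  D within a column intact.\<close>

definition weight :: "nat \<times> nat \<Rightarrow> complex" where
  "weight m = (\<Prod>k<fst m. up k / dn (Suc k)) * R.wt (fst m) (snd m)"

text \<open>The value 0 for x + j > N is the usual convention for 1/(q; q)_n at negative n; it has
  to be stated because subtraction truncates.\<close>

definition S :: "nat \<times> nat \<Rightarrow> nat \<times> nat \<Rightarrow> complex" where
  "S l m = (if l \<in> triangle N \<and> m \<in> triangle N \<and> fst m + snd l \<le> N
     then L.dual_hahn (fst m) (fst l) (snd l) * R.dual_hahn (snd l) (snd m) (fst m) /
       qpoch q q (N - fst m - snd l) else 0)"

definition tstar :: "nat \<times> nat \<Rightarrow> complex" where
  "tstar l = ms * (q ^ N / q ^ snd l) * (1 / q ^ fst l - 1) * (1 - ss * q ^ (snd l + fst l + 1))"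

lemma up_nz: "x < N \<Longrightarrow> up x \<noteq> 0"
  using L.q_nz L.rho_pow[of "x + 1"] by (auto simp: up_def)

lemma dn_nz: assumes "x < N" shows "dn (Suc x) \<noteq> 0"
proof -
  have "ss * q ^ N = r * q ^ x \<longleftrightarrow> ss * q ^ (N - x) = r"
    using assms L.q_nz power_add[of q x "N - x"] by auto
  moreover have "r \<noteq> ss * q ^ (N - x)" using L.rho_sigma[of "N - x"] assms by simp
  ultimately have "ss * q ^ N \<noteq> r * q ^ x" by auto
  then show ?thesis
    using L.q_nz L.q_pow[of "Suc x"] assms by (auto simp: dn_def)
qed

lemma weight_nz: "m \<in> triangle N \<Longrightarrow> weight m \<noteq> 0"
  using up_nz dn_nz R.wt_nz by (auto simp: weight_def triangle_def prod_zero_iff)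

lemma weight_column: 
  assumes "l \<in> triangle N" "m \<in> triangle N"
  shows "weight l * R.turn_k l m = weight m * R.turn_k m l"
proof (cases "fst l = fst m")
  case True
  then show ?thesis using R.wt_turn[OF assms] by (simp add: weight_def)
next
  case False
  then have "R.turn_k l m = 0" "R.turn_k m l = 0" using R.turn_k_nzD(1)[of l m] R.turn_k_nzD(1)[of m l] by auto
  then show ?thesis by simp
qed

lemma column_symmetric:
  assumes "l \<in> triangle N" "m \<in> triangle N"
  shows "weight l * R.column_k l m = weight m * R.column_k m l"
proof (cases "fst l = fst m")
  case True
  then show ?thesis using weight_column[OF assms] by (auto simp: R.column_k_def algebra_simps)
next
  case False
  then have "R.column_k l m = 0" "R.column_k m l = 0"
    using R.column_k_nzD(1)[of l m] R.column_k_nzD(1)[of m l] by auto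
  then show ?thesis by simp
qed

lemma raise_lower_symmetric:
  assumes "l \<in> triangle N" "m \<in> triangle N"
  shows "weight l * (up (fst l) * R.raise_k l m) = weight m * (dn (fst m) * R.lower_k m l)"
proof (cases "fst m = Suc (fst l)")
  case True
  then have "dn (fst m) \<noteq> 0" using dn_nz[of "fst l"] assms by (auto simp: triangle_def)
  then show ?thesis using R.wt_raise_lower[OF assms] True by (simp add: weight_def field_simps)
next
  case False
  then show ?thesis by (simp add: R.raise_k_def R.lower_k_def)
qed

text \<open>Transposition exchanges the terms with B and D by \<open>raise_lower_symmetric\<close>.
  The terms with B D and 1 stay in one column, where \<open>up\<close> and \<open>dn\<close> are
  constant, and are symmetric separately.\<close>

lemma hex_symmetric:
  assumes "l \<in> triangle N" "m \<in> triangle N"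
  shows "weight l * hex_k l m = weight m * hex_k m l"
proof -
  have 1: "weight l * (up (fst l) * R.turn_k l m) = weight m * (up (fst m) * R.turn_k m l)"
  proof (cases "fst l = fst m")
    case True
    then show ?thesis using weight_column[OF assms] by auto
  next
    case False
    then have "R.turn_k l m = 0" "R.turn_k m l = 0"
      using R.turn_k_nzD(1)[of l m] R.turn_k_nzD(1)[of m l] by auto
    then show ?thesis by simp
  qed
  have 2: "weight l * (dn (fst l) * of_bool (l = m)) = weight m * (dn (fst m) * of_bool (m = l))"
    by auto
  have "weight l * hex_k l m = ms * (weight l * (up (fst l) * R.raise_k l m) - weight l * (up (fst l) * R.turn_k l m)
     + weight l * (dn (fst l) * R.lower_k l m) - weight l * (dn (fst l) * of_bool (l = m)))"
    by (simp add: hex_k_def algebra_simps)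
  also have "\<dots> = ms * (weight m * (dn (fst m) * R.lower_k m l) - weight m * (up (fst m) * R.turn_k m l)
     + weight m * (up (fst m) * R.raise_k m l) - weight m * (dn (fst m) * of_bool (m = l)))"
    unfolding raise_lower_symmetric[OF assms] raise_lower_symmetric[OF assms(2,1)] 1 2 by (rule refl)
  also have "\<dots> = weight m * hex_k m l"
    by (simp add: hex_k_def algebra_simps)
  finally show ?thesis .
qed

lemma column_adjacent: "R.column_k l m \<noteq> 0 \<Longrightarrow> adjacent l m"
  using R.column_k_nzD[of l m] by (auto simp: adjacent_def A2_def)

lemma hex_adjacent:
  assumes "hex_k l m \<noteq> 0"
  shows "adjacent l m"
proof -
  have "R.raise_k l m \<noteq> 0 \<or> R.turn_k l m \<noteq> 0 \<or> R.lower_k l m \<noteq> 0 \<or> l = m"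
    using assms by (auto simp: hex_k_def)
  then show ?thesis
    using R.turn_k_nzD[of l m]
    by (auto simp: adjacent_def A2_def R.raise_k_def R.lower_k_def split: if_splits)
qed

definition radial :: "nat \<Rightarrow> nat \<Rightarrow> nat \<Rightarrow> complex" where
  "radial i j x = (if x + j \<le> N then L.dual_hahn x i j / qpoch q q (N - x - j) else 0)"

lemma S_profile:
  assumes "(i, j) \<in> triangle N"
  shows "S (i, j) = R.profile (radial i j) j"
  using assms by (auto simp: S_def R.profile_def radial_def fun_eq_iff)

lemma column_S:
  assumes "l \<in> triangle N" "m \<in> triangle N"
  shows "(\<Sum>c\<in>triangle N. R.column_k m c * S l c) = (1 / q ^ snd l - 1) * S l m"
proof -
  obtain i j where l: "l = (i, j)" by (cases l)
  have "j \<le> N" using assms(1) by (auto simp: l triangle_def)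
  then show ?thesis using R.column_profile[of j "radial i j" m] S_profile[of i j] assms
    by (simp add: l radial_def)
qed

text \<open>Write g = h/(q; q)_(N-x-j) with h the series \<open>L.dual_hahn x i j\<close>. The
  factors 1 - q^(N-x-j) then combine so that the right side is q^(N-j) times the difference equation
  for h. Beyond x + j = N both sides are 0.\<close>

lemma radial_relation:
  assumes "i + j \<le> N" "x \<le> N"
  shows "tstar (i, j) * radial i j x
    = ms * (up x * (radial i j (Suc x) - radial i j x * (1 - q ^ N / q ^ x / q ^ j))
        + dn x * (R.lowered (radial i j) j x - radial i j x))"
proof -
  have q0: "q \<noteq> 0" by (rule L.q_nz)
  consider "x + j \<le> N" | "x + j = Suc N" | "x + j > Suc N" by linarith
  then show ?thesis
  proof cases
    case 1
    define C where "C = qpoch q q (N - x - j)"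
    have C: "C \<noteq> 0" using L.q_qpoch_nz by (simp add: C_def)
    define J where "J = 1 - q ^ N / q ^ x / q ^ j"
    have quot: "q ^ N / q ^ x' / q ^ j = q ^ (N - x' - j)" if "x' + j \<le> N" for x'
    proof -
      have "q ^ N = q ^ (N - x' - j) * q ^ x' * q ^ j" using that by (simp flip: power_add)
      then show ?thesis using q0 by simp
    qed
    have J: "J = 1 - q ^ (N - x - j)" using quot[OF 1] by (simp add: J_def)
    have r1: "radial i j (Suc x) = J * L.dual_hahn (x + 1) i j / C"
    proof (cases "x + j = N")
      case True
      then show ?thesis by (simp add: radial_def J)
    next
      case False
      then have e: "N - x - j = Suc (N - Suc x - j)" using 1 by simp
      have "C = qpoch q q (N - Suc x - j) * J"
        by (simp only: C_def J e qpoch_Suc power_Suc)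
      then show ?thesis using False 1 C by (simp add: radial_def)
    qed
    \<comment> \<open>Multiplied by \<open>dn x\<close>, the formula also holds at x = 0, where
      \<open>x - 1\<close> truncates and \<open>dn\<close> vanishes.\<close>
    have r2: "dn x * R.lowered (radial i j) j x = dn x * (L.dual_hahn (x - 1) i j / C)"
    proof (cases x)
      case 0
      then show ?thesis by (simp add: dn_def)
    next
      case (Suc x')
      have J': "1 - q ^ N / q ^ x' / q ^ j = 1 - q ^ (N - x' - j)" using quot[of x'] 1 Suc by simp
      have "N - x' - j = Suc (N - x - j)" using Suc 1 by simp
      then have "qpoch q q (N - x' - j) = C * (1 - q ^ (N - x' - j))" by (simp add: C_def qpoch_Suc)
      moreover have "qpoch q q (N - x' - j) \<noteq> 0" using L.q_qpoch_nz by simp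
      ultimately have "radial i j x' * (1 - q ^ N / q ^ x' / q ^ j) = L.dual_hahn x' i j / C"
        unfolding J' using Suc 1 by (simp add: radial_def)
      then show ?thesis by (simp add: Suc R.lowered_def)
    qed
    have r0: "radial i j x = L.dual_hahn x i j / C" using 1 by (simp add: radial_def C_def)
    have uJ: "up x * J = q ^ N / q ^ j * ((1 - q ^ (j + x) / q ^ N) * (1 - r * q ^ (x + 1)))"
    proof -
      have "- (q ^ x) * J = q ^ N / q ^ j * (1 - q ^ (j + x) / q ^ N)"
        using q0 by (simp add: J_def field_simps power_add)
      moreover have "up x * J = (- (q ^ x) * J) * (1 - r * q ^ (x + 1))" by (simp add: up_def)
      ultimately show ?thesis by (simp only: mult.assoc)
    qed
    have dJ: "dn x = q ^ N / q ^ j * (q * (1 - q ^ x) * (ss * q ^ j - r * q ^ (j + x) / q ^ (N + 1)))"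
    proof -
      have "ss * q ^ N - r * q ^ x / q = q ^ N / q ^ j * (ss * q ^ j - r * q ^ (j + x) / q ^ (N + 1))"
        using q0 by (simp add: field_simps power_add)
      then show ?thesis unfolding dn_def by simp
    qed
    have "tstar (i, j) * radial i j x = ms / C * (q ^ N / q ^ j * ((1 / q ^ i - 1) * (1 - ss * q ^ (j + i + 1)) * L.dual_hahn x i j))"
      by (simp add: tstar_def r0 mult_ac)
    also have "\<dots> = ms / C * (up x * J * (L.dual_hahn (x + 1) i j - L.dual_hahn x i j)
        + dn x * (L.dual_hahn (x - 1) i j - L.dual_hahn x i j))"
    proof -
      have "(1 / q ^ i - 1) * (1 - ss * q ^ (j + i + 1)) * L.dual_hahn x i j
        = (1 - q ^ (j + x) / q ^ N) * (1 - r * q ^ (x + 1)) * (L.dual_hahn (x + 1) i j - L.dual_hahn x i j)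
          + q * (1 - q ^ x) * (ss * q ^ j - r * q ^ (j + x) / q ^ (N + 1)) * (L.dual_hahn (x - 1) i j - L.dual_hahn x i j)"
        by (rule L.dual_hahn_difference) (use assms 1 in auto)
      then show ?thesis unfolding uJ dJ by (simp only: distrib_left mult.assoc)
    qed
    also have "\<dots> = ms * (up x * (J * L.dual_hahn (x + 1) i j / C - L.dual_hahn x i j / C * J)
        + (dn x * (L.dual_hahn (x - 1) i j / C) - dn x * (L.dual_hahn x i j / C)))"
      using C by (simp add: field_simps)
    finally show ?thesis unfolding r1 r0 J_def[symmetric] right_diff_distrib[of "dn x"] r2 .
  next
    \<comment> \<open>One step beyond the boundary g(x-1) need not vanish, but its lowering factor
      does.\<close>
    case 2
    then have "R.lowered (radial i j) j x = 0"
    proof (cases x)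
      case (Suc x')
      then have "q ^ N = q ^ x' * q ^ j" using 2 by (simp flip: power_add)
      then show ?thesis using Suc q0 by (simp add: R.lowered_def)
    qed (simp add: R.lowered_def)
    then show ?thesis using 2 by (simp add: radial_def)
  next
    case 3
    then have "radial i j (x - 1) = 0" "radial i j x = 0" "radial i j (Suc x) = 0"
      by (auto simp: radial_def)
    then show ?thesis by (simp add: R.lowered_def)
  qed
qed

lemma hex_S:
  assumes "l \<in> triangle N" "m \<in> triangle N"
  shows "(\<Sum>c\<in>triangle N. hex_k m c * S l c) = tstar l * S l m"
proof -
  obtain i j x y where lm: "l = (i, j)" "m = (x, y)" by (cases l, cases m)
  have ij: "i + j \<le> N" "j \<le> N" and xy: "(x, y) \<in> triangle N" "x \<le> N"
    using assms by (auto simp: lm triangle_def)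
  let ?g = "radial i j" and ?D = "R.dual_hahn j y x"
  have g: "?g x = 0" if "N < x + j" for x using that by (simp add: radial_def)
  have "(\<Sum>c\<in>triangle N. hex_k m c * S l c)
    = ms * (up x * ((\<Sum>c\<in>triangle N. R.raise_k (x, y) c * R.profile ?g j c) - (\<Sum>c\<in>triangle N. R.turn_k (x, y) c * R.profile ?g j c))
        + dn x * ((\<Sum>c\<in>triangle N. R.lower_k (x, y) c * R.profile ?g j c) - (\<Sum>c\<in>triangle N. if c = (x, y) then R.profile ?g j (x, y) else 0)))"
    unfolding sum_distrib_left sum_subtractf[symmetric] sum.distrib[symmetric] lm S_profile[OF assms(1)[unfolded lm]]
    by (intro sum.cong) (auto simp: hex_k_def algebra_simps)
  also have "\<dots> = ms * (up x * (?g (Suc x) * ?D - ?g x * (1 - q ^ N / q ^ x / q ^ j) * ?D)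
      + dn x * (R.lowered ?g j x * ?D - ?g x * ?D))"
  proof -
    have 1: "(\<Sum>c\<in>triangle N. R.raise_k (x, y) c * R.profile ?g j c) = ?g (Suc x) * ?D"
      by (rule R.raise_profile[OF g xy(1)])
    have 2: "(\<Sum>c\<in>triangle N. R.turn_k (x, y) c * R.profile ?g j c) = ?g x * (1 - q ^ N / q ^ x / q ^ j) * ?D"
      by (rule R.turn_profile[OF g ij(2) xy(1)])
    have 3: "(\<Sum>c\<in>triangle N. if c = (x, y) then R.profile ?g j (x, y) else 0) = ?g x * ?D"
      using xy by (simp add: R.profile_def)
    show ?thesis unfolding 1 2 3 R.lower_profile[OF ij(2) xy(1)] ..
  qed
  also have "\<dots> = ms * (up x * (?g (Suc x) - ?g x * (1 - q ^ N / q ^ x / q ^ j))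
      + dn x * (R.lowered ?g j x - ?g x)) * ?D"
    by (simp add: algebra_simps)
  also have "\<dots> = tstar l * S l m"
    unfolding radial_relation[OF ij(1) xy(2), symmetric] lm S_profile[OF assms(1)[unfolded lm]]
    using xy by (simp add: R.profile_def)
  finally show ?thesis .
qed

text \<open>At the origin both series reduce to their first term, so the value is 1/(q;
  q)_(N-j).\<close>

lemma S_origin: "l \<in> triangle N \<Longrightarrow> S l (0, 0) \<noteq> 0"
  using L.q_qpoch_nz[of "N - snd l"] by (auto simp: S_def triangle_def)

lemma S_in_grid_space: "S l \<in> grid_space N"
  by (auto simp: grid_space_def S_def)

text \<open>The second eigenvalue determines j. For equal j the first ones differ by a nonzero
  multiple of (q^-i - q^-i') (1 - s q^(i+i'+j+1)), and \<open>i \<noteq> i'\<close> puts the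
  exponent between 2 and 2N, the range of \<open>sigma_pow\<close>.\<close>

lemma tstar_column_inj: "inj_on (\<lambda>l. (tstar l, 1 / q ^ snd l - 1)) (triangle N)"
proof (rule inj_onI)
  fix l m assume lm: "l \<in> triangle N" "m \<in> triangle N" "(tstar l, 1 / q ^ snd l - 1) = (tstar m, 1 / q ^ snd m - 1)"
  obtain i j i' j' where ij: "l = (i, j)" "m = (i', j')" by (cases l, cases m)
  have le: "i + j \<le> N" "i' + j' \<le> N" using lm by (auto simp: ij triangle_def)
  have "q ^ j = q ^ j'" using lm L.q_nz by (simp add: ij)
  then have jj: "j = j'" using le inj_onD[OF L.q_pow_inj, of j j'] by auto
  have "tstar l - tstar m = ms * (q ^ N / q ^ j) * ((1 / q ^ i - 1 / q ^ i') * (1 - ss * q ^ (i + i' + j + 1)))"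
    using L.q_nz by (simp add: tstar_def ij jj field_simps power_add)
  then have "(1 / q ^ i - 1 / q ^ i') * (1 - ss * q ^ (i + i' + j + 1)) = 0"
    using lm ms_nz L.q_nz by simp
  moreover have "1 - ss * q ^ (i + i' + j + 1) \<noteq> 0" if "i \<noteq> i'"
    using L.sigma_pow[of "i + i' + j + 1"] that le jj by auto
  ultimately have "i \<noteq> i' \<Longrightarrow> q ^ i = q ^ i'" using L.q_nz by auto
  then have "i = i'" using inj_onD[OF L.q_pow_inj, of i i'] le by auto
  then show "l = m" by (simp add: ij jj)
qed

end

section \<open>The factorized pair\<close>

text \<open>\<open>A2\<close> is closed under sending (a, b) to (-b, -a). This returns adjacency
  from the exchanged system, where the roles of source and target are reversed.\<close>

lemma adjacent_swap: "adjacent (prod.swap l) (prod.swap m) \<Longrightarrow> adjacent m l"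
proof -
  have A2: "(a, b) \<in> A2 \<Longrightarrow> (- b, - a) \<in> A2" for a b by (auto simp: A2_def)
  show "adjacent (prod.swap l) (prod.swap m) \<Longrightarrow> adjacent m l"
    unfolding adjacent_def using A2[of "int (snd l) - int (snd m)" "int (fst l) - int (fst m)"] by simp
qed

lemma swap_triangle: "prod.swap l \<in> triangle N \<longleftrightarrow> l \<in> triangle N"
  by (cases l) (auto simp: triangle_def)

lemma sum_triangle_swap: "(\<Sum>l\<in>triangle N. f (prod.swap l)) = (\<Sum>l\<in>triangle N. f l)"
  by (rule sum.reindex_bij_witness[of _ prod.swap prod.swap]) (auto simp: swap_triangle)

definition diag_k :: "(nat \<times> nat \<Rightarrow> complex) \<Rightarrow> nat \<times> nat \<Rightarrow> nat \<times> nat \<Rightarrow> complex" where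
  "diag_k t l m = (if l = m then t l else 0)"

lemma diag_op:
  assumes "f \<in> grid_space N"
  shows "kernel_op N (diag_k t) f = (\<lambda>l. t l * f l)"
proof (rule kernel_op_eqI)
  show "(\<lambda>l. t l * f l) \<in> grid_space N" using assms by (auto simp: grid_space_def)
  fix l assume l: "l \<in> triangle N"
  have "(\<Sum>c\<in>triangle N. diag_k t l c * f c) = (\<Sum>c\<in>triangle N. if c = l then t l * f l else 0)"
    by (intro sum.cong) (auto simp: diag_k_def)
  then show "(\<Sum>c\<in>triangle N. diag_k t l c * f c) = t l * f l" using l by simp
qed (rule assms)

context q_hahn_pair begin

definition teig :: "nat \<times> nat \<Rightarrow> complex" where
  "teig m = 1 / q ^ fst m - 1"

definition theig :: "nat \<times> nat \<Rightarrow> complex" where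
  "theig m = \<mu> * (q ^ N / q ^ fst m) * (1 / q ^ snd m - 1) * (1 - \<sigma> * q ^ (fst m + snd m + 1))"

definition tseig :: "nat \<times> nat \<Rightarrow> complex" where
  "tseig l = 1 / q ^ snd l - 1"

definition X where "X = kernel_op N (diag_k teig)"
definition Y where "Y = kernel_op N (diag_k theig)"
definition Xs where "Xs = kernel_op N hex_k"
definition Ys where "Ys = kernel_op N R.column_k"


lemma S_swap: "S l m = q_hahn_pair.S N q \<sigma> \<rho> ss r (prod.swap m) (prod.swap l)"
proof -
  interpret swp: q_hahn_pair N q \<sigma> \<rho> ss r \<mu> ms by (rule swap_pair)
  have n: "N - snd l - fst m = N - fst m - snd l" by simp
  have c: "prod.swap m \<in> triangle N \<and> prod.swap l \<in> triangle N \<and> snd l + fst m \<le> N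
    \<longleftrightarrow> l \<in> triangle N \<and> m \<in> triangle N \<and> fst m + snd l \<le> N"
    unfolding swap_triangle add.commute[of "snd l"] by blast
  show ?thesis
    unfolding S_def swp.S_def fst_swap snd_swap c n
    by (subst mult.commute) (rule refl)
qed

lemma theig_swap: "theig m = q_hahn_pair.tstar N q \<sigma> \<mu> (prod.swap m)"
proof -
  interpret swp: q_hahn_pair N q \<sigma> \<rho> ss r \<mu> ms by (rule swap_pair)
  show ?thesis by (simp add: theig_def swp.tstar_def add.commute)
qed

lemma theig_inj: "inj_on (\<lambda>m. (teig m, theig m)) (triangle N)"
proof (rule inj_onI)
  interpret swp: q_hahn_pair N q \<sigma> \<rho> ss r \<mu> ms by (rule swap_pair)
  fix l m assume lm: "l \<in> triangle N" "m \<in> triangle N" "(teig l, theig l) = (teig m, theig m)"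
  have "prod.swap l = prod.swap m"
    by (rule inj_onD[OF swp.tstar_column_inj]) (use lm in \<open>auto simp: swap_triangle theig_swap teig_def\<close>)
  then show "l = m" by (simp add: prod.swap_def prod_eq_iff)
qed

lemma inv_q_nz: "1 / q \<noteq> 1"
  using L.q_pow[of 1] N1 L.q_nz by simp

lemma tstar_1_0: "tstar (1, 0) \<noteq> 0"
  using inv_q_nz ms_nz L.q_nz L.sigma_pow[of 2] N1 by (auto simp: tstar_def power2_eq_square)

sublocale P: joint_eigenbasis N grid_delta X Y teig theig
proof
  have in1: "(1, 0) \<in> triangle N" "(0, 1) \<in> triangle N" using N1 by (auto simp: triangle_def)
  show "X (grid_delta l) = pointwise (*) (teig l) (grid_delta l)" if "l \<in> triangle N" for l
    unfolding X_def diag_op[OF grid_delta_in[OF that]] by (auto simp: fun_eq_iff grid_delta_def pointwise_times_apply)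
  show "Y (grid_delta l) = pointwise (*) (theig l) (grid_delta l)" if "l \<in> triangle N" for l
    unfolding Y_def diag_op[OF grid_delta_in[OF that]] by (auto simp: fun_eq_iff grid_delta_def pointwise_times_apply)
  show "\<exists>l\<in>triangle N. teig l \<noteq> 0 \<and> theig l = 0"
    using in1 inv_q_nz by (intro bexI[of _ "(1, 0)"]) (auto simp: teig_def theig_def)
  interpret swp: q_hahn_pair N q \<sigma> \<rho> ss r \<mu> ms by (rule swap_pair)
  have "theig (0, 1) \<noteq> 0" using swp.tstar_1_0 by (simp add: theig_swap)
  then show "\<exists>l\<in>triangle N. theig l \<noteq> 0" using in1 by blast
  show "grid_delta l \<noteq> 0" for l
  proof
    assume "grid_delta l = 0"
    then have "grid_delta l l = 0" by simp
    then show False by (simp add: grid_delta_def)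
  qed
qed (auto simp: X_def Y_def kernel_op_endos theig_inj)

sublocale Q: joint_eigenbasis N S Xs Ys tstar tseig
proof
  have in1: "(1, 0) \<in> triangle N" "(0, 1) \<in> triangle N" using N1 by (auto simp: triangle_def)
  have sc: "pointwise (*) c (S l) \<in> grid_space N" for c l
    by (rule grid.subspace_scale[OF subspace_grid_space S_in_grid_space])
  show "Xs (S l) = pointwise (*) (tstar l) (S l)" if "l \<in> triangle N" for l
    unfolding Xs_def by (rule kernel_op_eqI[OF S_in_grid_space sc]) (simp add: hex_S that pointwise_times_apply)
  show "Ys (S l) = pointwise (*) (tseig l) (S l)" if "l \<in> triangle N" for l
    unfolding Ys_def
    by (rule kernel_op_eqI[OF S_in_grid_space sc]) (simp add: column_S that pointwise_times_apply tseig_def)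
  show "\<exists>l\<in>triangle N. tstar l \<noteq> 0 \<and> tseig l = 0"
    using in1 tstar_1_0 by (intro bexI[of _ "(1, 0)"]) (auto simp: tseig_def)
  show "\<exists>l\<in>triangle N. tseig l \<noteq> 0"
    using in1 inv_q_nz by (intro bexI[of _ "(0, 1)"]) (auto simp: tseig_def)
  show "S l \<noteq> 0" if "l \<in> triangle N" for l using S_origin[OF that] by auto
  show "inj_on (\<lambda>l. (tstar l, tseig l)) (triangle N)" using tstar_column_inj by (simp add: tseig_def)
qed (auto simp: Xs_def Ys_def kernel_op_endos S_in_grid_space)

text \<open>Bispectrality: the eigenvalue equation \<open>column_S\<close> of the exchanged system,
  read with \<open>m\<close> as index and \<open>l\<close> as variable, expands multiplication by
  \<open>teig\<close> in the family \<open>S\<close>.\<close>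

lemma X_S:
  assumes "l \<in> triangle N"
  shows "X (S l) = (\<Sum>k\<in>triangle N. pointwise (*) (L.column_k (prod.swap l) (prod.swap k)) (S k))"
proof
  interpret swp: q_hahn_pair N q \<sigma> \<rho> ss r \<mu> ms by (rule swap_pair)
  fix m
  show "X (S l) m = (\<Sum>k\<in>triangle N. pointwise (*) (L.column_k (prod.swap l) (prod.swap k)) (S k)) m"
  proof (cases "m \<in> triangle N")
    case True
    have "(\<Sum>k\<in>triangle N. L.column_k (prod.swap l) (prod.swap k) * S k m)
      = (\<Sum>k\<in>triangle N. L.column_k (prod.swap l) (prod.swap k) * swp.S (prod.swap m) (prod.swap k))"
      by (simp only: S_swap[of _ m])
    also have "\<dots> = (\<Sum>k\<in>triangle N. L.column_k (prod.swap l) k * swp.S (prod.swap m) k)"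
      by (rule sum_triangle_swap)
    also have "\<dots> = teig m * S l m"
      using swp.column_S[of "prod.swap m" "prod.swap l"] assms True
      by (simp add: swap_triangle S_swap[of l m] teig_def)
    finally show ?thesis
      by (simp add: sum_fun_apply pointwise_times_apply X_def diag_op[OF S_in_grid_space])
  qed (simp add: sum_fun_apply pointwise_times_apply X_def diag_op[OF S_in_grid_space] S_def)
qed

text \<open>The same reading of \<open>hex_S\<close>.\<close>

lemma Y_S:
  assumes "l \<in> triangle N"
  shows "Y (S l) = (\<Sum>k\<in>triangle N. pointwise (*) (q_hahn_pair.hex_k N q \<sigma> \<rho> ss r \<mu> (prod.swap l) (prod.swap k)) (S k))"
proof
  interpret swp: q_hahn_pair N q \<sigma> \<rho> ss r \<mu> ms by (rule swap_pair)
  fix m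
  show "Y (S l) m = (\<Sum>k\<in>triangle N. pointwise (*) (q_hahn_pair.hex_k N q \<sigma> \<rho> ss r \<mu> (prod.swap l) (prod.swap k)) (S k)) m"
  proof (cases "m \<in> triangle N")
    case True
    have "(\<Sum>k\<in>triangle N. swp.hex_k (prod.swap l) (prod.swap k) * S k m)
      = (\<Sum>k\<in>triangle N. swp.hex_k (prod.swap l) (prod.swap k) * swp.S (prod.swap m) (prod.swap k))"
      by (simp only: S_swap[of _ m])
    also have "\<dots> = (\<Sum>k\<in>triangle N. swp.hex_k (prod.swap l) k * swp.S (prod.swap m) k)"
      by (rule sum_triangle_swap)
    also have "\<dots> = theig m * S l m"
      using swp.hex_S[of "prod.swap m" "prod.swap l"] assms True
      by (simp add: swap_triangle S_swap[of l m] theig_swap)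
    finally show ?thesis
      by (simp add: sum_fun_apply pointwise_times_apply Y_def diag_op[OF S_in_grid_space])
  qed (simp add: sum_fun_apply pointwise_times_apply Y_def diag_op[OF S_in_grid_space] S_def)
qed

lemma form_nondeg: "grid.nondeg_symmetric_form (grid_space N) (grid_form N weight)"
  by (rule grid_form_nondeg) (rule weight_nz)

lemma delta_orthogonal: "m \<in> triangle N \<Longrightarrow> l \<noteq> m \<Longrightarrow> grid_form N weight (grid_delta l) (grid_delta m) = 0"
  by (simp add: grid_form_delta) (simp add: grid_delta_def)

lemma S_orthogonal:
  assumes "l \<in> triangle N" "m \<in> triangle N" "l \<noteq> m"
  shows "grid_form N weight (S l) (S m) = 0"
  by (rule Q.orthogonal[unfolded Xs_def Ys_def])
    (use assms grid_form_selfadjoint[of N weight] hex_symmetric column_symmetric in auto)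

lemma S_norm: "l \<in> triangle N \<Longrightarrow> grid_form N weight (S l) (S l) \<noteq> 0"
  by (rule Q.norm_nz[OF form_nondeg]) (auto intro!: S_orthogonal)

lemma delta_norm: "l \<in> triangle N \<Longrightarrow> grid_form N weight (grid_delta l) (grid_delta l) \<noteq> 0"
  by (rule P.norm_nz[OF form_nondeg]) (auto intro!: delta_orthogonal)

text \<open>A nonzero vector of \<open>W\<close> yields some \<open>S l\<close>, its value at the
  origin yields \<open>grid_delta (0, 0)\<close>, and this yields every \<open>S k\<close>: the
  coefficient of \<open>S k\<close> in \<open>grid_delta (0, 0)\<close> is
  \<open>weight (0, 0) * S k (0, 0)\<close> divided by the norm of \<open>S k\<close>.\<close>

lemma irreducible:
  assumes W: "grid.subspace W" "W \<subseteq> grid_space N" "W \<noteq> {0}"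
    and H: "\<forall>h\<in>P.plane. \<forall>v\<in>W. h v \<in> W" and Hs: "\<forall>h\<in>Q.plane. \<forall>v\<in>W. h v \<in> W"
  shows "W = grid_space N"
proof -
  have o: "(0, 0) \<in> triangle N" by (simp add: triangle_def)
  obtain v where v: "v \<in> W" "v \<noteq> 0" using W grid.subspace_0[OF W(1)] by blast
  have "v \<in> grid_space N" using v W by blast
  then obtain c where c: "v = (\<Sum>m\<in>triangle N. pointwise (*) (c m) (S m))" by (rule Q.expand)
  have "\<exists>l\<in>triangle N. c l \<noteq> 0"
  proof (rule ccontr)
    assume "\<not> ?thesis"
    then have "v = 0" unfolding c by (simp add: sum.neutral)
    with v show False by simp
  qed
  then obtain l where l: "l \<in> triangle N" "c l \<noteq> 0" by blast
  have "S l \<in> W" using Q.invariant_contains[of W c l, OF W(1) Hs v(1)[unfolded c] l] .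
  then have "(\<Sum>m\<in>triangle N. pointwise (*) (S l m) (grid_delta m)) \<in> W"
    using grid_space_expand[OF S_in_grid_space[of l]] by simp
  from P.invariant_contains[of W "S l" "(0, 0)", OF W(1) H this o S_origin[OF l(1)]]
  have d: "grid_delta (0, 0) \<in> W" .
  obtain c' where c': "grid_delta (0, 0) = (\<Sum>m\<in>triangle N. pointwise (*) (c' m) (S m))"
    using grid_delta_in[OF o] by (rule Q.expand)
  have S_W: "S k \<in> W" if k: "k \<in> triangle N" for k
  proof -
    have "grid_form N weight (S k) (grid_delta (0, 0)) = (\<Sum>m\<in>triangle N. c' m * grid_form N weight (S k) (S m))"
      unfolding c' grid_form_sum grid_form_simps(4) ..
    also have "\<dots> = (\<Sum>m\<in>triangle N. if m = k then c' k * grid_form N weight (S k) (S k) else 0)"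
      using S_orthogonal[OF k] by (intro sum.cong) auto
    also have "\<dots> = c' k * grid_form N weight (S k) (S k)" using k by simp
    finally have "c' k \<noteq> 0"
      using weight_nz[OF o] S_origin[OF k] by (auto simp: grid_form_delta[OF o])
    then show ?thesis by (rule Q.invariant_contains[of W c' k, OF W(1) Hs d[unfolded c'] k])
  qed
  have "grid.span (S ` triangle N) \<subseteq> W"
    by (rule grid.span_minimal) (use S_W W in auto)
  then show ?thesis using W(2) Q.e_span by blast
qed

text \<open>On a column \<open>Ys\<close> is tridiagonal with nonzero entries next to the diagonal,
  so the values of an eigenvector there are determined by the one at y = 0.\<close>

lemma column_recurrence:
  assumes f: "f \<in> grid_space N" "f (x, 0) = 0" and eig: "Ys f = pointwise (*) c f" and xy: "x + y \<le> N"
  shows "f (x, y) = 0"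
  using xy
proof (induction y rule: less_induct)
  case (less y)
  show ?case
  proof (cases y)
    case 0
    then show ?thesis using f by simp
  next
    case (Suc z)
    have z: "(x, z) \<in> triangle N" "(x, y) \<in> triangle N" "x + z < N" using less.prems Suc by (auto simp: triangle_def)
    have "(\<Sum>k\<in>triangle N. R.column_k (x, z) k * f k) = c * f (x, z)"
      using fun_cong[OF eig, of "(x, z)"] kernel_op_apply[OF f(1) z(1), of R.column_k]
      by (simp add: Ys_def pointwise_times_apply)
    also have "f (x, z) = 0" using less.IH[of z] less.prems Suc by simp
    also have "(\<Sum>k\<in>triangle N. R.column_k (x, z) k * f k)
      = (\<Sum>k\<in>triangle N. if k = (x, y) then R.column_k (x, z) (x, y) * f (x, y) else 0)"
    proof (rule sum.cong[OF refl])
      fix k assume k: "k \<in> triangle N"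
      show "R.column_k (x, z) k * f k = (if k = (x, y) then R.column_k (x, z) (x, y) * f (x, y) else 0)"
      proof (cases "k = (x, y) \<or> R.column_k (x, z) k = 0")
        case False
        then obtain y' where y': "k = (x, y')" "y' \<le> z"
          using R.column_k_nzD[of "(x, z)" k] Suc by (cases k) auto
        then have "f k = 0" using less.IH[of y'] less.prems Suc by simp
        then show ?thesis using False by simp
      qed auto
    qed
    also have "\<dots> = R.column_k (x, z) (x, y) * f (x, y)" using z by simp
    finally show ?thesis using R.column_k_offdiag(1)[OF z(3)] Suc by simp
  qed
qed

lemma X_apply: "f \<in> grid_space N \<Longrightarrow> X f = (\<lambda>l. teig l * f l)"
  unfolding X_def by (rule diag_op)

text \<open>The eigenvalue of \<open>X\<close> confines \<open>W\<close> to one column, the t_x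
  being distinct, and there \<open>column_recurrence\<close> leaves one degree of freedom.\<close>

lemma X_Ys_simple:
  assumes "W \<in> grid.common_eigenspaces (grid_space N) {X, Ys}"
  shows "grid.dim W = 1"
proof -
  obtain w where W: "W \<noteq> {0}" "W = {v \<in> grid_space N. X v = pointwise (*) (w X) v \<and> Ys v = pointwise (*) (w Ys) v}"
    using assms unfolding grid.common_eigenspaces_def by auto
  have "0 \<in> W" unfolding W(2) using grid.subspace_0[OF subspace_grid_space, of N] P.F_0 Q.G_0
    by (simp only: mem_Collect_eq grid.scale_zero_right simp_thms)
  then obtain v where v: "v \<in> W" "v \<noteq> 0" using W(1) by blast
  then obtain m where m: "v m \<noteq> 0" by (metis ext zero_fun_apply)
  have v': "v \<in> grid_space N" "X v = pointwise (*) (w X) v" "Ys v = pointwise (*) (w Ys) v" using v W(2) by auto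
  have mt: "m \<in> triangle N" using m v' grid_spaceD by blast
  define x where "x = fst m"
  have supp: "u l = 0" if u: "u \<in> W" and l: "fst l \<noteq> x" for u l
  proof (cases "l \<in> triangle N")
    case True
    have ug: "u \<in> grid_space N" and uX: "X u = pointwise (*) (w X) u" using u W(2) by auto
    have "X u l = teig l * u l" by (simp only: X_apply[OF ug])
    moreover have "X u l = w X * u l" by (simp only: uX pointwise_times_apply)
    moreover have "X v m = teig m * v m" "X v m = w X * v m"
      by (simp only: X_apply[OF v'(1)]) (simp only: v'(2) pointwise_times_apply)
    then have "teig m = w X" using m by simp
    moreover have "teig l \<noteq> teig m"
      using inj_onD[OF L.q_pow_inj, of "fst l" "fst m"] l True mt L.q_nz
      by (auto simp: teig_def x_def triangle_def)
    ultimately show ?thesis by auto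
  next
    case False
    then show ?thesis using u W(2) grid_spaceD by blast
  qed
  have v0: "v (x, 0) \<noteq> 0"
  proof
    assume "v (x, 0) = 0"
    then have "v (x, snd m) = 0"
      by (rule column_recurrence[OF v'(1) _ v'(3)]) (use mt in \<open>auto simp: x_def triangle_def\<close>)
    with m show False by (simp add: x_def)
  qed
  have "W = grid.span {v}"
  proof (intro equalityI subsetI)
    fix u assume u: "u \<in> W"
    have u': "u \<in> grid_space N" "Ys u = pointwise (*) (w Ys) u" using u W(2) by auto
    \<comment> \<open>Chosen so that \<open>f\<close> vanishes at \<open>(x, 0)\<close>; as
      \<open>f\<close> is again an eigenvector of \<open>Ys\<close>, it is 0.\<close>
    define k where "k = u (x, 0) / v (x, 0)"
    define f where "f = u - pointwise (*) k v"
    have fg: "f \<in> grid_space N"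
      unfolding f_def by (intro grid.subspace_diff grid.subspace_scale subspace_grid_space u' v')
    have "Ys u = Ys (f + pointwise (*) k v)" by (simp add: f_def)
    also have "\<dots> = Ys f + Ys (pointwise (*) k v)"
      by (rule grid_endosD(2)[OF Q.G_endo fg]) (intro grid.subspace_scale subspace_grid_space v')
    also have "Ys (pointwise (*) k v) = pointwise (*) k (pointwise (*) (w Ys) v)"
      unfolding grid_endosD(3)[OF Q.G_endo v'(1)] v'(3) ..
    finally have "pointwise (*) (w Ys) u = Ys f + pointwise (*) k (pointwise (*) (w Ys) v)"
      unfolding u'(2) .
    then have "Ys f = pointwise (*) (w Ys) u - pointwise (*) k (pointwise (*) (w Ys) v)"
      by (simp only: add_diff_cancel_right')
    also have "\<dots> = pointwise (*) (w Ys) f"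
      unfolding f_def by (auto simp: fun_eq_iff pointwise_times_apply algebra_simps)
    finally have Ysf: "Ys f = pointwise (*) (w Ys) f" .
    have "f (x, 0) = 0" using v0 by (simp add: f_def k_def pointwise_times_apply)
    then have col: "f (x, y) = 0" if "x + y \<le> N" for y
      using column_recurrence[OF fg _ Ysf] that by blast
    have "f = 0"
    proof
      fix l
      show "f l = 0 l"
      proof (cases "fst l = x")
        case True
        then show ?thesis using col[of "snd l"] grid_spaceD[OF fg, of l] by (cases l) (auto simp: triangle_def)
      next
        case False
        then show ?thesis using supp[OF u False] supp[OF v(1) False] by (simp add: f_def pointwise_times_apply)
      qed
    qed
    then have "u = pointwise (*) k v" unfolding f_def by (simp only: right_minus_eq)
    then show "u \<in> grid.span {v}" by (auto simp: grid.span_singleton)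
  next
    fix u assume "u \<in> grid.span {v}"
    then obtain k where k: "u = pointwise (*) k v" by (auto simp: grid.span_singleton)
    show "u \<in> W"
      unfolding W(2) k
      using grid.subspace_scale[OF subspace_grid_space v'(1), of k]
      by (simp only: mem_Collect_eq grid_endosD(3)[OF P.F_endo v'(1)] grid_endosD(3)[OF Q.G_endo v'(1)]
          v'(2,3) grid.scale_scale mult.commute simp_thms)
  qed
  then show ?thesis using grid.dim_eq_card[of "{v}" W] v(2) by (simp add: grid.span_span)
qed

text \<open>\<open>teig\<close> depends on x alone, and \<open>column_k\<close> keeps x.\<close>

lemma X_Ys_commute: "X \<circ> Ys = Ys \<circ> X"
proof
  fix f
  show "(X \<circ> Ys) f = (Ys \<circ> X) f"
  proof (cases "f \<in> grid_space N")
    case True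
    have g: "Ys f \<in> grid_space N" "X f \<in> grid_space N"
      using True grid_endosD(1)[OF Q.G_endo] grid_endosD(1)[OF P.F_endo] by auto
    have "Ys (X f) = (\<lambda>l. teig l * Ys f l)"
      unfolding Ys_def
    proof (rule kernel_op_eqI[OF g(2)])
      show "(\<lambda>l. teig l * kernel_op N R.column_k f l) \<in> grid_space N"
        using g(1) by (auto simp: grid_space_def Ys_def)
      fix l assume l: "l \<in> triangle N"
      have "R.column_k l c * X f c = teig l * (R.column_k l c * f c)" for c
        using R.column_k_nzD(1)[of l c] by (cases "R.column_k l c = 0") (auto simp: X_apply[OF True] teig_def)
      then show "(\<Sum>c\<in>triangle N. R.column_k l c * X f c) = teig l * kernel_op N R.column_k f l"
        unfolding kernel_op_apply[OF True l] sum_distrib_left by (intro sum.cong refl)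
    qed
    moreover have "X (Ys f) = (\<lambda>l. teig l * Ys f l)"
      by (rule X_apply[OF g(1)])
    ultimately show ?thesis by (simp only: o_apply)
  next
    case False
    then have "X f = 0" "Ys f = 0"
      using grid_endosD(4)[OF P.F_endo] grid_endosD(4)[OF Q.G_endo] by auto
    then show ?thesis using P.F_0 Q.G_0 by (simp only: o_apply)
  qed
qed

lemma factorized:
  "factorized_A2_Leonard_pair (pointwise (*)) N (grid_space N) P.plane Q.plane
     (\<lambda>l. grid.span {grid_delta l}) (\<lambda>l. grid.span {S l}) (grid_form N weight) X Y Xs Ys"
proof (intro factorized_A2_Leonard_pair.intro A2_Leonard_pair.intro A2_Leonard_pair_axioms.intro
    factorized_A2_Leonard_pair_axioms.intro)
  interpret swp: q_hahn_pair N q \<sigma> \<rho> ss r \<mu> ms by (rule swap_pair)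
  show "complex_space (pointwise (*) :: complex \<Rightarrow> (nat \<times> nat \<Rightarrow> complex) \<Rightarrow> _)"
    by (rule grid.complex_space_axioms)
  show "1 \<le> N" by (rule N1)
  show "grid.subspace (grid_space N)" by (rule subspace_grid_space)
  show "grid.commuting_diagonalizable_plane (grid_space N) P.plane" by (rule P.plane)
  show "grid.commuting_diagonalizable_plane (grid_space N) Q.plane" by (rule Q.plane)
  show "bij_betw (\<lambda>l. grid.span {grid_delta l}) (triangle N) (grid.common_eigenspaces (grid_space N) P.plane)"
    by (rule P.eigenspaces_bij)
  show "bij_betw (\<lambda>l. grid.span {S l}) (triangle N) (grid.common_eigenspaces (grid_space N) Q.plane)"
    by (rule Q.eigenspaces_bij)
  show "h ` grid.span {grid_delta l} \<subseteq> grid.span (\<Union>c\<in>{c \<in> triangle N. adjacent c l}. grid.span {grid_delta c})"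
    if l: "l \<in> triangle N" and h: "h \<in> Q.plane" for l h
    by (rule P.adjacent_span[OF Q.F_endo Q.G_endo _ _ _ _ l h])
      (auto simp: Xs_def Ys_def kernel_op_delta[OF l] hex_adjacent column_adjacent)
  show "h ` grid.span {S l} \<subseteq> grid.span (\<Union>c\<in>{c \<in> triangle N. adjacent c l}. grid.span {S c})"
    if l: "l \<in> triangle N" and h: "h \<in> P.plane" for l h
    by (rule Q.adjacent_span[OF P.F_endo P.G_endo X_S[OF l] _ Y_S[OF l] _ l h])
      (rule adjacent_swap, rule swp.column_adjacent, assumption, rule adjacent_swap, rule swp.hex_adjacent, assumption)
  show "\<nexists>W. grid.subspace W \<and> W \<subseteq> grid_space N \<and> W \<noteq> {0} \<and> W \<noteq> grid_space N \<and>
        (\<forall>h\<in>P.plane. h ` W \<subseteq> W) \<and> (\<forall>h\<in>Q.plane. h ` W \<subseteq> W)"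
  proof
    assume "\<exists>W. grid.subspace W \<and> W \<subseteq> grid_space N \<and> W \<noteq> {0} \<and> W \<noteq> grid_space N \<and>
        (\<forall>h\<in>P.plane. h ` W \<subseteq> W) \<and> (\<forall>h\<in>Q.plane. h ` W \<subseteq> W)"
    then obtain W where W: "grid.subspace W" "W \<subseteq> grid_space N" "W \<noteq> {0}" "W \<noteq> grid_space N"
      "\<forall>h\<in>P.plane. h ` W \<subseteq> W" "\<forall>h\<in>Q.plane. h ` W \<subseteq> W"
      by (elim exE conjE)
    have "W = grid_space N"
      by (rule irreducible[OF W(1-3)]) (use W(5,6) in \<open>simp_all only: image_subset_iff\<close>)
    with W(4) show False by (rule notE)
  qed
  show "grid.dim (grid.span {grid_delta l}) = 1" if "l \<in> triangle N" for l
    using that by (rule P.dim_eigenspace)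
  show "grid.dim (grid.span {S l}) = 1" if "l \<in> triangle N" for l
    using that by (rule Q.dim_eigenspace)
  show "grid.nondeg_symmetric_form (grid_space N) (grid_form N weight)" by (rule form_nondeg)
  show "form_vanishes (grid_form N weight) (grid.span {grid_delta l}) (grid.span {grid_delta c})"
    if "l \<in> triangle N" "c \<in> triangle N" "l \<noteq> c" for l c
    using delta_orthogonal[OF that(2,3)] by (auto simp: form_vanishes_def grid.span_singleton grid_form_simps(3,4))
  show "form_vanishes (grid_form N weight) (grid.span {S l}) (grid.span {S c})"
    if "l \<in> triangle N" "c \<in> triangle N" "l \<noteq> c" for l c
    using S_orthogonal[OF that] by (auto simp: form_vanishes_def grid.span_singleton grid_form_simps(3,4))
  show "grid.basis_pair X Y P.plane" by (rule P.basis_pair)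
  show "grid.basis_pair Xs Ys Q.plane" by (rule Q.basis_pair)
  have inj: "inj_on (\<lambda>x. 1 / q ^ x - 1) {0..N}"
    using L.q_pow_inj L.q_nz by (auto simp: inj_on_def)
  show "\<exists>t. inj_on t {0..N} \<and> (\<forall>x y. (x, y) \<in> triangle N \<longrightarrow> (\<forall>v\<in>grid.span {grid_delta (x, y)}. X v = pointwise (*) (t x) v))"
    using inj P.eigenspace_scalar(1) by (intro exI[of _ "\<lambda>x. 1 / q ^ x - 1"]) (auto simp: teig_def)
  show "\<exists>t. inj_on t {0..N} \<and> (\<forall>i j. (i, j) \<in> triangle N \<longrightarrow> (\<forall>v\<in>grid.span {S (i, j)}. Ys v = pointwise (*) (t j) v))"
    using inj Q.eigenspace_scalar(2) by (intro exI[of _ "\<lambda>x. 1 / q ^ x - 1"]) (auto simp: tseig_def)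
  show "X \<circ> Ys = Ys \<circ> X" by (rule X_Ys_commute)
  show "grid.dim W = 1" if "W \<in> grid.common_eigenspaces (grid_space N) {X, Ys}" for W
    using that by (rule X_Ys_simple)
  have tri: "(i, j) \<in> triangle N" "(j, i) \<in> triangle N" "j + i < N" if "(i + 1, j) \<in> triangle N" for i j
    using that by (auto simp: triangle_def)
  show "\<not> form_vanishes (grid_form N weight) (grid.span {S (i + 1, j)}) (X ` grid.span {S (i, j)})"
    if "(i + 1, j) \<in> triangle N" for i j
  proof (rule Q.not_form_vanishes[where P = X and K = "\<lambda>k. L.column_k (prod.swap (i, j)) (prod.swap k)",
        OF X_S[OF tri(1)[OF that]] that])
    \<comment> \<open>The exchange makes i the vertical coordinate: this entry stands next to the
      diagonal in column j of the exchanged system.\<close>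
    show "L.column_k (prod.swap (i, j)) (prod.swap (i + 1, j)) \<noteq> 0"
      using L.column_k_offdiag(1)[OF tri(3)[OF that]] by simp
  qed (use that S_orthogonal S_norm in auto)
  show "\<not> form_vanishes (grid_form N weight) (grid.span {S (i, j)}) (X ` grid.span {S (i + 1, j)})"
    if "(i + 1, j) \<in> triangle N" for i j
  proof (rule Q.not_form_vanishes[where P = X and K = "\<lambda>k. L.column_k (prod.swap (i + 1, j)) (prod.swap k)",
        OF X_S[OF that] tri(1)[OF that]])
    show "L.column_k (prod.swap (i + 1, j)) (prod.swap (i, j)) \<noteq> 0"
      using L.column_k_offdiag(2)[OF tri(3)[OF that]] by simp
  qed (use tri(1)[OF that] S_orthogonal S_norm in auto)
  have tri': "(x, y) \<in> triangle N" "x + y < N" if "(x, y + 1) \<in> triangle N" for x y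
    using that by (auto simp: triangle_def)
  show "\<not> form_vanishes (grid_form N weight) (grid.span {grid_delta (x, y + 1)}) (Ys ` grid.span {grid_delta (x, y)})"
    if "(x, y + 1) \<in> triangle N" for x y
  proof (rule P.not_form_vanishes[where P = Ys and K = "\<lambda>k. R.column_k k (x, y)",
        OF kernel_op_delta[OF tri'(1)[OF that], of R.column_k, folded Ys_def] that])
    show "R.column_k (x, y + 1) (x, y) \<noteq> 0"
      using R.column_k_offdiag(2)[OF tri'(2)[OF that]] by simp
  qed (use that delta_orthogonal delta_norm in auto)
  show "\<not> form_vanishes (grid_form N weight) (grid.span {grid_delta (x, y)}) (Ys ` grid.span {grid_delta (x, y + 1)})"
    if "(x, y + 1) \<in> triangle N" for x y
  proof (rule P.not_form_vanishes[where P = Ys and K = "\<lambda>k. R.column_k k (x, y + 1)",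
        OF kernel_op_delta[OF that, of R.column_k, folded Ys_def] tri'(1)[OF that]])
    show "R.column_k (x, y) (x, y + 1) \<noteq> 0"
      using R.column_k_offdiag(1)[OF tri'(2)[OF that]] by simp
  qed (use tri'(1)[OF that] delta_orthogonal delta_norm in auto)
qed

end

section \<open>The parameter arrays and the coefficients \<open>T\<close>\<close>

lemma tstar_eig_eq:
  assumes "q \<noteq> 0"
  shows "tstar_eig N q ms ss j x = ms * (q ^ N / q ^ j) * (1 / q ^ x - 1) * (1 - ss * q ^ (j + x + 1))"
proof -
  have "int j + int x + 1 = int (j + x + 1)" by simp
  then have "q powi (int j + int x + 1) = q ^ (j + x + 1)" by (simp only: power_int_of_nat)
  moreover have "q powi (int N - int j) = q ^ N / q ^ j"
    using assms by (simp add: power_int_diff)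
  ultimately show ?thesis
    by (simp add: tstar_eig_def power_int_minus divide_inverse)
qed

lemma theta_eig_eq: "theta_eig = tstar_eig"
  by (auto simp: fun_eq_iff theta_eig_def tstar_eig_def)

lemma t_eig_eq: "t_eig q x = 1 / q ^ x - 1"
  by (simp add: t_eig_def power_int_minus divide_inverse)

lemma tstar_eig_inj_imp:
  assumes "inj_on (tstar_eig N q ms ss 0) {0..N}" "q \<noteq> 0" "2 \<le> k" "k \<le> 2 * N"
  shows "ss * q ^ k \<noteq> 1"
proof
  assume k: "ss * q ^ k = 1"
  \<comment> \<open>A pair x < y <= N with x + y + 1 = k: truncation gives (0, k-1) for k <= N + 1
    and (k-1-N, N) otherwise. The difference of the two eigenvalues contains 1 - s q^k, so they
    would collide.\<close>
  define x where "x = k - 1 - N"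
  define y where "y = k - 1 - x"
  have xy: "x + y + 1 = k" "x < y" "y \<le> N" using assms(3,4) by (auto simp: x_def y_def)
  have "tstar_eig N q ms ss 0 x - tstar_eig N q ms ss 0 y
    = ms * q ^ N * ((1 / q ^ x - 1 / q ^ y) * (1 - ss * q ^ (x + y + 1)))"
  proof -
    have "(1 / A - 1) * (1 - s * A) - (1 / B - 1) * (1 - s * B) = (1 / A - 1 / B) * (1 - s * A * B)"
      if "A \<noteq> 0" "B \<noteq> 0" for A B s :: complex using that by (simp add: field_simps)
    from this[of "q ^ x" "q ^ y" "ss * q"]
    have "(1 / q ^ x - 1) * (1 - ss * q * q ^ x) - (1 / q ^ y - 1) * (1 - ss * q * q ^ y)
      = (1 / q ^ x - 1 / q ^ y) * (1 - ss * q * q ^ x * q ^ y)" using assms(2) by simp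
    moreover have "tstar_eig N q ms ss 0 z = ms * q ^ N * ((1 / q ^ z - 1) * (1 - ss * q * q ^ z))" for z
      by (simp add: tstar_eig_eq[OF assms(2)] mult_ac)
    moreover have "ss * q * q ^ x * q ^ y = ss * q ^ (x + y + 1)" by (simp add: power_add mult_ac)
    ultimately show ?thesis by (simp only: right_diff_distrib[of "ms * q ^ N", symmetric])
  qed
  then have "tstar_eig N q ms ss 0 x = tstar_eig N q ms ss 0 y" unfolding xy(1) k by simp
  then show False using inj_onD[OF assms(1), of x y] xy by auto
qed

lemma t_eig_inj_imp:
  assumes "inj_on (t_eig q) {0..N}" "1 \<le> k" "k \<le> N"
  shows "q ^ k \<noteq> 1"
proof
  assume "q ^ k = 1"
  then have "t_eig q k = t_eig q 0" by (simp add: t_eig_eq)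
  then show False using inj_onD[OF assms(1), of k 0] assms(2,3) by auto
qed

text \<open>Distinctness of the two eigenvalue sequences gives \<open>q_pow\<close> and
  \<open>sigma_pow\<close>; the last factors of \<open>f_par\<close> and \<open>g_par\<close> give
  \<open>rho_pow\<close> and \<open>rho_sigma\<close>.\<close>

lemma q_hahn_of_first_array:
  assumes "1 \<le> N" "q \<noteq> 0"
    and "parameter_array N (t_eig q) (tstar_eig N q ms ss 0) (f_par N q ms r 0) (g_par N q ms ss r 0)"
  shows "q_hahn N q ss r" "ms \<noteq> 0"
proof -
  have inj: "inj_on (t_eig q) {0..N}" "inj_on (tstar_eig N q ms ss 0) {0..N}"
    and nz: "\<And>i. \<lbrakk>1 \<le> i; i \<le> N\<rbrakk> \<Longrightarrow> f_par N q ms r 0 i \<noteq> 0 \<and> g_par N q ms ss r 0 i \<noteq> 0"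
    using assms(3) unfolding parameter_array_def by auto
  show "ms \<noteq> 0" using nz[of 1] assms(1) by (auto simp: f_par_def)
  show "q_hahn N q ss r"
  proof
    fix k assume k: "1 \<le> k" "k \<le> N"
    show "r * q ^ k \<noteq> 1" "r \<noteq> ss * q ^ k" using nz[OF k] by (auto simp: f_par_def g_par_def)
  next
    show "q \<noteq> 0" by (rule assms(2))
    show "q ^ k \<noteq> 1" if "1 \<le> k" "k \<le> N" for k using inj(1) that by (rule t_eig_inj_imp)
    show "ss * q ^ k \<noteq> 1" if "2 \<le> k" "k \<le> 2 * N" for k
      using inj(2) assms(2) that by (rule tstar_eig_inj_imp)
  qed
qed

lemma q_hahn_of_second_array:
  assumes "1 \<le> N" "q \<noteq> 0"
    and "parameter_array N (theta_eig N q \<mu> \<sigma> 0) (thetastar_eig q) (varphi_par N q \<mu> \<rho> 0) (phi_par N q \<mu> \<sigma> \<rho> 0)"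
  shows "q_hahn N q \<sigma> \<rho>" "\<mu> \<noteq> 0"
proof -
  have "thetastar_eig q = t_eig q" by (simp add: fun_eq_iff thetastar_eig_def t_eig_def)
  then have inj: "inj_on (t_eig q) {0..N}" "inj_on (tstar_eig N q \<mu> \<sigma> 0) {0..N}"
    and nz: "\<And>i. \<lbrakk>1 \<le> i; i \<le> N\<rbrakk> \<Longrightarrow> varphi_par N q \<mu> \<rho> 0 i \<noteq> 0 \<and> phi_par N q \<mu> \<sigma> \<rho> 0 i \<noteq> 0"
    using assms(3) unfolding parameter_array_def theta_eig_eq by auto
  show "\<mu> \<noteq> 0" using nz[of 1] assms(1) by (auto simp: varphi_par_def)
  show "q_hahn N q \<sigma> \<rho>"
  proof
    fix k assume k: "1 \<le> k" "k \<le> N"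
    show "\<rho> * q ^ k \<noteq> 1" using nz[OF k] by (auto simp: varphi_par_def)
    \<comment> \<open>The reversed index turns the exponent j - N - 1 in \<open>phi_par\<close> into
      -k.\<close>
    define j where "j = N + 1 - k"
    have j: "1 \<le> j" "j \<le> N" "int j - int N - 1 = - int k" using k by (auto simp: j_def)
    then have "\<sigma> - \<rho> * q powi (- int k) \<noteq> 0" using nz[OF j(1,2)] by (simp add: phi_par_def)
    then show "\<rho> \<noteq> \<sigma> * q ^ k" using assms(2) by (auto simp: power_int_minus)
  next
    show "q \<noteq> 0" by (rule assms(2))
    show "q ^ k \<noteq> 1" if "1 \<le> k" "k \<le> N" for k using inj(1) that by (rule t_eig_inj_imp)
    show "\<sigma> * q ^ k \<noteq> 1" if "2 \<le> k" "k \<le> 2 * N" for k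
      using inj(2) assms(2) that by (rule tstar_eig_inj_imp)
  qed
qed

lemma (in q_hahn) phi32_eq_dual_hahn:
  assumes "x + y \<le> N" "j \<le> N"
  shows "phi32 (min j y) (1 / q ^ j) (1 / q ^ y) (\<sigma> * q ^ (x + y + 1)) (\<rho> * q) (q ^ x / q ^ N) q q = dual_hahn j y x"
proof -
  have eq: "dual_hahn j y x = (\<Sum>k\<in>{0..min j y}. cf y x k * qpoch (1 / q ^ j) q k)"
    unfolding dual_hahn_def
    by (rule sum.mono_neutral_right) (use assms in \<open>auto simp: cf_def inv_pow_qpoch_0\<close>)
  have gen: "A * B * C / D * E = B * C / D * E * A" for A B C D E :: complex by simp
  show ?thesis unfolding eq unfolding phi32_def cf_def by (intro sum.cong refl gen)
qed

section \<open>Comparison of the functions S with the coefficients T\<close>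

context q_hahn_pair begin

text \<open>The part of T free of x and y. The q-binomial of N - x over j is split three ways: 1/(q;
  q)_j goes here, 1/(q; q)_(N-x-j) is in \<open>S\<close>, and (q; q)_(N-x) is left to the
  normalisation of the vectors V_{x,y}.\<close>

definition scaling :: "nat \<Rightarrow> nat \<Rightarrow> complex" where
  "scaling i j =
     ((-1) ^ j * q powi ((int j * (int j - 3 - 2 * int N)) div 2) *
      qpoch (r * q) q i * qpoch (ss * q ^ (j + 2)) q (N - j) * qpoch (\<rho> * q) q j) /
     ((r * q) ^ i * qpoch (ss * q ^ (j + 1) / r) q i * qpoch (ss * q ^ (i + j + 1)) q i *
      qpoch (ss * q ^ (2 + 2 * i + j)) q (N - i - j) *
      \<sigma> ^ j * qpoch (q powi (- int N) * \<rho> / \<sigma>) q j) *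
     qbinomial q (N - j) i / qpoch q q j"

lemma scaling_nz:
  assumes "(i, j) \<in> triangle N" "r \<noteq> 0" "\<sigma> \<noteq> 0"
  shows "scaling i j \<noteq> 0"
proof -
  have ij: "i + j \<le> N" using assms by (simp add: triangle_def)
  have s: "qpoch (ss * q ^ a) q n \<noteq> 0" if "2 \<le> a \<or> n = 0" "n \<noteq> 0 \<Longrightarrow> a + n \<le> 2 * N + 1" for a n
    using L.sigma_pow[of "a + _"] that by (auto simp: qpoch_eq_0_iff mult.assoc simp flip: power_add)
  have 1: "qpoch (ss * q ^ (j + 1) / r) q i \<noteq> 0"
    unfolding qpoch_eq_0_iff
  proof safe
    fix k assume k: "k < i" "ss * q ^ (j + 1) / r * q ^ k = 1"
    then have "r = ss * q ^ (j + 1 + k)" using assms(2) by (simp add: field_simps power_add)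
    then show False using L.rho_sigma[of "j + 1 + k"] k ij by auto
  qed
  have 2: "qpoch (q powi (- int N) * \<rho> / \<sigma>) q j \<noteq> 0"
    unfolding qpoch_eq_0_iff
  proof safe
    fix k assume k: "k < j" "q powi (- int N) * \<rho> / \<sigma> * q ^ k = 1"
    then have "\<rho> * q ^ k = \<sigma> * q ^ N" using assms(3) L.q_nz by (simp add: field_simps power_int_minus)
    also have "q ^ N = q ^ (N - k) * q ^ k" using k ij by (simp flip: power_add)
    finally have "\<rho> = \<sigma> * q ^ (N - k)" using L.q_nz by simp
    then show False using R.rho_sigma[of "N - k"] k ij by auto
  qed
  have 3: "qbinomial q (N - j) i \<noteq> 0" "qpoch q q j \<noteq> 0"
    using L.q_qpoch_nz ij by (auto simp: qbinomial_def)
  have 4: "qpoch (r * q) q i \<noteq> 0" "qpoch (\<rho> * q) q j \<noteq> 0"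
    using L.rho_qpoch_nz R.rho_qpoch_nz ij by auto
  have 5: "qpoch (ss * q ^ (j + 2)) q (N - j) \<noteq> 0" by (rule s) (use ij in auto)
  have 6: "qpoch (ss * q ^ (i + j + 1)) q i \<noteq> 0" by (rule s) (use ij in \<open>cases i; simp\<close>)+
  have 7: "qpoch (ss * q ^ (2 + 2 * i + j)) q (N - i - j) \<noteq> 0" by (rule s) (use ij in auto)
  show ?thesis
    unfolding scaling_def
    using 1 2 3 4 5 6 7 assms(2,3) L.q_nz
    by (simp only: mult_eq_0_iff divide_eq_0_iff power_eq_0_iff power_int_eq_0_iff de_Morgan_disj neg_equal_0_iff_equal
        one_neq_zero simp_thms)
qed

lemma T_coeff_eq:
  assumes "(i, j) \<in> triangle N" "(x, y) \<in> triangle N" "x + j \<le> N"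
  shows "T_coeff N q ss r \<sigma> \<rho> i j x y = scaling i j * S (i, j) (x, y) * qpoch q q (N - x)"
proof -
  have le: "j + i \<le> N" "x \<le> N" "x + y \<le> N" "j \<le> N" using assms by (auto simp: triangle_def)
  have p1: "q powi (- int a) = 1 / q ^ a" for a
    by (simp add: power_int_minus divide_inverse)
  have p2: "q powi (- int N + int a) = q ^ a / q ^ N" for a
    using power_int_diff[of q "int a" "int N"] L.q_nz by (simp add: add.commute[of _ "int a"])
  have d1: "phi32 (min i x) (1 / q ^ i) (1 / q ^ x) (ss * q ^ (i + j + 1)) (r * q) (q ^ j / q ^ N) q q = L.dual_hahn x i j"
    unfolding L.phi32_eq_dual_hahn[OF le(1,2), symmetric] phi32_def
    by (simp only: min.commute[of i] mult.commute[of "qpoch (1 / q ^ x) q _"] add.commute[of i])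
  have d2: "phi32 (min j y) (1 / q ^ j) (1 / q ^ y) (\<sigma> * q ^ (x + y + 1)) (\<rho> * q) (q ^ x / q ^ N) q q = R.dual_hahn j y x"
    by (rule R.phi32_eq_dual_hahn[OF le(3,4)])
  have nz: "qpoch q q (N - x) \<noteq> 0" "qpoch q q j \<noteq> 0" "qpoch q q (N - x - j) \<noteq> 0"
    using L.q_qpoch_nz le by auto
  have Sv: "S (i, j) (x, y) = L.dual_hahn x i j * R.dual_hahn j y x / qpoch q q (N - x - j)"
    using assms by (simp add: S_def)
  have "T_coeff N q ss r \<sigma> \<rho> i j x y
    = (scaling i j * qpoch q q j) * qbinomial q (N - x) j * L.dual_hahn x i j * R.dual_hahn j y x"
  proof -
    have "T_coeff N q ss r \<sigma> \<rho> i j x y = scaling i j * qpoch q q j * qbinomial q (N - x) j *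
      phi32 (min i x) (q powi (- int i)) (q powi (- int x)) (ss * q ^ (i + j + 1)) (r * q) (q powi (- int N + int j)) q q *
      phi32 (min j y) (q powi (- int j)) (q powi (- int y)) (\<sigma> * q ^ (x + y + 1)) (\<rho> * q) (q powi (- int N + int x)) q q"
    proof -
      have "A * B * C * D * E = A * B / k * k * C * D * E" if "k \<noteq> 0" for A B C D E k :: complex
        using that by simp
      from this[OF nz(2)] show ?thesis unfolding T_coeff_def scaling_def .
    qed
    then show ?thesis unfolding p1 p2 d1 d2 .
  qed
  then show ?thesis unfolding Sv qbinomial_def[of q "N - x" j] using nz by (simp add: mult_ac)
qed

text \<open>Stopping at x = N - j loses nothing, because \<open>S (i, j)\<close> is 0
  beyond.\<close>

lemma expansion:
  assumes "(i, j) \<in> triangle N"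
  shows "pointwise (*) (scaling i j) (S (i, j)) = (\<Sum>x = 0..N - j. \<Sum>y = 0..N - x.
     pointwise (*) (T_coeff N q ss r \<sigma> \<rho> i j x y) (pointwise (*) (1 / qpoch q q (N - x)) (grid_delta (x, y))))"
    (is "?l = ?r")
proof
  fix m :: "nat \<times> nat"
  obtain a b where m: "m = (a, b)" by (cases m)
  have j: "j \<le> N" using assms by (simp add: triangle_def)
  have "?r m = (\<Sum>x = 0..N - j. \<Sum>y = 0..N - x. scaling i j * S (i, j) (x, y) * (if (a, b) = (x, y) then 1 else 0))"
    unfolding sum_fun_apply pointwise_times_apply m grid_delta_def
  proof (intro sum.cong refl)
    fix x y assume "x \<in> {0..N - j}" "y \<in> {0..N - x}"
    then have "(x, y) \<in> triangle N" "x + j \<le> N" using j by (auto simp: triangle_def)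
    then show "T_coeff N q ss r \<sigma> \<rho> i j x y * (1 / qpoch q q (N - x) * (if (a, b) = (x, y) then 1 else 0))
      = scaling i j * S (i, j) (x, y) * (if (a, b) = (x, y) then 1 else 0)"
      using T_coeff_eq[OF assms] L.q_qpoch_nz[of "N - x"] by simp
  qed
  also have "\<dots> = (\<Sum>x = 0..N - j. if x = a then (\<Sum>y = 0..N - x. if y = b then scaling i j * S (i, j) (a, b) else 0) else 0)"
  proof (intro sum.cong refl)
    fix x
    show "(\<Sum>y = 0..N - x. scaling i j * S (i, j) (x, y) * (if (a, b) = (x, y) then 1 else 0))
      = (if x = a then (\<Sum>y = 0..N - x. if y = b then scaling i j * S (i, j) (a, b) else 0) else 0)"
    proof (cases "x = a")
      case True
      show ?thesis unfolding True if_P[OF refl] by (intro sum.cong refl) auto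
    qed simp
  qed
  also have "\<dots> = scaling i j * S (i, j) (a, b)"
    using j by (auto simp: S_def triangle_def if_distrib cong: if_cong)
  finally show "?l m = ?r m" by (simp add: m pointwise_times_apply)
qed

end
theorem mainTheorem4:
  fixes N :: nat and q ms ss r \<mu> \<sigma> \<rho> :: complex
  assumes "N \<ge> 1" and "q \<noteq> 0"
    and "\<And>j. j \<le> N \<Longrightarrow>
      parameter_array (N - j) (t_eig q) (tstar_eig N q ms ss j) (f_par N q ms r j) (g_par N q ms ss r j)"
    and "\<And>x. x \<le> N \<Longrightarrow>
      parameter_array (N - x) (theta_eig N q \<mu> \<sigma> x) (thetastar_eig q)
        (varphi_par N q \<mu> \<rho> x) (phi_par N q \<mu> \<sigma> \<rho> x)"
    and "r \<noteq> 0" and "\<sigma> \<noteq> 0"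
  shows "\<exists>(V :: (nat \<times> nat \<Rightarrow> complex) set) H Hs E Es B X Y Xs Ys v vs.
    grid.subspace V \<and> grid.dim V = (N + 2) choose 2 \<and>
    factorized_A2_Leonard_pair (pointwise (*)) N V H Hs E Es B X Y Xs Ys \<and>
    (\<forall>x y. (x, y) \<in> triangle N \<longrightarrow>
       v x y \<in> E (x, y) \<and> v x y \<noteq> 0 \<and>
       X (v x y) = pointwise (*) (t_eig q x) (v x y) \<and>
       Y (v x y) = pointwise (*) (theta_eig N q \<mu> \<sigma> x y) (v x y)) \<and>
    (\<forall>i j. (i, j) \<in> triangle N \<longrightarrow>
       vs i j \<in> Es (i, j) \<and> vs i j \<noteq> 0 \<and>
       Xs (vs i j) = pointwise (*) (tstar_eig N q ms ss j i) (vs i j) \<and>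
       Ys (vs i j) = pointwise (*) (thetastar_eig q j) (vs i j) \<and>
       vs i j = (\<Sum>x = 0..N - j. \<Sum>y = 0..N - x.
                   pointwise (*) (T_coeff N q ss r \<sigma> \<rho> i j x y) (v x y)))"
proof -
  interpret q_hahn_pair N q ss r \<sigma> \<rho> ms \<mu>
    using q_hahn_of_first_array[of N q ms ss r] q_hahn_of_second_array[of N q \<mu> \<sigma> \<rho>]
      assms(1,2) assms(3,4)[of 0]
    by (intro q_hahn_pair.intro q_hahn_pair_axioms.intro) simp_all
  \<comment> \<open>This scaling cancels the factor (q; q)_(N-x) in
    \<open>T_coeff_eq\<close>.\<close>
  define v where "v x y = pointwise (*) (1 / qpoch q q (N - x)) (grid_delta (x, y))" for x y
  define vs where "vs i j = pointwise (*) (scaling i j) (S (i, j))" for i j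
  have v: "v x y \<in> grid.span {grid_delta (x, y)} \<and> v x y \<noteq> 0 \<and>
       X (v x y) = pointwise (*) (t_eig q x) (v x y) \<and>
       Y (v x y) = pointwise (*) (theta_eig N q \<mu> \<sigma> x y) (v x y)" if "(x, y) \<in> triangle N" for x y
  proof -
    have span: "v x y \<in> grid.span {grid_delta (x, y)}"
      unfolding v_def by (intro grid.span_scale grid.span_base) simp
    have "v x y \<noteq> 0"
      using L.q_qpoch_nz[of "N - x"] P.e_nz[OF that] by (simp add: v_def grid.scale_eq_0_iff)
    moreover have "teig (x, y) = t_eig q x" "theig (x, y) = theta_eig N q \<mu> \<sigma> x y"
      by (simp_all add: teig_def theig_def t_eig_eq theta_eig_eq tstar_eig_eq[OF L.q_nz])
    ultimately show ?thesis using span P.eigenspace_scalar[OF that span] by (simp only: simp_thms)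
  qed
  have vs: "vs i j \<in> grid.span {S (i, j)} \<and> vs i j \<noteq> 0 \<and>
       Xs (vs i j) = pointwise (*) (tstar_eig N q ms ss j i) (vs i j) \<and>
       Ys (vs i j) = pointwise (*) (thetastar_eig q j) (vs i j) \<and>
       vs i j = (\<Sum>x = 0..N - j. \<Sum>y = 0..N - x. pointwise (*) (T_coeff N q ss r \<sigma> \<rho> i j x y) (v x y))"
    if "(i, j) \<in> triangle N" for i j
  proof -
    have span: "vs i j \<in> grid.span {S (i, j)}"
      unfolding vs_def by (intro grid.span_scale grid.span_base) simp
    have "vs i j \<noteq> 0"
      using scaling_nz[OF that assms(5,6)] Q.e_nz[OF that] by (simp add: vs_def grid.scale_eq_0_iff)
    moreover have "tstar (i, j) = tstar_eig N q ms ss j i" "tseig (i, j) = thetastar_eig q j"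
      by (simp_all add: tstar_def tseig_def thetastar_eig_def tstar_eig_eq[OF L.q_nz] power_int_minus divide_inverse)
    moreover have "vs i j = (\<Sum>x = 0..N - j. \<Sum>y = 0..N - x. pointwise (*) (T_coeff N q ss r \<sigma> \<rho> i j x y) (v x y))"
      unfolding vs_def v_def by (rule expansion[OF that])
    ultimately show ?thesis using span Q.eigenspace_scalar[OF that span] by (metis (no_types))
  qed
  show ?thesis
    by (rule exI[of _ "grid_space N"], rule exI[of _ P.plane], rule exI[of _ Q.plane],
        rule exI[of _ "\<lambda>l. grid.span {grid_delta l}"], rule exI[of _ "\<lambda>l. grid.span {S l}"],
        rule exI[of _ "grid_form N weight"], rule exI[of _ X], rule exI[of _ Y], rule exI[of _ Xs],
        rule exI[of _ Ys], rule exI[of _ v], rule exI[of _ vs],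
        rule conjI[OF subspace_grid_space conjI[OF P.grid_space_dim conjI[OF factorized conjI]]])
      (use v vs in blast)+
qed

end
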